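(* Let $n \geq 2$, let $F_n$ be the free group of rank $n$, and let $\varphi \in \mathrm{Aut}(F_n)$ be a virtually inner automorphism of $F_n$. Let $F_n(t) = F_n \rtimes \langle t \rangle$ be the semi-direct product of $F_n$ with a cyclic group $\langle t \rangle$ (of infinite or finite order) in which conjugation by $t$ induces $\varphi$, i.e. $t^{-1} f t = \varphi(f)$ for all $f \in F_n$. Then the conjugacy problem is solvable for $F_n(t)$.
   Context: An automorphism $\varphi \in \mathrm{Aut}(F_n)$ is called virtually inner if $\varphi^m \in \mathrm{Inn}(F_n)$ for some positive integer $m$, where $\mathrm{Inn}(F_n)$ is the group of inner automorphisms of $F_n$. The group $F_n$ is free on $x_1,\dots,x_n$, and $F_n \triangleleft F_n(t)$. If $t$ has finite order $|t|$, then (for the semi-direct product to make sense) $\varphi^{|t|}$ is the identity. Every element of $F_n(t)$ can be written uniquely as $t^{\ell} V$, where $V$ is a reduced word in $x_1^{\pm 1},\dots,x_n^{\pm 1}$ and $\ell \in \mathbb{Z}$ if $t$ has infinite order, $0 \leq \ell < |t|$ if $t$ has finite order. The conjugacy problem for a group with a given generating set (here $x_1,\dots,x_n,t$) is solvable if there is an algorithm which, given two words in the generators and their inverses, decides whether the elements they represent are conjugate in the group. *)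

theory Defs
  imports "HOL-Algebra.Algebra" "HOL-Library.Nat_Bijection"
begin

section \<open>Words and free groups\<close>

text \<open>The letter \<open>(i, False)\<close> stands for the \<open>i\<close>-th generator and \<open>(i, True)\<close> for its formal inverse.
  Generators are numbered from 0.\<close>

type_synonym letter = "nat \<times> bool"
type_synonym word = "letter list"

definition inv_letter :: "letter \<Rightarrow> letter" where
  "inv_letter a = (fst a, \<not> snd a)"

definition words_over :: "nat \<Rightarrow> word set" where
  "words_over k = {w. set w \<subseteq> {..<k} \<times> UNIV}"

definition reduced :: "word \<Rightarrow> bool" where
  "reduced w = successively (\<lambda>a b. b \<noteq> inv_letter a) w"

fun cons_reduce :: "letter \<Rightarrow> word \<Rightarrow> word" where
  "cons_reduce a [] = [a]"
| "cons_reduce a (b # w) = (if b = inv_letter a then w else a # b # w)"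

definition free_reduce :: "word \<Rightarrow> word" where
  "free_reduce w = foldr cons_reduce w []"

definition free_group :: "nat \<Rightarrow> word monoid" where
  "free_group n =
     \<lparr>carrier = {w \<in> words_over n. reduced w},
      monoid.mult = (\<lambda>u v. free_reduce (u @ v)),
      one = []\<rparr>"

lemma inv_letter_inv_letter [simp]: "inv_letter (inv_letter a) = a"
  by (simp add: inv_letter_def)

lemma inv_letter_neq [simp]: "inv_letter a \<noteq> a" "a \<noteq> inv_letter a"
  by (simp_all add: inv_letter_def prod_eq_iff)

lemma reduced_Nil [simp]: "reduced []"
  by (simp add: reduced_def)

lemma reduced_Cons: "reduced (a # w) \<longleftrightarrow> w = [] \<or> (hd w \<noteq> inv_letter a \<and> reduced w)"
  by (auto simp: reduced_def successively_Cons)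

lemma reduced_cons_reduce: "reduced w \<Longrightarrow> reduced (cons_reduce a w)"
  by (cases w) (auto simp: reduced_Cons)

lemma cons_reduce_cancel: "reduced w \<Longrightarrow> cons_reduce a (cons_reduce (inv_letter a) w) = w"
  by (cases w rule: list.exhaust; cases "tl w") (auto simp: reduced_Cons)

lemma reduced_foldr_cons_reduce: "reduced w \<Longrightarrow> reduced (foldr cons_reduce u w)"
  by (induction u) (auto simp: reduced_cons_reduce)

lemma reduced_free_reduce [simp]: "reduced (free_reduce w)"
  by (simp add: free_reduce_def reduced_foldr_cons_reduce)

lemma free_reduce_reduced [simp]: "reduced w \<Longrightarrow> free_reduce w = w"
proof (induction w)
  case (Cons a w)
  then show ?case
    by (cases w) (auto simp: reduced_Cons free_reduce_def)
qed (simp add: free_reduce_def)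

lemma foldr_cons_reduce_free_reduce:
  assumes "reduced w"
  shows "foldr cons_reduce (free_reduce u) w = foldr cons_reduce u w"
proof (induction u)
  case Nil
  then show ?case by (simp add: free_reduce_def)
next
  case (Cons a u)
  have *: "foldr cons_reduce (cons_reduce a r) w = cons_reduce a (foldr cons_reduce r w)" for r
  proof (cases r)
    case (Cons b s)
    have "cons_reduce a (cons_reduce (inv_letter a) (foldr cons_reduce s w)) = foldr cons_reduce s w"
      by (intro cons_reduce_cancel reduced_foldr_cons_reduce assms)
    then show ?thesis using Cons by auto
  qed simp
  have "free_reduce (a # u) = cons_reduce a (free_reduce u)"
    by (simp add: free_reduce_def)
  then show ?case using Cons * by simp
qed

lemma free_reduce_append: "free_reduce (u @ v) = foldr cons_reduce u (free_reduce v)"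
  by (simp add: free_reduce_def)

lemma free_reduce_append_left: "free_reduce (free_reduce u @ v) = free_reduce (u @ v)"
  by (simp add: free_reduce_append foldr_cons_reduce_free_reduce)

lemma free_reduce_append_right: "free_reduce (u @ free_reduce v) = free_reduce (u @ v)"
  by (simp add: free_reduce_append)

lemma set_cons_reduce: "set (cons_reduce a w) \<subseteq> insert a (set w)"
  by (cases w) auto

lemma set_free_reduce: "set (free_reduce w) \<subseteq> set w"
proof (induction w)
  case (Cons a w)
  have "free_reduce (a # w) = cons_reduce a (free_reduce w)"
    by (simp add: free_reduce_def)
  then show ?case using Cons set_cons_reduce[of a "free_reduce w"] by auto
qed (simp add: free_reduce_def)

lemma free_reduce_inverse: "free_reduce (rev (map inv_letter w) @ w) = []"
proof (induction w)
  case Nil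
  then show ?case by (simp add: free_reduce_def)
next
  case (Cons a w)
  have "cons_reduce (inv_letter a) (cons_reduce a (free_reduce w)) = free_reduce w"
    using cons_reduce_cancel[of "free_reduce w" "inv_letter a"] by simp
  then show ?case using Cons by (simp add: free_reduce_def)
qed

theorem group_free_group: "group (free_group n)"
proof (rule groupI)
  fix x y assume "x \<in> carrier (free_group n)" "y \<in> carrier (free_group n)"
  then show "x \<otimes>\<^bsub>free_group n\<^esub> y \<in> carrier (free_group n)"
    using set_free_reduce[of "x @ y"] by (auto simp: free_group_def words_over_def)
next
  fix x assume x: "x \<in> carrier (free_group n)"
  show "\<exists>y\<in>carrier (free_group n). y \<otimes>\<^bsub>free_group n\<^esub> x = \<one>\<^bsub>free_group n\<^esub>"
  proof
    show "free_reduce (rev (map inv_letter x)) \<in> carrier (free_group n)"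
      using x set_free_reduce[of "rev (map inv_letter x)"]
      by (fastforce simp: free_group_def words_over_def inv_letter_def)
  qed (simp add: free_group_def free_reduce_append_left free_reduce_inverse)
qed (auto simp: free_group_def words_over_def free_reduce_append_left free_reduce_append_right)


section \<open>Inner and virtually inner automorphisms\<close>

definition Inn :: "('a, 'b) monoid_scheme \<Rightarrow> ('a \<Rightarrow> 'a) set" where
  "Inn G = {\<lambda>x\<in>carrier G. inv\<^bsub>G\<^esub> g \<otimes>\<^bsub>G\<^esub> x \<otimes>\<^bsub>G\<^esub> g | g. g \<in> carrier G}"

definition virtually_inner :: "('a, 'b) monoid_scheme \<Rightarrow> ('a \<Rightarrow> 'a) \<Rightarrow> bool" where
  "virtually_inner G \<phi> \<longleftrightarrow>
     \<phi> \<in> auto G \<and> (\<exists>m::nat. m > 0 \<and> \<phi> [^]\<^bsub>AutoGroup G\<^esub> m \<in> Inn G)"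


section \<open>Semidirect products\<close>

text \<open>The pair \<open>(h, x)\<close> stands for the product \<open>h x\<close>, and \<open>h\<^sup>-\<^sup>1 x h = \<theta> h x\<close>: the group \<open>H\<close> acts on
  \<open>N\<close> from the right.\<close>

definition semidirect_product ::
  "('h, 'c) monoid_scheme \<Rightarrow> ('a, 'd) monoid_scheme \<Rightarrow> ('h \<Rightarrow> 'a \<Rightarrow> 'a) \<Rightarrow> ('h \<times> 'a) monoid" where
  "semidirect_product H N \<theta> =
     \<lparr>carrier = carrier H \<times> carrier N,
      monoid.mult = (\<lambda>(h, x) (k, y). (h \<otimes>\<^bsub>H\<^esub> k, \<theta> k x \<otimes>\<^bsub>N\<^esub> y)),
      one = (\<one>\<^bsub>H\<^esub>, \<one>\<^bsub>N\<^esub>)\<rparr>"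

lemma auto_closed: "\<alpha> \<in> auto G \<Longrightarrow> x \<in> carrier G \<Longrightarrow> \<alpha> x \<in> carrier G"
  by (auto simp: auto_def hom_def)

lemma auto_mult:
  "\<alpha> \<in> auto G \<Longrightarrow> x \<in> carrier G \<Longrightarrow> y \<in> carrier G \<Longrightarrow> \<alpha> (x \<otimes>\<^bsub>G\<^esub> y) = \<alpha> x \<otimes>\<^bsub>G\<^esub> \<alpha> y"
  by (auto simp: auto_def hom_def)

lemma AutoGroup_simps:
  "carrier (AutoGroup G) = auto G"
  "\<one>\<^bsub>AutoGroup G\<^esub> = (\<lambda>x\<in>carrier G. x)"
  "\<alpha> \<in> auto G \<Longrightarrow> \<beta> \<in> auto G \<Longrightarrow> \<alpha> \<otimes>\<^bsub>AutoGroup G\<^esub> \<beta> = compose (carrier G) \<alpha> \<beta>"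
  by (simp_all add: AutoGroup_def BijGroup_def auto_def)

theorem group_semidirect_product:
  assumes "group H" "group N"
    and auto: "\<And>h. h \<in> carrier H \<Longrightarrow> \<theta> h \<in> auto N"
    and one: "\<theta> \<one>\<^bsub>H\<^esub> = \<one>\<^bsub>AutoGroup N\<^esub>"
    and mult: "\<And>h k. h \<in> carrier H \<Longrightarrow> k \<in> carrier H \<Longrightarrow>
                 \<theta> (h \<otimes>\<^bsub>H\<^esub> k) = \<theta> k \<otimes>\<^bsub>AutoGroup N\<^esub> \<theta> h"
  shows "group (semidirect_product H N \<theta>)"
proof -
  interpret H: group H by fact
  interpret N: group N by fact
  have act: "\<theta> (h \<otimes>\<^bsub>H\<^esub> k) x = \<theta> k (\<theta> h x)"
    if "h \<in> carrier H" "k \<in> carrier H" "x \<in> carrier N" for h k x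
    using that mult auto by (simp add: AutoGroup_simps compose_def)
  have act1: "\<theta> \<one>\<^bsub>H\<^esub> x = x" if "x \<in> carrier N" for x
    using that one by (simp add: AutoGroup_simps)
  have oneN: "\<theta> h \<one>\<^bsub>N\<^esub> = \<one>\<^bsub>N\<^esub>" if "h \<in> carrier H" for h
    using auto[OF that] by (metis auto_closed auto_mult N.one_closed N.l_one N.r_cancel_one')
  note [simp] = auto_closed[OF auto] auto_mult[OF auto]
  show ?thesis
  proof (rule groupI)
    fix p assume p: "p \<in> carrier (semidirect_product H N \<theta>)"
    obtain h x where hx: "p = (h, x)" "h \<in> carrier H" "x \<in> carrier N"
      using p by (auto simp: semidirect_product_def)
    let ?q = "(inv\<^bsub>H\<^esub> h, inv\<^bsub>N\<^esub> (\<theta> (inv\<^bsub>H\<^esub> h) x))"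
    have "\<theta> h (inv\<^bsub>N\<^esub> (\<theta> (inv\<^bsub>H\<^esub> h) x)) \<otimes>\<^bsub>N\<^esub> \<theta> h (\<theta> (inv\<^bsub>H\<^esub> h) x) = \<one>\<^bsub>N\<^esub>"
      using hx by (simp flip: auto_mult[OF auto] add: oneN)
    moreover have "\<theta> h (\<theta> (inv\<^bsub>H\<^esub> h) x) = x"
      using hx act[of "inv\<^bsub>H\<^esub> h" h x] act1 by simp
    ultimately have "?q \<otimes>\<^bsub>semidirect_product H N \<theta>\<^esub> p = \<one>\<^bsub>semidirect_product H N \<theta>\<^esub>"
      using hx by (simp add: semidirect_product_def)
    moreover have "?q \<in> carrier (semidirect_product H N \<theta>)"
      using hx by (simp add: semidirect_product_def)
    ultimately show "\<exists>q\<in>carrier (semidirect_product H N \<theta>).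
        q \<otimes>\<^bsub>semidirect_product H N \<theta>\<^esub> p = \<one>\<^bsub>semidirect_product H N \<theta>\<^esub>"
      by blast
  qed (auto simp: semidirect_product_def H.m_assoc N.m_assoc act act1 oneN)
qed


section \<open>Semidirect products of free groups with cyclic groups\<close>

text \<open>The cyclic group generated by \<open>t\<close> is \<^const>\<open>integer_mod_group\<close> \<open>N\<close>, the exponent of \<open>t\<close> being its
  element; \<open>N\<close> is the order of \<open>t\<close> if that is finite, and 0 if \<open>t\<close> has infinite order. The pair
  \<open>(l, V)\<close> is the normal form \<open>t\<^sup>l V\<close>.\<close>

definition free_by_cyclic :: "nat \<Rightarrow> (word \<Rightarrow> word) \<Rightarrow> nat \<Rightarrow> (int \<times> word) monoid" where
  "free_by_cyclic n \<phi> N =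
     semidirect_product (integer_mod_group N) (free_group n)
       (\<lambda>l. \<phi> [^]\<^bsub>AutoGroup (free_group n)\<^esub> l)"

definition free_incl :: "word \<Rightarrow> int \<times> word" where
  "free_incl w = (0, w)"

text \<open>The reduction modulo \<open>N\<close> matters only for \<open>N = 1\<close>, where \<open>t\<close> is trivial.\<close>

definition stable_letter :: "nat \<Rightarrow> int \<times> word" where
  "stable_letter N = (1 mod int N, [])"

text \<open>The generators \<open>x\<^sub>1, \<dots>, x\<^sub>n, t\<close>, in this order.\<close>

definition free_by_cyclic_gens :: "nat \<Rightarrow> nat \<Rightarrow> (int \<times> word) list" where
  "free_by_cyclic_gens n N = map (\<lambda>i. free_incl [(i, False)]) [0..<n] @ [stable_letter N]"

context
  fixes n N :: nat and \<phi> :: "word \<Rightarrow> word"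
  assumes \<phi>: "\<phi> \<in> auto (free_group n)"
    and fin: "N > 0 \<Longrightarrow> \<phi> [^]\<^bsub>AutoGroup (free_group n)\<^esub> N = \<one>\<^bsub>AutoGroup (free_group n)\<^esub>"
begin

lemma pow_mod_order:
  "\<phi> [^]\<^bsub>AutoGroup (free_group n)\<^esub> (l mod int N) = \<phi> [^]\<^bsub>AutoGroup (free_group n)\<^esub> (l::int)"
proof -
  interpret A: group "AutoGroup (free_group n)"
    by (rule group.AutoGroup[OF group_free_group])
  have c: "\<phi> \<in> carrier (AutoGroup (free_group n))"
    using \<phi> by (simp add: AutoGroup_simps)
  have N: "\<phi> [^]\<^bsub>AutoGroup (free_group n)\<^esub> int N = \<one>\<^bsub>AutoGroup (free_group n)\<^esub>"
    using fin by (cases "N = 0") (simp_all add: int_pow_int)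
  have "\<phi> [^]\<^bsub>AutoGroup (free_group n)\<^esub> l
      = \<phi> [^]\<^bsub>AutoGroup (free_group n)\<^esub> (int N * (l div int N) + l mod int N)"
    by simp
  also have "\<dots> = (\<phi> [^]\<^bsub>AutoGroup (free_group n)\<^esub> int N) [^]\<^bsub>AutoGroup (free_group n)\<^esub> (l div int N)
      \<otimes>\<^bsub>AutoGroup (free_group n)\<^esub> \<phi> [^]\<^bsub>AutoGroup (free_group n)\<^esub> (l mod int N)"
    using c by (simp only: A.int_pow_mult A.int_pow_pow)
  finally show ?thesis using N c by simp
qed

theorem group_free_by_cyclic: "group (free_by_cyclic n \<phi> N)"
proof -
  interpret A: group "AutoGroup (free_group n)"
    by (rule group.AutoGroup[OF group_free_group])
  have c: "\<phi> \<in> carrier (AutoGroup (free_group n))"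
    using \<phi> by (simp add: AutoGroup_simps)
  show ?thesis
    unfolding free_by_cyclic_def
  proof (rule group_semidirect_product)
    show "\<phi> [^]\<^bsub>AutoGroup (free_group n)\<^esub> h \<in> auto (free_group n)" for h :: int
      using A.int_pow_closed[OF c] by (simp add: AutoGroup_simps)
    show "\<phi> [^]\<^bsub>AutoGroup (free_group n)\<^esub> (h \<otimes>\<^bsub>integer_mod_group N\<^esub> k)
        = \<phi> [^]\<^bsub>AutoGroup (free_group n)\<^esub> k
          \<otimes>\<^bsub>AutoGroup (free_group n)\<^esub> \<phi> [^]\<^bsub>AutoGroup (free_group n)\<^esub> h" for h k :: int
      using A.int_pow_mult[OF c, of k h] by (simp add: pow_mod_order add.commute)
  qed (simp_all add: group_free_group)
qed

theorem stable_letter_conj: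
  assumes f: "f \<in> carrier (free_group n)"
  shows "inv\<^bsub>free_by_cyclic n \<phi> N\<^esub> stable_letter N \<otimes>\<^bsub>free_by_cyclic n \<phi> N\<^esub> free_incl f
           \<otimes>\<^bsub>free_by_cyclic n \<phi> N\<^esub> stable_letter N = free_incl (\<phi> f)"
proof -
  interpret G: group "free_by_cyclic n \<phi> N" by (rule group_free_by_cyclic)
  interpret A: group "AutoGroup (free_group n)"
    by (rule group.AutoGroup[OF group_free_group])
  have c: "\<phi> \<in> carrier (AutoGroup (free_group n))"
    using \<phi> by (simp add: AutoGroup_simps)
  have t: "stable_letter N \<in> carrier (free_by_cyclic n \<phi> N)"
    by (auto simp: stable_letter_def free_by_cyclic_def semidirect_product_def
        carrier_integer_mod_group free_group_def words_over_def)
  have incl: "free_incl w \<in> carrier (free_by_cyclic n \<phi> N)" if "w \<in> carrier (free_group n)" for w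
    using that by (auto simp: free_incl_def free_by_cyclic_def semidirect_product_def
        carrier_integer_mod_group)
  let ?pow = "\<lambda>l::int. \<phi> [^]\<^bsub>AutoGroup (free_group n)\<^esub> l"
  have 1: "?pow (1 mod int N) = \<phi>"
    using c pow_mod_order[of 1] by simp
  have 0: "?pow 0 [] = []"
    by (simp add: AutoGroup_simps) (simp add: free_group_def words_over_def)
  have "free_incl f \<otimes>\<^bsub>free_by_cyclic n \<phi> N\<^esub> stable_letter N
      = (1 mod int N, free_reduce (?pow (1 mod int N) f))"
    by (simp add: free_by_cyclic_def semidirect_product_def free_incl_def stable_letter_def
        free_group_def)
  also have "\<dots> = (1 mod int N, free_reduce (?pow 0 [] @ \<phi> f))"
    unfolding 0 1 by simp
  also have "\<dots> = stable_letter N \<otimes>\<^bsub>free_by_cyclic n \<phi> N\<^esub> free_incl (\<phi> f)"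
    by (simp add: free_by_cyclic_def semidirect_product_def free_incl_def stable_letter_def
        free_group_def)
  finally have "free_incl f \<otimes>\<^bsub>free_by_cyclic n \<phi> N\<^esub> stable_letter N
      = stable_letter N \<otimes>\<^bsub>free_by_cyclic n \<phi> N\<^esub> free_incl (\<phi> f)" .
  with t incl f auto_closed[OF \<phi> f] show ?thesis
    by (simp add: G.m_assoc) (simp flip: G.m_assoc)
qed

lemma free_incl_mult:
  assumes "u \<in> carrier (free_group n)" "v \<in> carrier (free_group n)"
  shows "free_incl u \<otimes>\<^bsub>free_by_cyclic n \<phi> N\<^esub> free_incl v = free_incl (u \<otimes>\<^bsub>free_group n\<^esub> v)"
proof -
  have "\<phi> [^]\<^bsub>AutoGroup (free_group n)\<^esub> (0::int) = (\<lambda>x\<in>carrier (free_group n). x)"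
    by (simp add: AutoGroup_simps)
  then show ?thesis
    using assms by (simp add: free_by_cyclic_def semidirect_product_def free_incl_def)
qed

theorem generate_free_by_cyclic_gens:
  "generate (free_by_cyclic n \<phi> N) (set (free_by_cyclic_gens n N)) = carrier (free_by_cyclic n \<phi> N)"
    (is "?S = carrier ?G")
proof
  interpret G: group "?G" by (rule group_free_by_cyclic)
  interpret F: group "free_group n" by (rule group_free_group)
  have gens: "set (free_by_cyclic_gens n N) \<subseteq> carrier ?G"
    by (auto simp: free_by_cyclic_gens_def stable_letter_def free_incl_def free_by_cyclic_def
        semidirect_product_def carrier_integer_mod_group free_group_def words_over_def reduced_def)
  then show "?S \<subseteq> carrier ?G" by (rule G.generate_incl)
  interpret S: subgroup ?S ?G using gens by (rule G.generate_is_subgroup)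
  have incl_closed: "free_incl w \<in> carrier ?G" if "w \<in> carrier (free_group n)" for w
    using that by (auto simp: free_incl_def free_by_cyclic_def semidirect_product_def
        carrier_integer_mod_group)
  have letter: "[a] \<in> carrier (free_group n)" if "fst a < n" for a
    using that by (cases a) (simp add: free_group_def words_over_def reduced_def)
  have one: "free_incl [] = \<one>\<^bsub>?G\<^esub>"
    by (simp add: free_incl_def free_by_cyclic_def semidirect_product_def free_group_def)
  have incl_letter: "free_incl [a] \<in> ?S" if "fst a < n" for a
  proof (cases a)
    case (Pair i b)
    then have i: "i < n" using that by simp
    have pos: "free_incl [(i, False)] \<in> ?S"
      using i by (auto intro!: generate.incl simp: free_by_cyclic_gens_def)
    show ?thesis
    proof (cases b)
      case True
      have "free_incl [(i, True)] \<otimes>\<^bsub>?G\<^esub> free_incl [(i, False)] = \<one>\<^bsub>?G\<^esub>"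
        using letter[of "(i, True)"] letter[of "(i, False)"] i
        by (simp add: free_incl_mult one[symmetric])
          (simp add: free_group_def free_reduce_def inv_letter_def)
      then have "inv\<^bsub>?G\<^esub> free_incl [(i, False)] = free_incl [(i, True)]"
        using incl_closed letter[of "(i, True)"] letter[of "(i, False)"] i
        by (intro G.inv_equality) auto
      then show ?thesis using pos S.m_inv_closed Pair True by metis
    qed (use pos Pair in simp)
  qed
  have incl: "free_incl w \<in> ?S" if "w \<in> carrier (free_group n)" for w
    using that
  proof (induction w)
    case Nil
    then show ?case by (simp add: one)
  next
    case (Cons a w)
    have a: "fst a < n" and w: "w \<in> carrier (free_group n)" and r: "free_reduce (a # w) = a # w"
      using Cons.prems by (auto simp: free_group_def words_over_def reduced_Cons)
    have "free_incl [a] \<otimes>\<^bsub>?G\<^esub> free_incl w = free_incl (a # w)"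
      using letter[OF a] w r by (simp add: free_incl_mult) (simp add: free_group_def)
    then show ?case using incl_letter[OF a] Cons.IH[OF w] S.m_closed by metis
  qed
  have t: "stable_letter N \<in> ?S"
    by (auto intro!: generate.incl simp: free_by_cyclic_gens_def)
  have nil: "(\<phi> [^]\<^bsub>AutoGroup (free_group n)\<^esub> k) [] = []" for k :: int
  proof -
    interpret A: group "AutoGroup (free_group n)"
      by (rule group.AutoGroup[OF group_free_group])
    have "\<phi> [^]\<^bsub>AutoGroup (free_group n)\<^esub> k \<in> auto (free_group n)"
      using \<phi> A.int_pow_closed[of \<phi> k] by (simp add: AutoGroup_simps)
    then have "\<phi> [^]\<^bsub>AutoGroup (free_group n)\<^esub> k \<in> hom (free_group n) (free_group n)"
      by (simp add: auto_def)
    then show ?thesis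
      using hom_one[OF _ F.is_group F.is_group] by (simp add: free_group_def)
  qed
  have mult_Nil: "[] \<otimes>\<^bsub>free_group n\<^esub> w = w" if "w \<in> carrier (free_group n)" for w
    using that by (simp add: free_group_def)
  have Nil_in: "[] \<in> carrier (free_group n)" and one_F: "\<one>\<^bsub>free_group n\<^esub> = []"
    by (simp_all add: free_group_def words_over_def)
  have tpow: "(int k mod int N, []) \<in> ?S" for k :: nat
  proof (induction k)
    case 0
    then show ?case using S.one_closed one by (simp add: free_incl_def)
  next
    case (Suc k)
    have "(int k mod int N, []) \<otimes>\<^bsub>?G\<^esub> stable_letter N = (int (Suc k) mod int N, [])"
      by (simp add: free_by_cyclic_def semidirect_product_def stable_letter_def nil
          mult_Nil Nil_in mod_add_eq add.commute)
    then show ?case using Suc t S.m_closed by metis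
  qed
  have tzpow: "(l, []) \<in> ?S" if l: "l \<in> carrier (integer_mod_group N)" for l
  proof (cases "l \<ge> 0")
    case True
    then show ?thesis
      using tpow[of "nat l"] l by (auto simp: carrier_integer_mod_group split: if_splits)
  next
    case False
    then have N: "N = 0" using l by (auto simp: carrier_integer_mod_group split: if_splits)
    have S: "(- l, []) \<in> ?S" using tpow[of "nat (- l)"] False N by simp
    have "(l, []) \<otimes>\<^bsub>?G\<^esub> (- l, []) = \<one>\<^bsub>?G\<^esub>"
      by (simp add: free_by_cyclic_def semidirect_product_def nil mult_Nil Nil_in one_F)
    moreover have "(l, []) \<in> carrier ?G"
      using N by (simp add: free_by_cyclic_def semidirect_product_def carrier_integer_mod_group
          free_group_def words_over_def)
    ultimately have "inv\<^bsub>?G\<^esub> (- l, []) = (l, [])"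
      using S.mem_carrier[OF S] by (intro G.inv_equality)
    then show ?thesis using S.m_inv_closed[OF S] by simp
  qed
  show "carrier ?G \<subseteq> ?S"
  proof
    fix p assume "p \<in> carrier ?G"
    then obtain l w where p: "p = (l, w)" "l \<in> carrier (integer_mod_group N)" "w \<in> carrier (free_group n)"
      by (auto simp: free_by_cyclic_def semidirect_product_def)
    have "(l, []) \<otimes>\<^bsub>?G\<^esub> free_incl w = (l, w)"
      using p by (simp add: free_by_cyclic_def semidirect_product_def free_incl_def nil mult_Nil)
        (auto simp: carrier_integer_mod_group split: if_splits)
    then show "p \<in> ?S" using tzpow[OF p(2)] incl[OF p(3)] S.m_closed p(1) by metis
  qed
qed

end


section \<open>Recursive functions\<close>

text \<open>\<open>recursive k f\<close>: the restriction of \<open>f\<close> to lists of length \<open>k\<close> is a (total) recursive function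
  of \<open>k\<close> arguments. Minimisation is applied only to functions that have a zero for every choice of
  the parameters. The rule \<open>ext\<close> makes the values at lists of other lengths irrelevant.\<close>

inductive recursive :: "nat \<Rightarrow> (nat list \<Rightarrow> nat) \<Rightarrow> bool" where
  zero: "recursive k (\<lambda>xs. 0)"
| succ: "recursive 1 (\<lambda>xs. Suc (xs ! 0))"
| proj: "i < k \<Longrightarrow> recursive k (\<lambda>xs. xs ! i)"
| comp: "recursive (length gs) f \<Longrightarrow> \<forall>g\<in>set gs. recursive k g \<Longrightarrow>
    recursive k (\<lambda>xs. f (map (\<lambda>g. g xs) gs))"
| prim_rec: "recursive k f \<Longrightarrow> recursive (Suc (Suc k)) g \<Longrightarrow>
    recursive (Suc k) (\<lambda>xs. rec_nat (f (tl xs)) (\<lambda>y r. g (y # r # tl xs)) (hd xs))"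
| minimise: "recursive (Suc k) f \<Longrightarrow> \<forall>xs. length xs = k \<longrightarrow> (\<exists>y. f (y # xs) = 0) \<Longrightarrow>
    recursive k (\<lambda>xs. LEAST y. f (y # xs) = 0)"
| ext: "recursive k f \<Longrightarrow> \<forall>xs. length xs = k \<longrightarrow> f xs = g xs \<Longrightarrow> recursive k g"

text \<open>By the Church--Turing thesis, an algorithm deciding a relation between words is a recursive
  function computing its characteristic function on Goedel numbers.\<close>

definition word_code :: "word \<Rightarrow> nat" where
  "word_code w = list_encode (map (\<lambda>(i, b). 2 * i + of_bool b) w)"

definition decidable_word_relation :: "nat \<Rightarrow> (word \<Rightarrow> word \<Rightarrow> bool) \<Rightarrow> bool" where
  "decidable_word_relation k R \<longleftrightarrow>
     (\<exists>f. recursive 2 f \<and>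
        (\<forall>u\<in>words_over k. \<forall>v\<in>words_over k. f [word_code u, word_code v] = (if R u v then 1 else 0)))"


section \<open>The conjugacy problem\<close>

definition conjugate_in :: "('a, 'b) monoid_scheme \<Rightarrow> 'a \<Rightarrow> 'a \<Rightarrow> bool" where
  "conjugate_in G a b \<longleftrightarrow> (\<exists>g\<in>carrier G. inv\<^bsub>G\<^esub> g \<otimes>\<^bsub>G\<^esub> a \<otimes>\<^bsub>G\<^esub> g = b)"

definition word_value :: "('a, 'b) monoid_scheme \<Rightarrow> 'a list \<Rightarrow> word \<Rightarrow> 'a" where
  "word_value G gs w =
     foldr (\<lambda>(i, b) x. (if b then inv\<^bsub>G\<^esub> (gs ! i) else gs ! i) \<otimes>\<^bsub>G\<^esub> x) w \<one>\<^bsub>G\<^esub>"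

definition conjugacy_problem_solvable :: "('a, 'b) monoid_scheme \<Rightarrow> 'a list \<Rightarrow> bool" where
  "conjugacy_problem_solvable G gs \<longleftrightarrow>
     decidable_word_relation (length gs)
       (\<lambda>u v. conjugate_in G (word_value G gs u) (word_value G gs v))"

end

theory Submission
  imports Defs "HOL-Library.Sublist"
begin

text \<open>If \<open>\<phi>\<^sup>m\<close> is conjugation by \<open>g\<close>, then \<open>t\<^sup>m g\<^sup>-\<^sup>1\<close> is central (here \<open>n \<ge> 2\<close> enters, through the
  trivial centre of \<open>F\<^sub>n\<close>). Hence the exponent of \<open>t\<close> in a conjugator need only range over
  \<open>0, \<dots>, m - 1\<close>, and conjugacy in \<open>F\<^sub>n(t)\<close> reduces to twisted conjugacy \<open>U f = \<psi>(f) V\<close> in \<open>F\<^sub>n\<close> for the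
  finitely many \<open>\<psi> = \<phi>\<^sup>r\<close>, \<open>0 \<le> r < m\<close>.

  A solution \<open>f\<close> of bounded length is found geometrically. In the tree \<open>F\<^sub>n\<close> the map
  \<open>T x = U\<^sup>-\<^sup>1 \<psi>(x)\<close> displaces both \<open>1\<close> and \<open>f\<close> by little, namely by the lengths of \<open>U\<close> and \<open>V\<close>. By
  bounded cancellation \<open>T\<close> coarsely maps segments to segments preserving their orientation, and
  \<open>T\<^sup>m\<close> is a translation up to a bounded error because \<open>\<psi>\<^sup>m\<close> is inner. A point of the segment
  from \<open>1\<close> to \<open>f\<close> that \<open>T\<close> moves far in one direction would keep drifting in that direction, so every
  prefix of \<open>f\<close> is displaced by an amount linear in the lengths of \<open>U\<close> and \<open>V\<close>. These displacements
  \<open>x\<^sup>-\<^sup>1 T x\<close> are pairwise distinct for the prefixes \<open>x\<close> of a shortest \<open>f\<close>, which bounds its length.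
  So conjugacy is decided by a bounded search, given that the word problem is solvable.\<close>

section \<open>Recursive functions on encoded data\<close>

lemma recursive_comp1:
  assumes "recursive 1 f" "recursive k g"
  shows "recursive k (\<lambda>xs. f [g xs])"
  using recursive.comp[of "[g]" f k] assms by simp

lemma recursive_Suc: "recursive k f \<Longrightarrow> recursive k (\<lambda>xs. Suc (f xs))"
  using recursive_comp1[OF recursive.succ] by simp

lemma recursive_const: "recursive k (\<lambda>xs. c)"
  by (induction c) (auto intro: recursive.zero recursive_Suc)

text \<open>\<open>recursive.prim_rec\<close> recurses on the head of the argument list; composing
  it with \<open>h\<close> followed by all projections allows any recursive function
  \<open>h\<close> as the number of steps.\<close>

lemma recursive_rec_nat:
  assumes f: "recursive k f" and g: "recursive (Suc (Suc k)) g" and h: "recursive k h"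
  shows "recursive k (\<lambda>xs. rec_nat (f xs) (\<lambda>y r. g (y # r # xs)) (h xs))"
proof -
  define P where "P = (\<lambda>xs. rec_nat (f (tl xs)) (\<lambda>y r. g (y # r # tl xs)) (hd xs))"
  define gs where "gs = h # map (\<lambda>i xs. xs ! i) [0..<k]"
  have "recursive (length gs) P"
    unfolding P_def gs_def using recursive.prim_rec[OF f g] by simp
  moreover have "\<forall>g\<in>set gs. recursive k g"
    using h by (auto simp: gs_def intro: recursive.proj)
  ultimately have "recursive k (\<lambda>xs. P (map (\<lambda>g. g xs) gs))"
    by (rule recursive.comp)
  then show ?thesis
  proof (rule recursive.ext, intro allI impI)
    fix xs :: "nat list" assume "length xs = k"
    then have "map (\<lambda>i. xs ! i) [0..<k] = xs" by (simp add: map_nth flip: \<open>length xs = k\<close>)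
    then show "P (map (\<lambda>g. g xs) gs) = rec_nat (f xs) (\<lambda>y r. g (y # r # xs)) (h xs)"
      by (simp add: P_def gs_def comp_def)
  qed
qed

lemma recursive_add:
  assumes "recursive k f" "recursive k g"
  shows "recursive k (\<lambda>xs. f xs + g xs)"
proof -
  have "recursive k (\<lambda>xs. rec_nat (f xs) (\<lambda>y r. (\<lambda>zs. Suc (zs ! 1)) (y # r # xs)) (g xs))"
    by (intro recursive_rec_nat assms recursive_Suc recursive.proj) simp
  moreover have "rec_nat a (\<lambda>y. Suc) b = a + b" for a b :: nat
    by (induction b) auto
  ultimately show ?thesis by simp
qed

lemma recursive_mult:
  assumes "recursive k f" "recursive k g"
  shows "recursive k (\<lambda>xs. f xs * g xs)"
proof -
  \<comment> \<open>In a recursion the counter and the accumulator stand before the parameters, so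
    \<open>f\<close> must be read two places further on.\<close>
  have "recursive (Suc (Suc k)) (\<lambda>zs. f (drop 2 zs))"
  proof -
    define gs :: "(nat list \<Rightarrow> nat) list" where "gs = map (\<lambda>i xs. xs ! (i + 2)) [0..<k]"
    have "recursive (Suc (Suc k)) (\<lambda>zs. f (map (\<lambda>g. g zs) gs))"
      by (rule recursive.comp) (auto simp: gs_def assms intro: recursive.proj[of "Suc (Suc _)", simplified])
    then show ?thesis
    proof (rule recursive.ext, intro allI impI)
      fix zs :: "nat list" assume l: "length zs = Suc (Suc k)"
      have "map (\<lambda>g. g zs) gs = drop 2 zs"
        using l by (intro nth_equalityI) (auto simp: gs_def add.commute)
      then show "f (map (\<lambda>g. g zs) gs) = f (drop 2 zs)" by simp
    qed
  qed
  then have "recursive k (\<lambda>xs. rec_nat 0 (\<lambda>y r. (\<lambda>zs. zs ! 1 + f (drop 2 zs)) (y # r # xs)) (g xs))"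
    by (intro recursive_rec_nat recursive_add assms recursive.proj recursive.zero) auto
  moreover have "rec_nat 0 (\<lambda>y r. r + a) b = a * b" for a b :: nat
    by (induction b) auto
  ultimately show ?thesis by simp
qed

lemma recursive_pred:
  assumes "recursive k f" shows "recursive k (\<lambda>xs. f xs - 1)"
proof -
  have "recursive k (\<lambda>xs. rec_nat 0 (\<lambda>y r. (\<lambda>zs. zs ! 0) (y # r # xs)) (f xs))"
    by (intro recursive_rec_nat assms recursive.proj recursive.zero) simp
  moreover have "rec_nat 0 (\<lambda>y r. y) b = b - 1" for b :: nat
    by (cases b) auto
  ultimately show ?thesis by simp
qed

lemma recursive_diff:
  assumes "recursive k f" "recursive k g"
  shows "recursive k (\<lambda>xs. f xs - g xs)"
proof -
  have "recursive k (\<lambda>xs. rec_nat (f xs) (\<lambda>y r. (\<lambda>zs. zs ! 1 - 1) (y # r # xs)) (g xs))"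
    by (intro recursive_rec_nat assms recursive_pred recursive.proj) simp
  moreover have "rec_nat a (\<lambda>y r. r - 1) b = a - b" for a b :: nat
    by (induction b) auto
  ultimately show ?thesis by simp
qed

lemma recursive_triangle:
  assumes "recursive k f" shows "recursive k (\<lambda>xs. triangle (f xs))"
proof -
  have "recursive k (\<lambda>xs. rec_nat 0 (\<lambda>y r. (\<lambda>zs. zs ! 1 + Suc (zs ! 0)) (y # r # xs)) (f xs))"
    by (intro recursive_rec_nat assms recursive_add recursive_Suc recursive.proj recursive.zero) auto
  moreover have "rec_nat 0 (\<lambda>y r. r + Suc y) b = triangle b" for b :: nat
    by (induction b) auto
  ultimately show ?thesis by simp
qed

lemma recursive_prod_encode:
  assumes "recursive k f" "recursive k g"
  shows "recursive k (\<lambda>xs. prod_encode (f xs, g xs))"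
  unfolding prod_encode_def prod.case by (intro recursive_add recursive_triangle assms)

lemma strict_mono_triangle: "strict_mono triangle"
  by (simp add: strict_mono_Suc_iff)

text \<open>The code of \<open>(a, b)\<close> is at least \<open>triangle (a + b)\<close> and below
  \<open>triangle (Suc (a + b))\<close>. Truncated subtraction expresses being below
  \<open>triangle (Suc y)\<close> as a zero, the form that minimisation asks for.\<close>

lemma Least_triangle:
  "(LEAST y. Suc (prod_encode (a, b)) - triangle (Suc y) = 0) = a + b"
proof (rule Least_equality)
  show "Suc (prod_encode (a, b)) - triangle (Suc (a + b)) = 0"
    by (simp add: prod_encode_def)
next
  fix y assume y: "Suc (prod_encode (a, b)) - triangle (Suc y) = 0"
  show "a + b \<le> y"
  proof (rule ccontr)
    assume "\<not> a + b \<le> y"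
    then have "triangle (Suc y) \<le> triangle (a + b)"
      unfolding strict_mono_less_eq[OF strict_mono_triangle] by simp
    then show False using y by (simp add: prod_encode_def)
  qed
qed

text \<open>Once the sum of the components is found by minimisation, subtracting its triangle number
  from the code leaves the first component, and the second is the rest of the sum.\<close>

lemma recursive_prod_decode_sum:
  "recursive 1 (\<lambda>xs. fst (prod_decode (xs ! 0)) + snd (prod_decode (xs ! 0)))"
proof -
  have "recursive (Suc 1) (\<lambda>zs. Suc (zs ! 1) - triangle (Suc (zs ! 0)))"
    by (intro recursive_diff recursive_Suc recursive_triangle recursive.proj) auto
  moreover have "\<exists>y. Suc ((y # xs) ! 1) - triangle (Suc ((y # xs) ! 0)) = 0" for xs :: "nat list"
    by (rule exI[of _ "xs ! 0"]) simp
  ultimately have "recursive 1 (\<lambda>xs. LEAST y. Suc ((y # xs) ! 1) - triangle (Suc ((y # xs) ! 0)) = 0)"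
    by (intro recursive.minimise) auto
  then show ?thesis
  proof (rule recursive.ext, intro allI impI)
    fix xs :: "nat list"
    obtain a b where ab: "xs ! 0 = prod_encode (a, b)"
      by (metis prod_decode_inverse surj_pair)
    then show "(LEAST y. Suc ((y # xs) ! 1) - triangle (Suc ((y # xs) ! 0)) = 0)
        = fst (prod_decode (xs ! 0)) + snd (prod_decode (xs ! 0))"
      using Least_triangle[of a b] by simp
  qed
qed

lemma recursive_fst_prod_decode:
  assumes "recursive k f" shows "recursive k (\<lambda>xs. fst (prod_decode (f xs)))"
proof -
  have "recursive 1 (\<lambda>xs. fst (prod_decode (xs ! 0)))"
  proof (rule recursive.ext)
    show "recursive 1 (\<lambda>xs. xs ! 0 - triangle (fst (prod_decode (xs ! 0)) + snd (prod_decode (xs ! 0))))"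
      by (intro recursive_diff recursive_triangle recursive_prod_decode_sum recursive.proj) simp
    show "\<forall>xs. length xs = 1 \<longrightarrow> xs ! 0 - triangle (fst (prod_decode (xs ! 0)) + snd (prod_decode (xs ! 0)))
        = fst (prod_decode (xs ! 0))"
    proof (intro allI impI)
      fix xs :: "nat list"
      obtain a b where ab: "xs ! 0 = prod_encode (a, b)"
        by (metis prod_decode_inverse surj_pair)
      then have "xs ! 0 = triangle (a + b) + a" by (simp add: prod_encode_def)
      with ab show "xs ! 0 - triangle (fst (prod_decode (xs ! 0)) + snd (prod_decode (xs ! 0)))
        = fst (prod_decode (xs ! 0))" by simp
    qed
  qed
  from recursive_comp1[OF this assms] show ?thesis by simp
qed

lemma recursive_snd_prod_decode:
  assumes "recursive k f" shows "recursive k (\<lambda>xs. snd (prod_decode (f xs)))"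
proof -
  have "recursive 1 (\<lambda>xs. (fst (prod_decode (xs ! 0)) + snd (prod_decode (xs ! 0))) - fst (prod_decode (xs ! 0)))"
    by (intro recursive_diff recursive_prod_decode_sum recursive_fst_prod_decode recursive.proj) simp
  from recursive_comp1[OF this assms] show ?thesis by simp
qed

section \<open>Functions computed through encodings\<close>

definition enc_prod :: "('a \<Rightarrow> nat) \<Rightarrow> ('b \<Rightarrow> nat) \<Rightarrow> 'a \<times> 'b \<Rightarrow> nat" where
  "enc_prod e1 e2 = (\<lambda>(a, b). prod_encode (e1 a, e2 b))"

definition enc_list :: "('a \<Rightarrow> nat) \<Rightarrow> 'a list \<Rightarrow> nat" where
  "enc_list e xs = list_encode (map e xs)"

text \<open>\<open>f\<close> is tracked by a recursive function on codes; nothing is asked at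
  numbers that encode nothing. Predicates are included by taking \<open>of_bool\<close> for
  \<open>e2\<close>.\<close>

definition computes :: "('a \<Rightarrow> nat) \<Rightarrow> ('b \<Rightarrow> nat) \<Rightarrow> ('a \<Rightarrow> 'b) \<Rightarrow> bool" where
  "computes e1 e2 f \<longleftrightarrow> (\<exists>r. recursive 1 r \<and> (\<forall>a. r [e1 a] = e2 (f a)))"

lemma computesI: "recursive 1 r \<Longrightarrow> (\<And>a. r [e1 a] = e2 (f a)) \<Longrightarrow> computes e1 e2 f"
  by (auto simp: computes_def)

lemma computesE:
  assumes "computes e1 e2 f"
  obtains r where "recursive 1 r" "\<And>a. r [e1 a] = e2 (f a)"
  using assms by (auto simp: computes_def)

lemma computes_id: "computes e e (\<lambda>x. x)"
  by (rule computesI[OF recursive.proj[of 0]]) auto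

lemma computes_code: "computes e id e"
  by (rule computesI[OF recursive.proj[of 0]]) auto

lemma computes_const: "computes e1 e2 (\<lambda>x. c)"
  by (rule computesI[OF recursive_const]) auto

lemma computes_comp:
  assumes "computes e2 e3 f" "computes e1 e2 g"
  shows "computes e1 e3 (\<lambda>x. f (g x))"
proof -
  obtain r s where "recursive 1 r" "\<And>a. r [e2 a] = e3 (f a)" "recursive 1 s" "\<And>a. s [e1 a] = e2 (g a)"
    using assms by (metis computesE)
  then show ?thesis by (intro computesI[OF recursive_comp1[of r 1 s]]) auto
qed

lemma computes_Pair:
  assumes "computes e e1 f" "computes e e2 g"
  shows "computes e (enc_prod e1 e2) (\<lambda>x. (f x, g x))"
proof -
  obtain r s where "recursive 1 r" "\<And>a. r [e a] = e1 (f a)" "recursive 1 s" "\<And>a. s [e a] = e2 (g a)"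
    using assms by (metis computesE)
  then show ?thesis by (intro computesI[OF recursive_prod_encode[of 1 r s]]) (auto simp: enc_prod_def)
qed

lemma computes_fst:
  assumes "computes e (enc_prod e1 e2) f" shows "computes e e1 (\<lambda>x. fst (f x))"
proof -
  obtain r where "recursive 1 r" "\<And>a. r [e a] = enc_prod e1 e2 (f a)"
    using assms by (metis computesE)
  then show ?thesis
    by (intro computesI[OF recursive_fst_prod_decode[of 1 r]]) (auto simp: enc_prod_def split: prod.split)
qed

lemma computes_snd:
  assumes "computes e (enc_prod e1 e2) f" shows "computes e e2 (\<lambda>x. snd (f x))"
proof -
  obtain r where "recursive 1 r" "\<And>a. r [e a] = enc_prod e1 e2 (f a)"
    using assms by (metis computesE)
  then show ?thesis
    by (intro computesI[OF recursive_snd_prod_decode[of 1 r]]) (auto simp: enc_prod_def split: prod.split)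
qed

text \<open>Curried functions are handled by pairing their arguments, which lets the rules be
  chained backwards along the syntax of a term.\<close>

lemma computes_comp2:
  assumes "computes (enc_prod e1 e2) e3 (\<lambda>p. F (fst p) (snd p))" "computes e e1 f" "computes e e2 g"
  shows "computes e e3 (\<lambda>x. F (f x) (g x))"
  using computes_comp[OF assms(1) computes_Pair[OF assms(2,3)]] by simp

lemma computes_comp3:
  assumes "computes (enc_prod e1 (enc_prod e2 e3)) e4 (\<lambda>p. F (fst p) (fst (snd p)) (snd (snd p)))"
    "computes e e1 f" "computes e e2 g" "computes e e3 h"
  shows "computes e e4 (\<lambda>x. F (f x) (g x) (h x))"
  using computes_comp[OF assms(1) computes_Pair[OF assms(2) computes_Pair[OF assms(3,4)]]] by simp

lemma computes_op:
  assumes "\<And>f g. recursive 1 f \<Longrightarrow> recursive 1 g \<Longrightarrow> recursive 1 (\<lambda>xs. h (f xs) (g xs))"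
    and "computes e id f" "computes e id g"
  shows "computes e id (\<lambda>x. h (f x) (g x))"
proof -
  obtain r s where "recursive 1 r" "\<And>a. r [e a] = id (f a)" "recursive 1 s" "\<And>a. s [e a] = id (g a)"
    using assms(2,3) by (metis computesE)
  then show ?thesis by (intro computesI[OF assms(1)[of r s]]) auto
qed

lemma computes_add:
  "computes e id f \<Longrightarrow> computes e id g \<Longrightarrow> computes e id (\<lambda>x. f x + g x)"
  using computes_op[where h = "(+)"] recursive_add by blast

lemma computes_diff:
  "computes e id f \<Longrightarrow> computes e id g \<Longrightarrow> computes e id (\<lambda>x. f x - g x)"
  using computes_op[where h = "(-)"] recursive_diff by blast

lemma computes_mult:
  "computes e id f \<Longrightarrow> computes e id g \<Longrightarrow> computes e id (\<lambda>x. f x * g x)"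
  using computes_op[where h = "\<lambda>a b. a * b"] recursive_mult by blast

lemma computes_Suc: "computes e id f \<Longrightarrow> computes e id (\<lambda>x. Suc (f x))"
  using computes_add[of e "\<lambda>_. 1" f] by (simp add: computes_const)

lemma computes_rec_nat:
  assumes "computes e e2 b"
    and "computes (enc_prod e (enc_prod id e2)) e2 (\<lambda>p. F (fst p) (fst (snd p)) (snd (snd p)))"
    and "computes e id k"
  shows "computes e e2 (\<lambda>x. rec_nat (b x) (F x) (k x))"
proof -
  obtain rb where rb: "recursive 1 rb" "\<And>a. rb [e a] = e2 (b a)"
    using assms(1) by (metis computesE)
  obtain rF where rF: "recursive 1 rF" "\<And>x y r. rF [prod_encode (e x, prod_encode (y, e2 r))] = e2 (F x y r)"
    using assms(2) by (elim computesE) (auto simp: enc_prod_def)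
  obtain rk where rk: "recursive 1 rk" "\<And>a. rk [e a] = k a"
    using assms(3) by (elim computesE) auto
  show ?thesis
  proof (rule computesI)
    show "recursive 1 (\<lambda>xs. rec_nat (rb xs)
        (\<lambda>y r. (\<lambda>zs. rF [prod_encode (zs ! 2, prod_encode (zs ! 0, zs ! 1))]) (y # r # xs)) (rk xs))"
      by (intro recursive_rec_nat rb rk recursive_comp1[OF rF(1)] recursive_prod_encode recursive.proj) auto
    have "rec_nat (e2 (b a)) (\<lambda>y r. rF [prod_encode (e a, prod_encode (y, r))]) i = e2 (rec_nat (b a) (F a) i)"
      for a i by (induction i) (auto simp: rF)
    then show "rec_nat (rb [e a]) (\<lambda>y r. (\<lambda>zs. rF [prod_encode (zs ! 2, prod_encode (zs ! 0, zs ! 1))])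
        (y # r # [e a])) (rk [e a]) = e2 (rec_nat (b a) (F a) (k a))" for a
      by (simp add: rb rk)
  qed
qed

text \<open>A case distinction is a recursion of length 0 or 1 that starts with the else
  branch.\<close>

lemma computes_If:
  assumes P: "computes e of_bool P" and f: "computes e e2 f" and g: "computes e e2 g"
  shows "computes e e2 (\<lambda>x. if P x then f x else g x)"
proof -
  have "computes e id (\<lambda>x. of_bool (P x))"
    using P by (simp add: computes_def)
  then have "computes e e2 (\<lambda>x. rec_nat (g x) (\<lambda>_ _. f x) (of_bool (P x)))"
    by (rule computes_rec_nat[OF g computes_comp[OF f computes_fst[OF computes_id]]])
  moreover have "rec_nat (g x) (\<lambda>_ _. f x) (of_bool (P x)) = (if P x then f x else g x)" for x
    by simp
  ultimately show ?thesis by simp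
qed

lemma computes_eq_0:
  assumes "computes e id f" shows "computes e of_bool (\<lambda>x. f x = 0)"
proof -
  have "computes e of_bool (\<lambda>x. rec_nat True (\<lambda>_ _. False) (f x))"
    by (rule computes_rec_nat[OF computes_const computes_const assms])
  moreover have "rec_nat True (\<lambda>_ _. False) k = (k = 0)" for k
    by (cases k) auto
  ultimately show ?thesis by simp
qed

lemma computes_conj:
  "computes e of_bool P \<Longrightarrow> computes e of_bool Q \<Longrightarrow> computes e of_bool (\<lambda>x. P x \<and> Q x)"
  using computes_If[of e P of_bool Q "\<lambda>_. False", OF _ _ computes_const]
  by (simp add: if_bool_eq_conj conj_commute cong: conj_cong)

lemma computes_disj:
  "computes e of_bool P \<Longrightarrow> computes e of_bool Q \<Longrightarrow> computes e of_bool (\<lambda>x. P x \<or> Q x)"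
  using computes_If[of e P of_bool "\<lambda>_. True" Q, OF _ computes_const]
  by (simp add: if_bool_eq_disj cong: disj_cong)

text \<open>Both truncated differences of the codes vanish exactly if the codes are equal;
  injectivity of \<open>e2\<close> carries this back to the values.\<close>

lemma computes_eq:
  assumes "computes e e2 f" "computes e e2 g" "inj e2"
  shows "computes e of_bool (\<lambda>x. f x = g x)"
proof -
  have "computes e id (\<lambda>x. (e2 (f x) - e2 (g x)) + (e2 (g x) - e2 (f x)))"
    by (intro computes_add computes_diff computes_comp[OF computes_code] assms)
  moreover have "((e2 (f x) - e2 (g x)) + (e2 (g x) - e2 (f x)) = 0) = (f x = g x)" for x
    using assms(3) by (auto dest: injD)
  ultimately show ?thesis using computes_eq_0 by fastforce
qed

section \<open>Computing with lists\<close>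

lemma computes_Cons:
  assumes "computes e e1 f" "computes e (enc_list e1) g"
  shows "computes e (enc_list e1) (\<lambda>x. f x # g x)"
proof -
  have "computes e id (\<lambda>x. Suc (enc_prod e1 (enc_list e1) (f x, g x)))"
    by (intro computes_Suc computes_comp[OF computes_code] computes_Pair assms)
  then show ?thesis by (simp add: computes_def enc_list_def enc_prod_def)
qed

text \<open>The code of a nonempty list is the successor of the code of its head and tail, so
  recursion degenerates to a case analysis: the last counter value is that pair, and the earlier
  result is dropped.\<close>

lemma computes_case_list:
  assumes "computes e (enc_list e1) l" "computes e e2 b"
    and F: "computes (enc_prod e (enc_prod e1 (enc_list e1))) e2 (\<lambda>p. F (fst p) (fst (snd p)) (snd (snd p)))"
  shows "computes e e2 (\<lambda>x. case l x of [] \<Rightarrow> b x | y # ys \<Rightarrow> F x y ys)"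
proof -
  obtain rl where rl: "recursive 1 rl" "\<And>a. rl [e a] = list_encode (map e1 (l a))"
    using assms(1) by (elim computesE) (auto simp: enc_list_def)
  obtain rb where rb: "recursive 1 rb" "\<And>a. rb [e a] = e2 (b a)"
    using assms(2) by (metis computesE)
  obtain rF where rF: "recursive 1 rF"
    "\<And>x y ys. rF [prod_encode (e x, prod_encode (e1 y, list_encode (map e1 ys)))] = e2 (F x y ys)"
    using F by (elim computesE) (auto simp: enc_prod_def enc_list_def)
  show ?thesis
  proof (rule computesI)
    show "recursive 1 (\<lambda>xs. rec_nat (rb xs)
        (\<lambda>y r. (\<lambda>zs. rF [prod_encode (zs ! 2, zs ! 0)]) (y # r # xs)) (rl xs))"
      by (intro recursive_rec_nat rb rl recursive_comp1[OF rF(1)] recursive_prod_encode recursive.proj) auto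
    show "rec_nat (rb [e a]) (\<lambda>y r. (\<lambda>zs. rF [prod_encode (zs ! 2, zs ! 0)])
        (y # r # [e a])) (rl [e a]) = e2 (case l a of [] \<Rightarrow> b a | y # ys \<Rightarrow> F a y ys)" for a
      by (cases "l a") (auto simp: rb rl rF)
  qed
qed

lemmas computes_intros = computes_id computes_fst computes_snd computes_Pair computes_Cons
  computes_Suc computes_add computes_diff computes_mult computes_conj computes_disj

lemma length_le_list_encode: "length xs \<le> list_encode xs"
proof (induction xs)
  case (Cons x xs)
  then show ?case using le_prod_encode_2[of "list_encode xs" x] by simp
qed simp

text \<open>\<open>step\<close> consumes one entry of the remaining list and does nothing on the
  empty list. It can thus be iterated as often as the code of the list says, since that number is at
  least the length.\<close>

lemma computes_foldl:
  assumes "computes e e2 b"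
    and F: "computes (enc_prod e (enc_prod e2 e1)) e2 (\<lambda>p. F (fst p) (fst (snd p)) (snd (snd p)))"
    and l: "computes e (enc_list e1) l"
  shows "computes e e2 (\<lambda>x. foldl (F x) (b x) (l x))"
proof -
  define step where "step x p = (case snd p of [] \<Rightarrow> (fst p, []) | y # ys \<Rightarrow> (F x (fst p) y, ys))" for x p
  have step: "computes (enc_prod e (enc_prod id (enc_prod e2 (enc_list e1)))) (enc_prod e2 (enc_list e1))
     (\<lambda>q. step (fst q) (snd (snd q)))"
    unfolding step_def
    by (rule computes_case_list computes_comp3[OF F] computes_const computes_intros)+
  have "computes e (enc_prod e2 (enc_list e1))
     (\<lambda>x. rec_nat (b x, l x) (\<lambda>_. step x) (enc_list e1 (l x)))"
    by (rule computes_rec_nat[OF _ step] computes_Pair computes_comp[OF computes_code] assms)+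
  then have *: "computes e e2 (\<lambda>x. fst (rec_nat (b x, l x) (\<lambda>_. step x) (enc_list e1 (l x))))"
    by (rule computes_fst)
  have "rec_nat (r, ys) (\<lambda>_. step x) k = (foldl (F x) r (take k ys), drop k ys)" for x r ys k
  proof (induction k)
    case (Suc k)
    show ?case
    proof (cases "k < length ys")
      case True
      then show ?thesis
        using Suc by (simp add: step_def take_Suc_conv_app_nth flip: Cons_nth_drop_Suc)
    qed (use Suc in \<open>simp add: step_def\<close>)
  qed simp
  moreover have "take (enc_list e1 (l x)) (l x) = l x" for x
    using length_le_list_encode[of "map e1 (l x)"] by (simp add: enc_list_def)
  ultimately show ?thesis using * by simp
qed

lemma computes_rev:
  assumes "computes e (enc_list e1) l" shows "computes e (enc_list e1) (\<lambda>x. rev (l x))"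
proof -
  have "computes e (enc_list e1) (\<lambda>x. foldl (\<lambda>r y. y # r) [] (l x))"
    by (rule computes_foldl[OF computes_const _ assms] computes_intros)+
  moreover have "foldl (\<lambda>r y. y # r) r ys = rev ys @ r" for r ys :: "'b list"
    by (induction ys arbitrary: r) auto
  ultimately show ?thesis by simp
qed

lemma computes_foldr:
  assumes b: "computes e e2 b"
    and F: "computes (enc_prod e (enc_prod e1 e2)) e2 (\<lambda>p. F (fst p) (fst (snd p)) (snd (snd p)))"
    and l: "computes e (enc_list e1) l"
  shows "computes e e2 (\<lambda>x. foldr (F x) (l x) (b x))"
  unfolding foldr_conv_foldl
  by (rule computes_foldl[OF b _ computes_rev[OF l]] computes_comp3[OF F] computes_intros)+

lemma computes_append:
  assumes "computes e (enc_list e1) f" "computes e (enc_list e1) g"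
  shows "computes e (enc_list e1) (\<lambda>x. f x @ g x)"
proof -
  have "computes e (enc_list e1) (\<lambda>x. foldr (\<lambda>y r. y # r) (f x) (g x))"
    by (rule computes_foldr[OF assms(2) _ assms(1)] computes_intros)+
  moreover have "foldr (\<lambda>y r. y # r) ys r = ys @ r" for r ys :: "'b list"
    by (induction ys arbitrary: r) auto
  ultimately show ?thesis by simp
qed

lemma computes_bind:
  assumes F: "computes (enc_prod e e1) (enc_list e2) (\<lambda>p. F (fst p) (snd p))"
    and l: "computes e (enc_list e1) l"
  shows "computes e (enc_list e2) (\<lambda>x. concat (map (F x) (l x)))"
proof -
  have "computes e (enc_list e2) (\<lambda>x. foldr (\<lambda>y r. F x y @ r) (l x) [])"
    by (rule computes_foldr[OF computes_const _ l] computes_append computes_comp2[OF F] computes_intros)+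
  moreover have "foldr (\<lambda>y r. F x y @ r) ys [] = concat (map (F x) ys)" for x ys
    by (induction ys) auto
  ultimately show ?thesis by simp
qed

lemma computes_map:
  assumes F: "computes (enc_prod e e1) e2 (\<lambda>p. F (fst p) (snd p))"
    and l: "computes e (enc_list e1) l"
  shows "computes e (enc_list e2) (\<lambda>x. map (F x) (l x))"
proof -
  have "computes e (enc_list e2) (\<lambda>x. concat (map (\<lambda>y. [F x y]) (l x)))"
    by (rule computes_bind[OF _ l] computes_Cons F computes_const)+
  then show ?thesis by (simp add: concat_map_singleton)
qed

lemma computes_Bex_set:
  assumes P: "computes (enc_prod e e1) of_bool (\<lambda>p. P (fst p) (snd p))"
    and l: "computes e (enc_list e1) l"
  shows "computes e of_bool (\<lambda>x. \<exists>y\<in>set (l x). P x y)"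
proof -
  have "computes e of_bool (\<lambda>x. foldr (\<lambda>y r. P x y \<or> r) (l x) False)"
    by (rule computes_foldr[OF computes_const _ l] computes_comp2[OF P] computes_intros)+
  moreover have "foldr (\<lambda>y r. P x y \<or> r) ys False = (\<exists>y\<in>set ys. P x y)" for x ys
    by (induction ys) auto
  ultimately show ?thesis by simp
qed

lemma computes_length:
  assumes "computes e (enc_list e1) l" shows "computes e id (\<lambda>x. length (l x))"
proof -
  have "computes e id (\<lambda>x. foldr (\<lambda>y r. Suc r) (l x) 0)"
    by (rule computes_foldr[OF computes_const _ assms] computes_intros)+
  moreover have "foldr (\<lambda>y. Suc) ys 0 = length ys" for ys :: "'b list"
    by (induction ys) auto
  ultimately show ?thesis by simp
qed

lemma computes_power:
  assumes "computes e id f" "computes e id g" shows "computes e id (\<lambda>x. f x ^ g x)"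
proof -
  have "computes e id (\<lambda>x. rec_nat 1 (\<lambda>_ r. f x * r) (g x))"
    by (rule computes_rec_nat[OF computes_const _ assms(2)] computes_mult
        computes_comp[OF assms(1)] computes_intros)+
  moreover have "rec_nat 1 (\<lambda>_ r. a * r) k = a ^ k" for a k :: nat
    by (induction k) auto
  ultimately show ?thesis by simp
qed

text \<open>A counter that is reset on reaching \<open>m\<close>. For \<open>m = 0\<close> it is
  never reset, in agreement with \<open>k mod 0 = k\<close>; this case serves a \<open>t\<close> of
  infinite order.\<close>

lemma computes_mod:
  assumes "computes e id f" shows "computes e id (\<lambda>x. f x mod m)"
proof -
  have "computes e id (\<lambda>x. rec_nat 0 (\<lambda>_ r. if Suc r = m then 0 else Suc r) (f x))"
    by (rule computes_rec_nat[OF computes_const _ assms] computes_If computes_eq[of _ id]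
        computes_intros computes_const inj_on_id)+
  moreover have "rec_nat 0 (\<lambda>_ r. if Suc r = m then 0 else Suc r) k = k mod m" for k
    by (induction k) (auto simp: mod_Suc)
  ultimately show ?thesis by simp
qed

text \<open>Nested case distinctions compute any function whatever on finitely many codes.
  Automorphisms enter the algorithm through such tables.\<close>

lemma computes_table: "computes id e2 (\<lambda>c. if c < k then f c else d)"
proof (induction k)
  case 0
  then show ?case by (simp add: computes_const)
next
  case (Suc k)
  have "computes id e2 (\<lambda>c. if c = k then f k else if c < k then f c else d)"
    by (rule computes_If computes_eq[of _ id] computes_id computes_const Suc.IH inj_on_id)+
  moreover have "(\<lambda>c. if c = k then f k else if c < k then f c else d) = (\<lambda>c. if c < Suc k then f c else d)"
    by (auto simp: fun_eq_iff)
  ultimately show ?case by (metis (no_types))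
qed

lemma inj_enc_list: "inj e \<Longrightarrow> inj (enc_list e)"
  by (auto simp: inj_on_def enc_list_def list_encode_eq intro: list.inj_map_strong)

section \<open>Coarse maps of trees\<close>

text \<open>\<open>four_point\<close> is 0-hyperbolicity: among the three sums of opposite distances
  of four points, the two largest agree.\<close>

locale tree_metric =
  fixes S :: "'a set" and d :: "'a \<Rightarrow> 'a \<Rightarrow> int"
  assumes nonneg: "0 \<le> d x y"
    and sym: "x \<in> S \<Longrightarrow> y \<in> S \<Longrightarrow> d x y = d y x"
    and triangle: "x \<in> S \<Longrightarrow> y \<in> S \<Longrightarrow> z \<in> S \<Longrightarrow> d x z \<le> d x y + d y z"
    and four_point: "x \<in> S \<Longrightarrow> y \<in> S \<Longrightarrow> z \<in> S \<Longrightarrow> w \<in> S \<Longrightarrow>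
      d x y + d z w \<le> max (d x z + d y w) (d x w + d y z)"
begin

text \<open>Twice the Gromov product of \<open>p\<close> and \<open>r\<close> at \<open>q\<close>;
  it vanishes if and only if \<open>q\<close> lies metrically between \<open>p\<close> and
  \<open>r\<close>.\<close>

definition defect :: "'a \<Rightarrow> 'a \<Rightarrow> 'a \<Rightarrow> int" where
  "defect p q r = d p q + d q r - d p r"

lemma defect_sym: "p \<in> S \<Longrightarrow> q \<in> S \<Longrightarrow> r \<in> S \<Longrightarrow> defect p q r = defect r q p"
  using sym by (simp add: defect_def)

text \<open>The four-point condition for \<open>p\<close>, \<open>q\<close>, \<open>a\<close>,
  \<open>b\<close>: points close to a common segment are no farther apart than their positions along
  it, up to an error \<open>K\<close>.\<close>

lemma near_segment:
  assumes "a \<in> S" "b \<in> S" "p \<in> S" "q \<in> S" "defect a p b \<le> K" "defect a q b \<le> K"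
  shows "2 * d p q \<le> \<bar>(d a q - d q b) - (d a p - d p b)\<bar> + 2 * K"
  using four_point[of p q a b] sym[of p a] sym[of q a] assms
  by (auto simp: defect_def max_def split: if_splits)

text \<open>Solves \<open>c 0 = 0\<close>, \<open>c (Suc i) = 2 * \<Lambda> * c i + Z\<close>, the
  recurrence for how far the \<open>i\<close>-th move may go backwards. The factor \<open>Z\<close>
  stands outside because the final estimate relies on linearity in \<open>Z\<close>.\<close>

definition drift_bound :: "int \<Rightarrow> int \<Rightarrow> nat \<Rightarrow> int" where
  "drift_bound \<Lambda> Z i = Z * (\<Sum>k<i. (2 * \<Lambda>) ^ k)"

lemma drift_bound_Suc: "drift_bound \<Lambda> Z (Suc i) = 2 * \<Lambda> * drift_bound \<Lambda> Z i + Z"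
  by (simp add: drift_bound_def sum.lessThan_Suc_shift sum_distrib_left algebra_simps del: sum.lessThan_Suc)

lemma drift_bound_nonneg: "0 \<le> \<Lambda> \<Longrightarrow> 0 \<le> Z \<Longrightarrow> 0 \<le> drift_bound \<Lambda> Z i"
  by (simp add: drift_bound_def sum_nonneg)

lemma drift_bound_mono: "0 \<le> \<Lambda> \<Longrightarrow> 0 \<le> Z \<Longrightarrow> i \<le> j \<Longrightarrow> drift_bound \<Lambda> Z i \<le> drift_bound \<Lambda> Z j"
  unfolding drift_bound_def by (intro mult_left_mono sum_mono2) auto

text \<open>\<open>d a p - d p b\<close> is twice the position of \<open>p\<close> along the segment from \<open>a\<close> to \<open>b\<close>, up to a
  constant. \<open>T\<close> coarsely preserves the order of positions; hence if it moves \<open>x\<close> towards \<open>b\<close>, then no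
  further iterate moves back by more than a bounded amount.\<close>

lemma one_sided_drift:
  fixes \<Lambda> B D K :: int
  assumes S: "a \<in> S" "b \<in> S" "x \<in> S" and T: "\<And>p. p \<in> S \<Longrightarrow> T p \<in> S"
    and \<Lambda>: "0 \<le> \<Lambda>" and K: "0 \<le> K"
    and lip_defect: "\<And>p q r. p \<in> S \<Longrightarrow> q \<in> S \<Longrightarrow> r \<in> S \<Longrightarrow> defect (T p) (T q) (T r) \<le> \<Lambda> * defect p q r + B"
    and D: "d b (T b) \<le> D" and B: "0 \<le> B"
    and near: "\<And>i. i \<le> m \<Longrightarrow> defect a ((T ^^ i) x) b \<le> K"
    and fwd: "d a x - d x b \<le> d a (T x) - d (T x) b"
    and m: "m > 0"
  shows "d a (T x) - d (T x) b \<le> d a x - d x b + 2 * d ((T ^^ m) x) x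
     + m * drift_bound \<Lambda> ((4 * \<Lambda> + 1) * K + 2 * B + 4 * D) m"
proof -
  define h where "h p = d a p - d p b" for p
  define y where "y i = (T ^^ i) x" for i
  define Z where "Z = (4 * \<Lambda> + 1) * K + 2 * B + 4 * D"
  have yS: "y i \<in> S" for i by (induction i) (auto simp: y_def S T)
  have y_Suc: "y (Suc i) = T (y i)" for i by (simp add: y_def)
  have nearY: "defect a (y i) b \<le> K" if "i \<le> m" for i using near that by (simp add: y_def)
  have D0: "0 \<le> D" using D nonneg[of b "T b"] by linarith
  have Z0: "0 \<le> Z" using \<Lambda> K B D0 by (simp add: Z_def)
  have step: "h (y i) \<le> h (y (Suc i)) + drift_bound \<Lambda> Z i" if "i < m" for i
    using that
  proof (induction i)
    case 0
    then show ?case using fwd by (simp add: h_def y_def drift_bound_def)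
  next
    case (Suc i)
    define C where "C = drift_bound \<Lambda> Z i"
    let ?p = "y i" and ?q = "y (Suc i)"
    have C0: "0 \<le> C" unfolding C_def using \<Lambda> Z0 by (rule drift_bound_nonneg)
    have IH: "h ?p \<le> h ?q + C" using Suc by (simp add: C_def)
    have np: "defect a ?p b \<le> K" "defect a ?q b \<le> K" "defect a (T ?q) b \<le> K"
      using nearY[of i] nearY[of "Suc i"] nearY[of "Suc (Suc i)"] Suc.prems by (simp_all add: y_Suc)
    have dpq: "2 * d ?p ?q \<le> h ?q - h ?p + 2 * C + 2 * K"
      using near_segment[OF S(1,2) yS yS np(1,2)] IH C0 by (simp add: h_def abs_if split: if_splits)
    have p0: "0 \<le> defect a ?p b" using triangle[OF S(1) yS S(2)] by (simp add: defect_def)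
    \<comment> \<open>Since the move from \<open>?p\<close> to \<open>?q\<close> hardly goes back,
      \<open>?q\<close> is almost between \<open>?p\<close> and \<open>b\<close>. By
      \<open>lip_defect\<close>, \<open>T ?q\<close> is almost between \<open>T ?p\<close> and
      \<open>T b\<close>, and \<open>T b\<close> is near \<open>b\<close>: the next move hardly goes
      back either.\<close>
    have "2 * defect ?p ?q b \<le> 2 * C + 4 * K"
      using dpq np p0 K by (simp add: h_def defect_def)
    then have "\<Lambda> * defect ?p ?q b \<le> \<Lambda> * (C + 2 * K)"
      using \<Lambda> by (intro mult_left_mono) auto
    then have "defect (T ?p) (T ?q) (T b) \<le> \<Lambda> * (C + 2 * K) + B"
      using lip_defect[OF yS yS S(2), of i "Suc i"] by linarith
    then have "d (T ?q) b \<le> d (T ?p) b + \<Lambda> * (C + 2 * K) + B + 2 * D"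
      using triangle[OF T[OF yS] T[OF S(2)] S(2), of "Suc i"] triangle[OF T[OF yS] S(2) T[OF S(2)], of i]
        sym[OF S(2) T[OF S(2)]] D nonneg[of "T ?p" "T ?q"] by (simp add: defect_def)
    then have "h (T ?p) \<le> h (T ?q) + (K + 2 * (\<Lambda> * (C + 2 * K) + B + 2 * D))"
      using np triangle[OF S(1) T[OF yS] S(2), of "Suc i"] by (simp add: h_def defect_def y_Suc)
    also have "K + 2 * (\<Lambda> * (C + 2 * K) + B + 2 * D) = drift_bound \<Lambda> Z (Suc i)"
      unfolding drift_bound_Suc Z_def C_def by (simp add: algebra_simps)
    finally show ?case by (simp add: y_Suc)
  qed
  \<comment> \<open>What the first move gains towards \<open>b\<close> is still there after
    \<open>m\<close> moves, up to the accumulated backward movement; but \<open>y m\<close> is only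
    \<open>d (y m) x\<close> away from \<open>x\<close>.\<close>
  have "h (y 1) \<le> h (y (Suc j)) + j * drift_bound \<Lambda> Z m" if "j < m" for j
    using that
  proof (induction j)
    case (Suc j)
    then have "h (y (Suc j)) \<le> h (y (Suc (Suc j))) + drift_bound \<Lambda> Z m"
      using step[of "Suc j"] drift_bound_mono[OF \<Lambda> Z0, of "Suc j" m] by linarith
    with Suc show ?case by (simp add: algebra_simps)
  qed simp
  from this[of "m - 1"] m have "h (y 1) \<le> h (y m) + (m - 1) * drift_bound \<Lambda> Z m" by simp
  also have "\<dots> \<le> h (y m) + m * drift_bound \<Lambda> Z m"
    using drift_bound_nonneg[OF \<Lambda> Z0, of m] by (simp add: mult_right_mono)
  also have "h (y m) \<le> h x + 2 * d (y m) x"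
    using triangle[OF S(1) S(3) yS, of m] triangle[OF S(3) yS S(2), of m] sym[OF S(3) yS, of m]
    by (simp add: h_def)
  finally show ?thesis by (simp add: h_def y_def Z_def)
qed

text \<open>A move towards \<open>a\<close> is treated by exchanging \<open>a\<close> and
  \<open>b\<close>, which reverses the sign of positions. So the position of \<open>x\<close>
  changes by a bounded amount, and \<open>near_segment\<close> turns this into a distance.\<close>

lemma drift:
  fixes \<Lambda> B D K :: int
  assumes S: "a \<in> S" "b \<in> S" "x \<in> S" and T: "\<And>p. p \<in> S \<Longrightarrow> T p \<in> S"
    and \<Lambda>: "0 \<le> \<Lambda>" and K: "0 \<le> K"
    and lip_defect: "\<And>p q r. p \<in> S \<Longrightarrow> q \<in> S \<Longrightarrow> r \<in> S \<Longrightarrow> defect (T p) (T q) (T r) \<le> \<Lambda> * defect p q r + B"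
    and D: "d a (T a) \<le> D" "d b (T b) \<le> D" and B: "0 \<le> B"
    and near: "\<And>i. i \<le> m \<Longrightarrow> defect a ((T ^^ i) x) b \<le> K"
    and m: "m > 0"
  shows "2 * d x (T x) \<le> 2 * d ((T ^^ m) x) x
     + m * drift_bound \<Lambda> ((4 * \<Lambda> + 1) * K + 2 * B + 4 * D) m + 2 * K"
proof -
  let ?R = "2 * d ((T ^^ m) x) x + m * drift_bound \<Lambda> ((4 * \<Lambda> + 1) * K + 2 * B + 4 * D) m"
  have "0 \<le> D" using D(1) nonneg[of a "T a"] by linarith
  then have R0: "0 \<le> ?R"
    using \<Lambda> K B nonneg by (intro add_nonneg_nonneg mult_nonneg_nonneg drift_bound_nonneg) auto
  have iS: "(T ^^ i) x \<in> S" for i by (induction i) (auto simp: S T)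
  have "\<bar>(d a (T x) - d (T x) b) - (d a x - d x b)\<bar> \<le> ?R"
  proof (cases "d a x - d x b \<le> d a (T x) - d (T x) b")
    case True
    then show ?thesis
      using one_sided_drift[OF S T \<Lambda> K lip_defect D(2) B near True m] by simp
  next
    case False
    have "d b (T x) - d (T x) a \<le> d b x - d x a + 2 * d ((T ^^ m) x) x + m * drift_bound \<Lambda> ((4 * \<Lambda> + 1) * K + 2 * B + 4 * D) m"
    proof (rule one_sided_drift[OF S(2,1,3) T \<Lambda> K lip_defect D(1) B _ _ m])
      show "d b x - d x a \<le> d b (T x) - d (T x) a"
        using False sym S T by (smt (verit))
      show "defect b ((T ^^ i) x) a \<le> K" if "i \<le> m" for i
        using near[OF that] defect_sym[OF S(2) iS S(1)] by simp
    qed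
    then show ?thesis using False sym S T by (smt (verit))
  qed
  moreover have "defect a (T x) b \<le> K" "defect a x b \<le> K"
    using near[of 1] near[of 0] m by auto
  ultimately show ?thesis
    using near_segment[OF S(1,2,3) T[OF S(3)], of K] by simp
qed

text \<open>Applying \<open>T\<close> stretches the displacement of the previous iterate by at most
  \<open>\<Lambda>\<close>, whence the geometric sum. It serves for the two ends of a
  segment.\<close>

lemma iterate_displacement:
  assumes T: "\<And>p. p \<in> S \<Longrightarrow> T p \<in> S" and lip: "\<And>p q. p \<in> S \<Longrightarrow> q \<in> S \<Longrightarrow> d (T p) (T q) \<le> \<Lambda> * d p q"
    and \<Lambda>: "0 \<le> \<Lambda>" and D: "d a (T a) \<le> D" and a: "a \<in> S" and dd: "d a a = 0"
  shows "d a ((T ^^ i) a) \<le> D * (\<Sum>k<i. \<Lambda> ^ k)"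
proof (induction i)
  case 0
  then show ?case by (simp add: dd)
next
  case (Suc i)
  have iS: "(T ^^ i) a \<in> S" for i by (induction i) (auto simp: a T)
  have "d a ((T ^^ Suc i) a) \<le> d a (T a) + d (T a) (T ((T ^^ i) a))"
    using triangle[OF a T[OF a] T[OF iS]] by simp
  also have "\<dots> \<le> D + \<Lambda> * d a ((T ^^ i) a)" using D lip[OF a iS] by (intro add_mono)
  also have "\<dots> \<le> D + \<Lambda> * (D * (\<Sum>k<i. \<Lambda> ^ k))"
    using Suc \<Lambda> by (intro add_left_mono mult_left_mono)
  also have "\<dots> = D * (\<Sum>k<Suc i. \<Lambda> ^ k)"
    by (simp add: sum.lessThan_Suc_shift sum_distrib_left algebra_simps del: sum.lessThan_Suc)
  finally show ?case by simp
qed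

lemma iterate_defect:
  assumes T: "\<And>p. p \<in> S \<Longrightarrow> T p \<in> S" and \<Lambda>: "0 \<le> \<Lambda>"
    and lip_defect: "\<And>p q r. p \<in> S \<Longrightarrow> q \<in> S \<Longrightarrow> r \<in> S \<Longrightarrow> defect (T p) (T q) (T r) \<le> \<Lambda> * defect p q r + B"
    and S: "a \<in> S" "x \<in> S" "b \<in> S" and 0: "defect a x b = 0"
  shows "defect ((T ^^ i) a) ((T ^^ i) x) ((T ^^ i) b) \<le> B * (\<Sum>k<i. \<Lambda> ^ k)"
proof (induction i)
  case 0
  then show ?case using \<open>defect a x b = 0\<close> by simp
next
  case (Suc i)
  have iS: "p \<in> S \<Longrightarrow> (T ^^ i) p \<in> S" for i p by (induction i) (auto simp: T)
  have "defect ((T ^^ Suc i) a) ((T ^^ Suc i) x) ((T ^^ Suc i) b)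
      \<le> \<Lambda> * defect ((T ^^ i) a) ((T ^^ i) x) ((T ^^ i) b) + B"
    using lip_defect[OF iS iS iS, OF S] by simp
  also have "\<dots> \<le> \<Lambda> * (B * (\<Sum>k<i. \<Lambda> ^ k)) + B"
    using Suc \<Lambda> by (intro add_right_mono mult_left_mono)
  also have "\<dots> = B * (\<Sum>k<Suc i. \<Lambda> ^ k)"
    by (simp add: sum.lessThan_Suc_shift sum_distrib_left algebra_simps del: sum.lessThan_Suc)
  finally show ?case by simp
qed

text \<open>Supplies the constant \<open>K\<close> of \<open>drift\<close>: each iterate of
  \<open>x\<close> is nearly between the iterates of \<open>a\<close> and \<open>b\<close>, and
  these have not moved far.\<close>

lemma displacement_on_segment:
  fixes \<Lambda> B D :: int
  assumes S: "a \<in> S" "b \<in> S" "x \<in> S" and T: "\<And>p. p \<in> S \<Longrightarrow> T p \<in> S"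
    and dd: "\<And>p. p \<in> S \<Longrightarrow> d p p = 0"
    and \<Lambda>: "0 \<le> \<Lambda>" and B: "0 \<le> B"
    and lip: "\<And>p q. p \<in> S \<Longrightarrow> q \<in> S \<Longrightarrow> d (T p) (T q) \<le> \<Lambda> * d p q"
    and lip_defect: "\<And>p q r. p \<in> S \<Longrightarrow> q \<in> S \<Longrightarrow> r \<in> S \<Longrightarrow> defect (T p) (T q) (T r) \<le> \<Lambda> * defect p q r + B"
    and D: "d a (T a) \<le> D" "d b (T b) \<le> D"
    and 0: "defect a x b = 0" and m: "m > 0" and s: "s = (\<Sum>k<m. \<Lambda> ^ k)" and K: "K = (B + 4 * D) * s"
  shows "2 * d x (T x) \<le> 2 * d ((T ^^ m) x) x
     + m * drift_bound \<Lambda> ((4 * \<Lambda> + 1) * K + 2 * B + 4 * D) m + 2 * K"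
proof (rule drift[OF S T \<Lambda> _ lip_defect D B _ m])
  have D0: "0 \<le> D" using D(1) nonneg[of a "T a"] by linarith
  have "0 \<le> s" unfolding s using \<Lambda> by (simp add: sum_nonneg)
  then show "0 \<le> K" using B D0 by (simp add: K)
  fix i assume i: "i \<le> m"
  let ?s = "\<Sum>k<i. \<Lambda> ^ k"
  have iS: "p \<in> S \<Longrightarrow> (T ^^ i) p \<in> S" for p by (induction i) (auto simp: T)
  \<comment> \<open>Moving an end of a segment by \<open>e\<close> changes the defect by at most
    \<open>2 * e\<close>.\<close>
  have "defect a ((T ^^ i) x) b \<le> defect ((T ^^ i) a) ((T ^^ i) x) ((T ^^ i) b)
      + 2 * d a ((T ^^ i) a) + 2 * d b ((T ^^ i) b)"
    using triangle[OF S(1) iS iS, OF S(1) S(3)] triangle[OF iS iS S(2), OF S(3) S(2)]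
      triangle[OF iS S(1) iS, OF S(1) S(2)] triangle[OF S(1) S(2) iS, OF S(2)]
      sym[OF iS S(1), OF S(1)] sym[OF iS S(2), OF S(2)]
    by (simp add: defect_def)
  also have "\<dots> \<le> B * ?s + 2 * (D * ?s) + 2 * (D * ?s)"
    by (intro add_mono mult_left_mono iterate_defect[OF T \<Lambda> lip_defect] 0 S
        iterate_displacement[OF T lip \<Lambda>] dd D) auto
  also have "\<dots> = (B + 4 * D) * ?s" by (simp add: algebra_simps)
  also have "\<dots> \<le> K"
    unfolding K s using i \<Lambda> B D0 by (intro mult_left_mono sum_mono2) auto
  finally show "defect a ((T ^^ i) x) b \<le> K" by simp
qed auto

end

section \<open>The free group as a tree\<close>

abbreviation lcp :: "'a list \<Rightarrow> 'a list \<Rightarrow> nat" where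
  "lcp x y \<equiv> length (longest_common_prefix x y)"

lemma lcp_commute: "lcp x y = lcp y x"
  by (induction x y rule: longest_common_prefix.induct) auto

lemma lcp_le1: "lcp x y \<le> length x"
  by (simp add: longest_common_prefix_prefix1 prefix_length_le)

lemma lcp_le2: "lcp x y \<le> length y"
  by (simp add: longest_common_prefix_prefix2 prefix_length_le)

lemma lcp_self [simp]: "lcp x x = length x"
  by (induction x) auto

lemma lcp_Nil [simp]: "lcp [] x = 0" "lcp x [] = 0"
  by (cases x; simp)+

text \<open>Source of the tree structure: the triangle inequality and the four-point condition of
  \<open>wdist\<close> both reduce to it.\<close>

lemma lcp_ultrametric: "min (lcp x y) (lcp y z) \<le> lcp x z"
proof (induction x z arbitrary: y rule: longest_common_prefix.induct)
  case (1 a x b z)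
  then show ?case by (cases y) auto
qed (simp_all add: min_def)

lemma prefix_imp_le_lcp: "prefix p x \<Longrightarrow> prefix p y \<Longrightarrow> length p \<le> lcp x y"
  using longest_common_prefix_max_prefix[of p x y] by (simp add: prefix_length_le)

lemma prefix_take_iff_le_lcp: "prefix (take r x) y \<and> r \<le> length x \<longleftrightarrow> r \<le> lcp x y"
proof
  assume "prefix (take r x) y \<and> r \<le> length x"
  then show "r \<le> lcp x y" using prefix_imp_le_lcp[of "take r x" x y] by (auto simp: take_is_prefix)
next
  assume r: "r \<le> lcp x y"
  then have "take r x = take r (longest_common_prefix x y)"
    using longest_common_prefix_prefix1[of x y] by (metis prefixE take_append diff_is_0_eq' take_0 append_Nil2)
  then have "prefix (take r x) (longest_common_prefix x y)" by (simp add: take_is_prefix)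
  then show "prefix (take r x) y \<and> r \<le> length x"
    using prefix_order.trans[OF _ longest_common_prefix_prefix2] r lcp_le1[of x y] by fastforce
qed

lemma lcp_take: "lcp (take i x) (take j y) \<le> lcp x y"
  by (intro prefix_imp_le_lcp prefix_order.trans[OF longest_common_prefix_prefix1]
      prefix_order.trans[OF longest_common_prefix_prefix2] take_is_prefix)

lemma reduced_append:
  "reduced (u @ v) \<longleftrightarrow> reduced u \<and> reduced v \<and> (u \<noteq> [] \<longrightarrow> v \<noteq> [] \<longrightarrow> hd v \<noteq> inv_letter (last u))"
  by (auto simp: reduced_def successively_append_iff)

lemma reduced_rev_map_inv: "reduced (rev (map inv_letter w)) \<longleftrightarrow> reduced w"
  unfolding reduced_def successively_rev successively_map
  by (rule arg_cong[of _ _ "\<lambda>R. successively R w"]) (metis inv_letter_inv_letter)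

lemma free_reduce_cancel_letter: "free_reduce (u @ inv_letter a # a # v) = free_reduce (u @ v)"
  using cons_reduce_cancel[OF reduced_free_reduce, of "inv_letter a" v]
  by (simp add: free_reduce_append) (simp add: free_reduce_def)

lemma length_free_reduce: "length (free_reduce w) \<le> length w"
proof (induction w)
  case (Cons a w)
  have "length (cons_reduce a v) \<le> Suc (length v)" for v by (cases v) auto
  then show ?case using Cons by (simp add: free_reduce_def) (meson Suc_le_mono le_trans)
qed (simp add: free_reduce_def)

lemma sum_powers_le: "(\<Sum>i\<le>M. s ^ i) \<le> Suc s ^ M" for s :: nat
proof (induction M)
  case (Suc M)
  have "s * s ^ M \<le> s * Suc s ^ M" by (intro mult_left_mono power_mono) auto
  from add_mono[OF Suc this] show ?case by simp
qed simp

context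
  fixes n :: nat
begin

abbreviation (input) FF where "FF \<equiv> free_group n"

interpretation F: group FF by (rule group_free_group)

lemma carrier_F: "w \<in> carrier FF \<longleftrightarrow> w \<in> words_over n \<and> reduced w"
  by (simp add: free_group_def)

lemma mult_F: "u \<otimes>\<^bsub>FF\<^esub> v = free_reduce (u @ v)" and one_F: "\<one>\<^bsub>FF\<^esub> = []"
  by (simp_all add: free_group_def)

lemma inv_F:
  assumes "x \<in> carrier FF" shows "inv\<^bsub>FF\<^esub> x = rev (map inv_letter x)"
proof (rule F.inv_equality)
  show "rev (map inv_letter x) \<otimes>\<^bsub>FF\<^esub> x = \<one>\<^bsub>FF\<^esub>"
    by (simp add: mult_F one_F free_reduce_inverse)
  show "rev (map inv_letter x) \<in> carrier FF"
    using assms by (auto simp: carrier_F reduced_rev_map_inv words_over_def inv_letter_def)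
qed (rule assms)

lemma length_inv_F [simp]: "x \<in> carrier FF \<Longrightarrow> length (inv\<^bsub>FF\<^esub> x) = length x"
  by (simp add: inv_F)

lemma length_mult_F: "length (u \<otimes>\<^bsub>FF\<^esub> v) \<le> length u + length v"
  using length_free_reduce[of "u @ v"] by (simp add: mult_F)

lemma take_closed: "x \<in> carrier FF \<Longrightarrow> take i x \<in> carrier FF"
  and drop_closed: "x \<in> carrier FF \<Longrightarrow> drop i x \<in> carrier FF"
  using reduced_append[of "take i x" "drop i x"]
  by (auto simp: carrier_F words_over_def dest: in_set_takeD in_set_dropD)

lemma take_mult_drop: "x \<in> carrier FF \<Longrightarrow> take i x \<otimes>\<^bsub>FF\<^esub> drop i x = x"
  by (simp add: mult_F carrier_F)

text \<open>Exactly the common prefix cancels in \<open>inv x \<otimes> y\<close>; where the words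
  first differ, the product is already reduced.\<close>

lemma length_inv_mult:
  assumes "x \<in> carrier FF" "y \<in> carrier FF"
  shows "length (inv\<^bsub>FF\<^esub> x \<otimes>\<^bsub>FF\<^esub> y) + 2 * lcp x y = length x + length y"
proof -
  have "length (free_reduce (rev (map inv_letter x) @ y)) + 2 * lcp x y = length x + length y"
    if "reduced x" "reduced y" for x y
    using that
  proof (induction x y rule: longest_common_prefix.induct)
    case (1 a x b y)
    show ?case
    proof (cases "a = b")
      case True
      then show ?thesis
        using 1 free_reduce_cancel_letter[of "rev (map inv_letter x)" a y] by (auto simp: reduced_Cons)
    next
      case False
      have "reduced (rev (map inv_letter (a # x)) @ b # y)"
        unfolding reduced_append reduced_rev_map_inv using 1 False by simp
      then show ?thesis using False by (simp del: rev.simps list.map)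
    qed
  qed (auto simp: reduced_rev_map_inv reduced_append[of "rev _" "[_]"])
  then show ?thesis using assms by (simp add: inv_F mult_F carrier_F)
qed

section \<open>The word metric\<close>

definition wdist :: "word \<Rightarrow> word \<Rightarrow> int" where
  "wdist x y = int (length (inv\<^bsub>FF\<^esub> x \<otimes>\<^bsub>FF\<^esub> y))"

lemma wdist_lcp: "x \<in> carrier FF \<Longrightarrow> y \<in> carrier FF \<Longrightarrow> wdist x y = length x + length y - 2 * int (lcp x y)"
  using length_inv_mult[of x y] by (simp add: wdist_def)

lemma wdist_mult_left:
  "g \<in> carrier FF \<Longrightarrow> x \<in> carrier FF \<Longrightarrow> y \<in> carrier FF \<Longrightarrow> wdist (g \<otimes>\<^bsub>FF\<^esub> x) (g \<otimes>\<^bsub>FF\<^esub> y) = wdist x y"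
  by (simp add: wdist_def F.inv_mult_group F.m_assoc) (simp add: F.m_assoc[symmetric])

lemma wdist_Nil: "x \<in> carrier FF \<Longrightarrow> wdist [] x = length x"
  using wdist_lcp[of "[]" x] F.one_closed by (simp add: one_F)

lemma wdist_self: "x \<in> carrier FF \<Longrightarrow> wdist x x = 0"
  by (simp add: wdist_lcp)

lemma tree_metric_wdist: "tree_metric (carrier FF) wdist"
proof
  show "0 \<le> wdist x y" for x y by (simp add: wdist_def)
  show "x \<in> carrier FF \<Longrightarrow> y \<in> carrier FF \<Longrightarrow> wdist x y = wdist y x" for x y
    by (simp add: wdist_lcp lcp_commute)
  show "wdist x z \<le> wdist x y + wdist y z"
    if "x \<in> carrier FF" "y \<in> carrier FF" "z \<in> carrier FF" for x y z
    using that lcp_ultrametric[of x y z] lcp_le1[of y z] lcp_le2[of x y]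
    by (simp add: wdist_lcp min_def split: if_splits)
  fix x y z w assume c: "x \<in> carrier FF" "y \<in> carrier FF" "z \<in> carrier FF" "w \<in> carrier FF"
  \<comment> \<open>Left translation moves \<open>w\<close> to the identity, from which distances
    are word lengths; the inequality is then \<open>lcp_ultrametric\<close> for the three other
    points.\<close>
  define t where "t u = inv\<^bsub>FF\<^esub> w \<otimes>\<^bsub>FF\<^esub> u" for u
  have tc: "u \<in> carrier FF \<Longrightarrow> t u \<in> carrier FF" for u using c by (simp add: t_def)
  have td: "u \<in> carrier FF \<Longrightarrow> v \<in> carrier FF \<Longrightarrow> wdist u v = wdist (t u) (t v)" for u v
    using c by (simp add: t_def wdist_mult_left)
  have tw: "t w = []" using c by (simp add: t_def one_F)
  show "wdist x y + wdist z w \<le> max (wdist x z + wdist y w) (wdist x w + wdist y z)"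
    unfolding td[OF c(1,2)] td[OF c(3,4)] td[OF c(1,3)] td[OF c(2,4)] td[OF c(1,4)] td[OF c(2,3)] tw
    using lcp_ultrametric[of "t x" "t z" "t y"] c lcp_commute[of "t y" "t z"] tc F.one_closed
    by (simp add: wdist_lcp one_F min_def max_def split: if_splits)
qed

interpretation T: tree_metric "carrier FF" wdist by (rule tree_metric_wdist)

text \<open>Seen from \<open>q\<close>, the geodesics to \<open>p\<close> and \<open>r\<close> share
  a beginning of half the defect in length. Hence a bound on common prefixes of images under an
  automorphism is a bound on defects of images.\<close>

lemma defect_lcp:
  assumes "p \<in> carrier FF" "q \<in> carrier FF" "r \<in> carrier FF"
  shows "T.defect p q r = 2 * int (lcp (inv\<^bsub>FF\<^esub> q \<otimes>\<^bsub>FF\<^esub> p) (inv\<^bsub>FF\<^esub> q \<otimes>\<^bsub>FF\<^esub> r))"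
proof -
  have "wdist p r = wdist (inv\<^bsub>FF\<^esub> q \<otimes>\<^bsub>FF\<^esub> p) (inv\<^bsub>FF\<^esub> q \<otimes>\<^bsub>FF\<^esub> r)"
    using assms by (simp add: wdist_mult_left)
  then show ?thesis
    using assms T.sym[of p q] by (simp add: T.defect_def wdist_lcp[of "_ \<otimes>\<^bsub>FF\<^esub> _"]) (simp add: wdist_def)
qed

lemma defect_mult_left:
  assumes "g \<in> carrier FF" "p \<in> carrier FF" "q \<in> carrier FF" "r \<in> carrier FF"
  shows "T.defect (g \<otimes>\<^bsub>FF\<^esub> p) (g \<otimes>\<^bsub>FF\<^esub> q) (g \<otimes>\<^bsub>FF\<^esub> r) = T.defect p q r"
  using assms by (simp add: T.defect_def wdist_mult_left)

text \<open>Prefixes of \<open>f\<close> are the vertices of the geodesic from the identity to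
  \<open>f\<close>.\<close>

lemma defect_take:
  assumes "f \<in> carrier FF" shows "T.defect [] (take i f) f = 0"
proof -
  have [simp]: "[] \<in> carrier FF" using F.one_closed by (simp add: one_F)
  have "lcp (take i f) f = length (take i f)"
    using prefix_imp_le_lcp[of "take i f" "take i f" f] lcp_le1[of "take i f" f]
    by (intro antisym) (simp_all add: take_is_prefix del: length_take)
  then show ?thesis using assms by (simp add: T.defect_def wdist_lcp take_closed)
qed

section \<open>Automorphisms as coarse maps of the tree\<close>

lemma auto_F_props:
  assumes "\<psi> \<in> auto FF"
  shows auto_F_closed: "x \<in> carrier FF \<Longrightarrow> \<psi> x \<in> carrier FF"
    and auto_F_mult: "x \<in> carrier FF \<Longrightarrow> y \<in> carrier FF \<Longrightarrow> \<psi> (x \<otimes>\<^bsub>FF\<^esub> y) = \<psi> x \<otimes>\<^bsub>FF\<^esub> \<psi> y"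
    and auto_F_inv: "x \<in> carrier FF \<Longrightarrow> \<psi> (inv\<^bsub>FF\<^esub> x) = inv\<^bsub>FF\<^esub> (\<psi> x)"
    and auto_F_one: "\<psi> [] = []"
proof -
  have "group_hom FF FF \<psi>"
    using assms by (simp add: group_hom_def group_hom_axioms_def auto_def F.is_group)
  then interpret group_hom FF FF \<psi> .
  show "x \<in> carrier FF \<Longrightarrow> \<psi> x \<in> carrier FF" "x \<in> carrier FF \<Longrightarrow> \<psi> (inv\<^bsub>FF\<^esub> x) = inv\<^bsub>FF\<^esub> (\<psi> x)"
    "x \<in> carrier FF \<Longrightarrow> y \<in> carrier FF \<Longrightarrow> \<psi> (x \<otimes>\<^bsub>FF\<^esub> y) = \<psi> x \<otimes>\<^bsub>FF\<^esub> \<psi> y" "\<psi> [] = []"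
    using hom_one by (auto simp: one_F)
qed

lemma auto_inverse:
  assumes "\<psi> \<in> auto FF"
  shows "\<exists>\<psi>'\<in>auto FF. \<forall>x\<in>carrier FF. \<psi>' (\<psi> x) = x \<and> \<psi> (\<psi>' x) = x"
proof -
  interpret A: group "AutoGroup FF" by (rule F.AutoGroup)
  let ?i = "inv\<^bsub>AutoGroup FF\<^esub> \<psi>"
  have c: "\<psi> \<in> carrier (AutoGroup FF)" using assms by (simp add: AutoGroup_simps)
  have i: "?i \<in> auto FF" using A.inv_closed[OF c] by (simp add: AutoGroup_simps)
  have "compose (carrier FF) ?i \<psi> = (\<lambda>x\<in>carrier FF. x)" "compose (carrier FF) \<psi> ?i = (\<lambda>x\<in>carrier FF. x)"
    using A.l_inv[OF c] A.r_inv[OF c] i assms by (simp_all add: AutoGroup_simps)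
  then have "\<And>x. x \<in> carrier FF \<Longrightarrow> ?i (\<psi> x) = x" "\<And>x. x \<in> carrier FF \<Longrightarrow> \<psi> (?i x) = x"
    by (metis compose_eq restrict_apply')+
  with i show ?thesis by blast
qed

lemma auto_lipschitz:
  assumes "\<psi> \<in> auto FF"
  shows "\<exists>L::nat. \<forall>w\<in>carrier FF. length (\<psi> w) \<le> L * length w"
proof (intro exI ballI)
  \<comment> \<open>The sum over the finitely many letters dominates the length of each
    image.\<close>
  define L where "L = (\<Sum>a\<in>{..<n} \<times> UNIV. length (\<psi> [a]))"
  show "length (\<psi> w) \<le> L * length w" if "w \<in> carrier FF" for w
    using that
  proof (induction w)
    case Nil
    then show ?case using auto_F_one[OF assms] by simp
  next
    case (Cons a w)
    have a: "a \<in> {..<n} \<times> UNIV" and ac: "[a] \<in> carrier FF" and w: "w \<in> carrier FF"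
      using Cons.prems by (auto simp: carrier_F words_over_def reduced_Cons)
    have "a # w = [a] \<otimes>\<^bsub>FF\<^esub> w" using Cons.prems by (simp add: mult_F carrier_F)
    then have "length (\<psi> (a # w)) \<le> length (\<psi> [a]) + length (\<psi> w)"
      using auto_F_mult[OF assms ac w] length_mult_F[of "\<psi> [a]" "\<psi> w"] by simp
    also have "length (\<psi> [a]) \<le> L"
      unfolding L_def using a by (intro member_le_sum) auto
    finally show ?case using Cons.IH[OF w] by simp
  qed
qed

lemma auto_wdist:
  assumes "\<psi> \<in> auto FF" "\<And>w. w \<in> carrier FF \<Longrightarrow> length (\<psi> w) \<le> L * length w"
    and "x \<in> carrier FF" "y \<in> carrier FF"
  shows "wdist (\<psi> x) (\<psi> y) \<le> L * wdist x y"
proof -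
  have "inv\<^bsub>FF\<^esub> \<psi> x \<otimes>\<^bsub>FF\<^esub> \<psi> y = \<psi> (inv\<^bsub>FF\<^esub> x \<otimes>\<^bsub>FF\<^esub> y)"
    using assms by (simp add: auto_F_mult auto_F_inv)
  then show ?thesis using assms(2)[of "inv\<^bsub>FF\<^esub> x \<otimes>\<^bsub>FF\<^esub> y"] assms(3,4)
    by (simp add: wdist_def flip: of_nat_mult)
qed

text \<open>The images of the prefixes of \<open>a\<close> form a path with steps of length at most \<open>L\<close>, which cannot
  jump over a vertex of the geodesic.\<close>

lemma path_meets_prefix:
  assumes \<psi>: "\<psi> \<in> auto FF" and L: "\<And>w. w \<in> carrier FF \<Longrightarrow> length (\<psi> w) \<le> L * length w"
    and a: "a \<in> carrier FF" and r: "r \<le> length (\<psi> a)"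
  obtains i where "i \<le> length a" "prefix (take r (\<psi> a)) (\<psi> (take i a))" "length (\<psi> (take i a)) \<le> r + L"
proof (cases "r = 0")
  case True
  then show thesis using that[of 0] auto_F_one[OF \<psi>] by simp
next
  case False
  define p where "p i = \<psi> (take i a)" for i
  have pc: "p i \<in> carrier FF" for i using take_closed[OF a] auto_F_closed[OF \<psi>] by (simp add: p_def)
  \<comment> \<open>\<open>p i\<close> is the first image that passes the vertex at height
    \<open>r\<close>; the one before branches off below it. As the step between them has length at
    most \<open>L\<close>, \<open>p i\<close> cannot reach beyond height
    \<open>r + L\<close>.\<close>
  define i where "i = (LEAST i. r \<le> lcp (p i) (\<psi> a))"
  have ex: "r \<le> lcp (p (length a)) (\<psi> a)" using r by (simp add: p_def)
  then have i: "r \<le> lcp (p i) (\<psi> a)" and ile: "i \<le> length a"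
    unfolding i_def by (rule LeastI, intro Least_le)
  have "i \<noteq> 0" using i False auto_F_one[OF \<psi>] by (cases i) (auto simp: p_def)
  then obtain j where j: "i = Suc j" by (cases i) auto
  have "\<not> r \<le> lcp (p j) (\<psi> a)" using j not_less_Least[of j "\<lambda>i. r \<le> lcp (p i) (\<psi> a)"] by (simp add: i_def)
  then have "lcp (p j) (p i) < r"
    using lcp_ultrametric[of "p j" "p i" "\<psi> a"] i by simp
  moreover have "wdist (p j) (p i) \<le> L"
  proof -
    have "lcp (take j a) (take i a) \<ge> j"
      using prefix_imp_le_lcp[of "take j a" "take j a" "take i a"] j ile
      by (simp add: min_def take_Suc_conv_app_nth)
    then have "wdist (take j a) (take i a) \<le> 1"
      using wdist_lcp[OF take_closed take_closed, OF a a, of j i] ile j by (simp del: take_all)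
    then show ?thesis
      using auto_wdist[OF \<psi> L take_closed[OF a] take_closed[OF a], of j i]
      by (simp add: p_def) (smt (verit) mult_left_le of_nat_0_le_iff)
  qed
  ultimately have "length (p i) \<le> r + L"
    using pc lcp_le1[of "p j" "p i"] by (simp add: wdist_lcp)
  moreover have "prefix (take r (\<psi> a)) (p i)"
    using i prefix_take_iff_le_lcp[of r "\<psi> a" "p i"] by (simp add: lcp_commute)
  ultimately show thesis using that[of i] ile by (simp add: p_def)
qed

text \<open>Cooper's bounded cancellation lemma.\<close>

lemma bounded_cancellation:
  assumes \<psi>: "\<psi> \<in> auto FF" and L: "\<And>w. w \<in> carrier FF \<Longrightarrow> length (\<psi> w) \<le> L * length w"
    and \<psi>': "\<psi>' \<in> auto FF" "\<And>x. x \<in> carrier FF \<Longrightarrow> \<psi>' (\<psi> x) = x"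
    and L': "\<And>w. w \<in> carrier FF \<Longrightarrow> length (\<psi>' w) \<le> L' * length w"
    and a: "a \<in> carrier FF" and b: "b \<in> carrier FF"
  shows "lcp (\<psi> a) (\<psi> b) \<le> 2 * L * lcp a b + 2 * L * L * L'"
proof -
  let ?r = "lcp (\<psi> a) (\<psi> b)"
  have y: "take ?r (\<psi> a) = take ?r (\<psi> b)"
    using longest_common_prefix_prefix1[of "\<psi> a" "\<psi> b"] longest_common_prefix_prefix2[of "\<psi> a" "\<psi> b"]
    by (metis append_eq_conv_conj prefixE)
  \<comment> \<open>Prefixes of \<open>a\<close> and \<open>b\<close> are chosen whose images lie at
    most \<open>L\<close> past the branch point of \<open>\<psi> a\<close> and
    \<open>\<psi> b\<close>, hence within \<open>2 * L\<close> of each other.\<close>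
  obtain i where i: "i \<le> length a" "prefix (take ?r (\<psi> a)) (\<psi> (take i a))" "length (\<psi> (take i a)) \<le> ?r + L"
    using path_meets_prefix[OF \<psi> L a lcp_le1] by metis
  obtain j where j: "j \<le> length b" "prefix (take ?r (\<psi> b)) (\<psi> (take j b))" "length (\<psi> (take j b)) \<le> ?r + L"
    using path_meets_prefix[OF \<psi> L b lcp_le2] by metis
  let ?u = "take i a" and ?v = "take j b"
  have c: "?u \<in> carrier FF" "?v \<in> carrier FF" using a b take_closed by auto
  then have \<psi>c: "\<psi> ?u \<in> carrier FF" "\<psi> ?v \<in> carrier FF" using auto_F_closed[OF \<psi>] by auto
  have r: "?r \<le> lcp (\<psi> ?u) (\<psi> ?v)"
    using prefix_imp_le_lcp[OF i(2) j(2)[folded y]] lcp_le1[of "\<psi> a" "\<psi> b"] by simp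
  have "wdist (\<psi> ?u) (\<psi> ?v) \<le> 2 * L"
    using r i(3) j(3) \<psi>c by (simp add: wdist_lcp)
  \<comment> \<open>By the inverse automorphism the prefixes themselves are close; this bounds
    \<open>i\<close> in terms of \<open>lcp a b\<close>, and with it the length of
    \<open>\<psi> ?u\<close>.\<close>
  then have "int L' * wdist (\<psi> ?u) (\<psi> ?v) \<le> int L' * (2 * int L)" by (intro mult_left_mono) auto
  then have "wdist ?u ?v \<le> int L' * (2 * int L)"
    using auto_wdist[OF \<psi>'(1) L' \<psi>c] \<psi>'(2) c by simp
  then have "int i + int j - 2 * lcp ?u ?v \<le> int L' * (2 * int L)"
    using c i(1) j(1) by (simp add: wdist_lcp min_absorb2)
  then have "int i \<le> int (2 * lcp a b + L' * (2 * L))"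
    using lcp_take[of i a j b] lcp_le2[of ?u ?v] j(1) by simp
  then have "i \<le> 2 * lcp a b + L' * (2 * L)" by linarith
  then have "L * i \<le> L * (2 * lcp a b + L' * (2 * L))" by (rule mult_left_mono) simp
  moreover have "?r \<le> L * i"
    using r lcp_le1[of "\<psi> ?u" "\<psi> ?v"] L[OF c(1)] i(1) by (simp add: min_absorb2)
  ultimately show ?thesis by (simp add: algebra_simps)
qed

lemma wdist_mult_right: "x \<in> carrier FF \<Longrightarrow> g \<in> carrier FF \<Longrightarrow> wdist x (x \<otimes>\<^bsub>FF\<^esub> g) = length g"
  by (simp add: wdist_def) (simp add: F.m_assoc[symmetric])

text \<open>Left translation by \<open>c\<close> is an isometry. As it moves the ends by at most
  \<open>Q\<close>, the image of \<open>x\<close> has nearly the same distances from them as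
  \<open>x\<close>, and \<open>near_segment\<close> applies with error \<open>2 * Q\<close>.\<close>

lemma translation_displacement:
  assumes c: "c \<in> carrier FF" and X: "a \<in> carrier FF" "b \<in> carrier FF" "x \<in> carrier FF"
    and Q: "wdist a (c \<otimes>\<^bsub>FF\<^esub> a) \<le> Q" "wdist b (c \<otimes>\<^bsub>FF\<^esub> b) \<le> Q"
    and 0: "T.defect a x b = 0"
  shows "wdist x (c \<otimes>\<^bsub>FF\<^esub> x) \<le> 3 * Q"
proof -
  let ?c = "\<lambda>x. c \<otimes>\<^bsub>FF\<^esub> x"
  have cX: "?c a \<in> carrier FF" "?c b \<in> carrier FF" "?c x \<in> carrier FF" using c X by auto
  have 1: "wdist a (?c x) \<le> Q + wdist a x"
    using T.triangle[OF X(1) cX(1,3)] Q(1) wdist_mult_left[OF c X(1,3)] by simp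
  have 2: "wdist (?c x) b \<le> Q + wdist x b"
    using T.triangle[OF cX(3,2) X(2)] Q(2) wdist_mult_left[OF c X(3,2)] T.sym[OF X(2) cX(2)] by simp
  have Q0: "0 \<le> Q" using Q(1) T.nonneg[of a "?c a"] by linarith
  have t: "wdist a b \<le> wdist a (?c x) + wdist (?c x) b"
    using T.triangle[OF X(1) cX(3) X(2)] .
  have "T.defect a (?c x) b \<le> 2 * Q" "T.defect a x b \<le> 2 * Q"
    using 1 2 0 Q0 by (simp_all add: T.defect_def)
  from T.near_segment[OF X(1,2,3) cX(3) this(2,1)]
  have "2 * wdist x (?c x)
      \<le> \<bar>(wdist a (?c x) - wdist (?c x) b) - (wdist a x - wdist x b)\<bar> + 2 * (2 * Q)" .
  moreover have "\<bar>(wdist a (?c x) - wdist (?c x) b) - (wdist a x - wdist x b)\<bar> \<le> 2 * Q"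
    using 1 2 t 0 by (simp add: T.defect_def abs_le_iff)
  ultimately show ?thesis by linarith
qed

text \<open>The factor develops by \<open>c \<mapsto> u \<otimes> \<psi> c\<close>. When
  \<open>\<psi> ^^ m\<close> is inner, the \<open>m\<close>-th iterate thus becomes a left
  translation followed by right multiplication with a fixed element.\<close>

lemma funpow_twist:
  assumes \<psi>: "\<psi> \<in> auto FF" and u: "u \<in> carrier FF"
  shows "\<exists>c\<in>carrier FF. \<forall>x\<in>carrier FF. ((\<lambda>x. u \<otimes>\<^bsub>FF\<^esub> \<psi> x) ^^ i) x = c \<otimes>\<^bsub>FF\<^esub> (\<psi> ^^ i) x"
proof (induction i)
  case 0
  show ?case by (rule bexI[of _ "\<one>\<^bsub>FF\<^esub>"]) auto
next
  case (Suc i)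
  then obtain c where c: "c \<in> carrier FF"
    "\<forall>x\<in>carrier FF. ((\<lambda>x. u \<otimes>\<^bsub>FF\<^esub> \<psi> x) ^^ i) x = c \<otimes>\<^bsub>FF\<^esub> (\<psi> ^^ i) x" by blast
  have i: "x \<in> carrier FF \<Longrightarrow> (\<psi> ^^ i) x \<in> carrier FF" for x i
    by (induction i) (auto intro: auto_F_closed[OF \<psi>])
  show ?case
    using c u i auto_F_closed[OF \<psi>] auto_F_mult[OF \<psi>]
    by (intro bexI[of _ "u \<otimes>\<^bsub>FF\<^esub> \<psi> c"]) (auto simp: F.m_assoc)
qed

text \<open>For \<open>T x = inv U \<otimes> \<psi> x\<close>, the two lengths on the right are the
  displacements at \<open>[]\<close> and at \<open>f\<close>, and the prefixes of \<open>f\<close>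
  lie on the segment between them. \<open>A\<close> is the same for all \<open>U\<close> and
  \<open>f\<close>, and the bound is linear.\<close>

lemma twisted_displacement:
  assumes \<psi>: "\<psi> \<in> auto FF" and m: "m > 0" and h: "h \<in> carrier FF"
    and inner: "\<And>x. x \<in> carrier FF \<Longrightarrow> (\<psi> ^^ m) x = inv\<^bsub>FF\<^esub> h \<otimes>\<^bsub>FF\<^esub> x \<otimes>\<^bsub>FF\<^esub> h"
  shows "\<exists>A :: nat. \<forall>U\<in>carrier FF. \<forall>f\<in>carrier FF. \<forall>i.
     length (inv\<^bsub>FF\<^esub> (take i f) \<otimes>\<^bsub>FF\<^esub> (inv\<^bsub>FF\<^esub> U \<otimes>\<^bsub>FF\<^esub> \<psi> (take i f)))
     \<le> A * Suc (length U + length (inv\<^bsub>FF\<^esub> f \<otimes>\<^bsub>FF\<^esub> (inv\<^bsub>FF\<^esub> U \<otimes>\<^bsub>FF\<^esub> \<psi> f)))"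
proof -
  obtain L where L: "\<And>w. w \<in> carrier FF \<Longrightarrow> length (\<psi> w) \<le> L * length w"
    using auto_lipschitz[OF \<psi>] by blast
  obtain \<psi>' where \<psi>': "\<psi>' \<in> auto FF" "\<And>x. x \<in> carrier FF \<Longrightarrow> \<psi>' (\<psi> x) = x"
    using auto_inverse[OF \<psi>] by blast
  obtain L' where L': "\<And>w. w \<in> carrier FF \<Longrightarrow> length (\<psi>' w) \<le> L' * length w"
    using auto_lipschitz[OF \<psi>'(1)] by blast
  \<comment> \<open>Constants from \<open>bounded_cancellation\<close>, the additive one doubled
    because a defect is twice a common prefix. \<open>\<Lambda>\<close> is also a Lipschitz constant
    of \<open>\<psi>\<close>.\<close>
  define \<Lambda> B where "\<Lambda> = int (2 * L)" and "B = int (4 * L * L * L')"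
  define s where "s = (\<Sum>k<m. \<Lambda> ^ k)"
  define S where "S = T.drift_bound \<Lambda> 1 m"
  define H where "H = int (length h)"
  have nn: "0 \<le> \<Lambda>" "0 \<le> B" "0 \<le> s" "0 \<le> S" "0 \<le> H"
    by (simp_all add: \<Lambda>_def B_def s_def S_def H_def sum_nonneg T.drift_bound_nonneg)
  \<comment> \<open>Collects the coefficients of the bounds below, which are affine in
    \<open>D\<close> and each estimated by a multiple of \<open>D + 1\<close>.\<close>
  define A where "A = 8 * H + 6 * s + m * (((4 * \<Lambda> + 1) * ((B + 4) * s) + 2 * B + 4) * S) + 2 * ((B + 4) * s)"
  have A0: "0 \<le> A" unfolding A_def using nn by (intro add_nonneg_nonneg mult_nonneg_nonneg) auto
  have key: "wdist x (inv\<^bsub>FF\<^esub> U \<otimes>\<^bsub>FF\<^esub> \<psi> x) \<le> A * (D + 1)"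
    if U: "U \<in> carrier FF" and f: "f \<in> carrier FF" and x: "x = take i f"
      and D: "D = int (length U + length (inv\<^bsub>FF\<^esub> f \<otimes>\<^bsub>FF\<^esub> (inv\<^bsub>FF\<^esub> U \<otimes>\<^bsub>FF\<^esub> \<psi> f)))"
    for U f x i D
  proof -
    define T where "T x = inv\<^bsub>FF\<^esub> U \<otimes>\<^bsub>FF\<^esub> \<psi> x" for x
    define K where "K = (B + 4 * D) * s"
    note \<psi>c = auto_F_closed[OF \<psi>]
    have Nil: "[] \<in> carrier FF" using F.one_closed by (simp add: one_F)
    have xc: "x \<in> carrier FF" unfolding x by (rule take_closed[OF f])
    have Tc: "p \<in> carrier FF \<Longrightarrow> T p \<in> carrier FF" for p using U \<psi>c by (simp add: T_def)
    have lip: "wdist (T p) (T q) \<le> \<Lambda> * wdist p q" if "p \<in> carrier FF" "q \<in> carrier FF" for p q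
    proof -
      have "wdist (T p) (T q) \<le> L * wdist p q"
        using auto_wdist[OF \<psi> L that] that U \<psi>c by (simp add: T_def wdist_mult_left)
      also have "\<dots> \<le> \<Lambda> * wdist p q"
        using T.nonneg by (intro mult_right_mono) (auto simp: \<Lambda>_def)
      finally show ?thesis by simp
    qed
    have defect: "T.defect (T p) (T q) (T r) \<le> \<Lambda> * T.defect p q r + B"
      if "p \<in> carrier FF" "q \<in> carrier FF" "r \<in> carrier FF" for p q r
    proof -
      let ?a = "inv\<^bsub>FF\<^esub> q \<otimes>\<^bsub>FF\<^esub> p" and ?b = "inv\<^bsub>FF\<^esub> q \<otimes>\<^bsub>FF\<^esub> r"
      have "T.defect (T p) (T q) (T r) = T.defect (\<psi> p) (\<psi> q) (\<psi> r)"
        unfolding T_def using that U \<psi>c by (intro defect_mult_left) auto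
      also have "\<dots> = 2 * int (lcp (\<psi> ?a) (\<psi> ?b))"
        using that \<psi>c by (simp add: defect_lcp auto_F_mult[OF \<psi>] auto_F_inv[OF \<psi>])
      also have "\<dots> \<le> 2 * int (2 * L * lcp ?a ?b + 2 * L * L * L')"
        using bounded_cancellation[OF \<psi> L \<psi>' L', of ?a ?b] that by (simp del: of_nat_add of_nat_mult)
      also have "\<dots> = \<Lambda> * T.defect p q r + B"
        using that by (simp add: defect_lcp \<Lambda>_def B_def)
      finally show ?thesis by simp
    qed
    have D1: "wdist [] (T []) \<le> D"
    proof -
      have "T [] = inv\<^bsub>FF\<^esub> U"
        using F.r_one[of "inv\<^bsub>FF\<^esub> U"] U by (simp add: T_def auto_F_one[OF \<psi>] one_F)
      then show ?thesis using U by (simp add: wdist_Nil D)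
    qed
    have D2: "wdist f (T f) \<le> D"
      using D by (simp add: T_def wdist_def)
    have D0: "0 \<le> D" by (simp add: D)
    have 0: "T.defect [] x f = 0" unfolding x by (rule defect_take[OF f])
    have ic: "p \<in> carrier FF \<Longrightarrow> (T ^^ i) p \<in> carrier FF" for i p by (induction i) (auto simp: Tc)
    have disp: "wdist [] ((T ^^ m) []) \<le> D * s" "wdist f ((T ^^ m) f) \<le> D * s"
      unfolding s_def
      by (intro T.iterate_displacement Tc lip nn D1 D2 Nil f wdist_self; assumption)+
    obtain c where c: "c \<in> carrier FF" "\<And>x. x \<in> carrier FF \<Longrightarrow> (T ^^ m) x = c \<otimes>\<^bsub>FF\<^esub> (\<psi> ^^ m) x"
      using funpow_twist[OF \<psi>, of "inv\<^bsub>FF\<^esub> U" m] U unfolding T_def by auto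
    define c' where "c' = c \<otimes>\<^bsub>FF\<^esub> inv\<^bsub>FF\<^esub> h"
    have c': "c' \<in> carrier FF" using c h by (simp add: c'_def)
    \<comment> \<open>The right factor \<open>h\<close> moves every vertex by exactly the length of
      \<open>h\<close>, so up to this error the iterate is the translation by
      \<open>c'\<close>.\<close>
    have Tm: "(T ^^ m) y = (c' \<otimes>\<^bsub>FF\<^esub> y) \<otimes>\<^bsub>FF\<^esub> h" if "y \<in> carrier FF" for y
      using that c h by (simp add: inner c'_def F.m_assoc)
    have close: "wdist ((T ^^ m) y) (c' \<otimes>\<^bsub>FF\<^esub> y) = H" "wdist (c' \<otimes>\<^bsub>FF\<^esub> y) ((T ^^ m) y) = H"
      if "y \<in> carrier FF" for y
      using wdist_mult_right[of "c' \<otimes>\<^bsub>FF\<^esub> y" h] that c' h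
        T.sym[of "c' \<otimes>\<^bsub>FF\<^esub> y" "c' \<otimes>\<^bsub>FF\<^esub> y \<otimes>\<^bsub>FF\<^esub> h"] by (simp_all add: Tm H_def)
    have Q: "wdist y (c' \<otimes>\<^bsub>FF\<^esub> y) \<le> D * s + H" if "y \<in> carrier FF" "wdist y ((T ^^ m) y) \<le> D * s" for y
      using T.triangle[OF that(1) ic[OF that(1)], of "c' \<otimes>\<^bsub>FF\<^esub> y" m] that c' close(1)[OF that(1)] by simp
    have "wdist x (c' \<otimes>\<^bsub>FF\<^esub> x) \<le> 3 * (D * s + H)"
      using translation_displacement[OF c' Nil f xc Q[OF Nil disp(1)] Q[OF f disp(2)] 0] .
    then have E: "wdist ((T ^^ m) x) x \<le> 3 * D * s + 4 * H"
      using T.triangle[OF ic[OF xc, of m] F.m_closed[OF c' xc] xc] close(1)[OF xc]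
        T.sym[OF xc F.m_closed[OF c' xc]] by (simp add: algebra_simps)
    have "2 * wdist x (T x) \<le> 2 * wdist ((T ^^ m) x) x
       + m * T.drift_bound \<Lambda> ((4 * \<Lambda> + 1) * K + 2 * B + 4 * D) m + 2 * K"
      by (rule T.displacement_on_segment[OF Nil f xc Tc wdist_self nn(1,2) lip defect D1 D2 0 m s_def K_def])
    \<comment> \<open>By linearity of \<open>drift_bound\<close> in its second argument, the
      dependence on \<open>D\<close> stays affine.\<close>
    also have "T.drift_bound \<Lambda> ((4 * \<Lambda> + 1) * K + 2 * B + 4 * D) m = ((4 * \<Lambda> + 1) * K + 2 * B + 4 * D) * S"
      by (simp add: T.drift_bound_def S_def)
    also have "2 * wdist ((T ^^ m) x) x + m * (((4 * \<Lambda> + 1) * K + 2 * B + 4 * D) * S) + 2 * K \<le> A * (D + 1)"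
    proof -
      have "(B + 4 * D) * s \<le> ((B + 4) * (D + 1)) * s"
        using nn D0 by (intro mult_right_mono) (simp_all add: algebra_simps)
      then have K: "K \<le> ((B + 4) * s) * (D + 1)" by (simp add: K_def algebra_simps)
      have "(4 * \<Lambda> + 1) * K \<le> (4 * \<Lambda> + 1) * (((B + 4) * s) * (D + 1))"
        using nn K by (intro mult_left_mono) auto
      moreover have "2 * B + 4 * D \<le> (2 * B + 4) * (D + 1)"
        using nn D0 by (simp add: algebra_simps)
      ultimately have "(4 * \<Lambda> + 1) * K + 2 * B + 4 * D
          \<le> ((4 * \<Lambda> + 1) * ((B + 4) * s) + 2 * B + 4) * (D + 1)"
        by (simp add: algebra_simps)
      then have "((4 * \<Lambda> + 1) * K + 2 * B + 4 * D) * S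
          \<le> (((4 * \<Lambda> + 1) * ((B + 4) * s) + 2 * B + 4) * (D + 1)) * S"
        using nn by (intro mult_right_mono) auto
      then have "m * (((4 * \<Lambda> + 1) * K + 2 * B + 4 * D) * S)
          \<le> m * ((((4 * \<Lambda> + 1) * ((B + 4) * s) + 2 * B + 4) * (D + 1)) * S)"
        by (intro mult_left_mono) auto
      moreover have "2 * wdist ((T ^^ m) x) x \<le> (6 * s + 8 * H) * (D + 1)"
      proof -
        have "0 \<le> 6 * s + 8 * (H * D)" using nn D0 by simp
        then show ?thesis using E by (simp add: algebra_simps)
      qed
      ultimately have "2 * wdist ((T ^^ m) x) x + m * (((4 * \<Lambda> + 1) * K + 2 * B + 4 * D) * S) + 2 * K
        \<le> (6 * s + 8 * H) * (D + 1) + m * ((((4 * \<Lambda> + 1) * ((B + 4) * s) + 2 * B + 4) * (D + 1)) * S)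
          + 2 * (((B + 4) * s) * (D + 1))"
        using K by linarith
      also have "\<dots> = A * (D + 1)"
        by (simp add: A_def algebra_simps)
      finally show ?thesis by simp
    qed
    finally show ?thesis using T.nonneg[of x "T x"] by (simp add: T_def)
  qed
  show ?thesis
  proof (intro exI[of _ "nat A"] ballI allI)
    fix U f i assume Uf: "U \<in> carrier FF" "f \<in> carrier FF"
    let ?x = "take i f"
    let ?D = "length U + length (inv\<^bsub>FF\<^esub> f \<otimes>\<^bsub>FF\<^esub> (inv\<^bsub>FF\<^esub> U \<otimes>\<^bsub>FF\<^esub> \<psi> f))"
    have "int (length (inv\<^bsub>FF\<^esub> ?x \<otimes>\<^bsub>FF\<^esub> (inv\<^bsub>FF\<^esub> U \<otimes>\<^bsub>FF\<^esub> \<psi> ?x))) \<le> int (nat A * Suc ?D)"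
      using key[OF Uf refl refl, of i] A0 by (simp add: wdist_def algebra_simps)
    then show "length (inv\<^bsub>FF\<^esub> ?x \<otimes>\<^bsub>FF\<^esub> (inv\<^bsub>FF\<^esub> U \<otimes>\<^bsub>FF\<^esub> \<psi> ?x)) \<le> nat A * Suc ?D"
      by (simp only: of_nat_le_iff)
  qed
qed

text \<open>A shortest solution \<open>f\<close> visits pairwise distinct twisted conjugates along its prefixes, for
  otherwise it could be shortened; these are short words, of which there are few.\<close>

lemma short_twisted_conjugator:
  assumes \<psi>: "\<psi> \<in> auto FF" and m: "m > 0" and h: "h \<in> carrier FF"
    and inner: "\<And>x. x \<in> carrier FF \<Longrightarrow> (\<psi> ^^ m) x = inv\<^bsub>FF\<^esub> h \<otimes>\<^bsub>FF\<^esub> x \<otimes>\<^bsub>FF\<^esub> h"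
  shows "\<exists>A :: nat. \<forall>U\<in>carrier FF. \<forall>V\<in>carrier FF.
     (\<exists>f\<in>carrier FF. U \<otimes>\<^bsub>FF\<^esub> f = \<psi> f \<otimes>\<^bsub>FF\<^esub> V) \<longrightarrow>
     (\<exists>f\<in>carrier FF. U \<otimes>\<^bsub>FF\<^esub> f = \<psi> f \<otimes>\<^bsub>FF\<^esub> V \<and> length f \<le> Suc (2 * n) ^ (A * Suc (length U + length V)))"
proof -
  obtain A :: nat where A: "\<And>U f i. U \<in> carrier FF \<Longrightarrow> f \<in> carrier FF \<Longrightarrow>
     length (inv\<^bsub>FF\<^esub> (take i f) \<otimes>\<^bsub>FF\<^esub> (inv\<^bsub>FF\<^esub> U \<otimes>\<^bsub>FF\<^esub> \<psi> (take i f)))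
     \<le> A * Suc (length U + length (inv\<^bsub>FF\<^esub> f \<otimes>\<^bsub>FF\<^esub> (inv\<^bsub>FF\<^esub> U \<otimes>\<^bsub>FF\<^esub> \<psi> f)))"
    using twisted_displacement[OF assms] by blast
  show ?thesis
  proof (intro exI[of _ A] ballI impI)
    fix U V assume U: "U \<in> carrier FF" and V: "V \<in> carrier FF"
      and ex: "\<exists>f\<in>carrier FF. U \<otimes>\<^bsub>FF\<^esub> f = \<psi> f \<otimes>\<^bsub>FF\<^esub> V"
    then obtain f0 where f0: "f0 \<in> carrier FF" "U \<otimes>\<^bsub>FF\<^esub> f0 = \<psi> f0 \<otimes>\<^bsub>FF\<^esub> V" by blast
    let ?P = "\<lambda>f. f \<in> carrier FF \<and> U \<otimes>\<^bsub>FF\<^esub> f = \<psi> f \<otimes>\<^bsub>FF\<^esub> V"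
    obtain f where f: "f \<in> carrier FF" and fV: "U \<otimes>\<^bsub>FF\<^esub> f = \<psi> f \<otimes>\<^bsub>FF\<^esub> V"
      and min: "\<And>g. ?P g \<Longrightarrow> length f \<le> length g"
      using ex_has_least_nat[of ?P f0 length] f0 by blast
    note \<psi>c = auto_F_closed[OF \<psi>]
    \<comment> \<open>\<open>W x\<close> is the displacement of the twisted map at \<open>x\<close>,
      as a word; the solutions are the \<open>x\<close> with displacement
      \<open>inv V\<close>.\<close>
    define W where "W x = inv\<^bsub>FF\<^esub> x \<otimes>\<^bsub>FF\<^esub> (inv\<^bsub>FF\<^esub> U \<otimes>\<^bsub>FF\<^esub> \<psi> x)" for x
    have W_iff: "W x = inv\<^bsub>FF\<^esub> V \<longleftrightarrow> U \<otimes>\<^bsub>FF\<^esub> x = \<psi> x \<otimes>\<^bsub>FF\<^esub> V" if "x \<in> carrier FF" for x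
    proof -
      have "inv\<^bsub>FF\<^esub> (W x) = inv\<^bsub>FF\<^esub> (\<psi> x) \<otimes>\<^bsub>FF\<^esub> (U \<otimes>\<^bsub>FF\<^esub> x)"
        using that U \<psi>c by (simp add: W_def F.inv_mult_group F.m_assoc)
      moreover have "W x \<in> carrier FF" using that U \<psi>c by (simp add: W_def)
      ultimately have "W x = inv\<^bsub>FF\<^esub> V \<longleftrightarrow> inv\<^bsub>FF\<^esub> (\<psi> x) \<otimes>\<^bsub>FF\<^esub> (U \<otimes>\<^bsub>FF\<^esub> x) = V"
        using V by (metis F.inv_inv)
      also have "\<dots> \<longleftrightarrow> U \<otimes>\<^bsub>FF\<^esub> x = \<psi> x \<otimes>\<^bsub>FF\<^esub> V"
        using that U V \<psi>c by (metis F.inv_closed F.inv_solve_left F.m_closed)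
      finally show ?thesis .
    qed
    \<comment> \<open>The right side depends on \<open>x\<close> only through \<open>W x\<close>; so
      the piece of \<open>f\<close> between two prefixes of equal displacement can be cut
      out.\<close>
    have W_mult: "W (x \<otimes>\<^bsub>FF\<^esub> g) = inv\<^bsub>FF\<^esub> g \<otimes>\<^bsub>FF\<^esub> W x \<otimes>\<^bsub>FF\<^esub> \<psi> g" if "x \<in> carrier FF" "g \<in> carrier FF" for x g
      using that U \<psi>c by (simp add: W_def F.inv_mult_group F.m_assoc auto_F_mult[OF \<psi>])
    have Wf: "W f = inv\<^bsub>FF\<^esub> V" using W_iff[OF f] fV by simp
    have inj: "inj_on (\<lambda>i. W (take i f)) {..length f}"
    proof (rule linorder_inj_onI)
      fix i j assume ij: "i < j" "i \<in> {..length f}" "j \<in> {..length f}"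
      show "W (take i f) \<noteq> W (take j f)"
      proof
        assume eq: "W (take i f) = W (take j f)"
        let ?g = "take i f \<otimes>\<^bsub>FF\<^esub> drop j f"
        have "W ?g = W (take j f \<otimes>\<^bsub>FF\<^esub> drop j f)"
          unfolding W_mult[OF take_closed[OF f] drop_closed[OF f]] eq by (rule refl)
        then have "?P ?g"
          using Wf W_iff[of ?g] F.m_closed[OF take_closed[OF f] drop_closed[OF f]]
          unfolding take_mult_drop[OF f] by simp
        then have "length f \<le> length ?g" by (rule min)
        also have "\<dots> \<le> length (take i f) + length (drop j f)" by (rule length_mult_F)
        finally show False using ij by simp
      qed
    qed auto
    define M where "M = A * Suc (length U + length V)"
    let ?B = "{w. set w \<subseteq> {..<n} \<times> (UNIV :: bool set) \<and> length w \<le> M}"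
    have "(\<lambda>i. W (take i f)) ` {..length f} \<subseteq> ?B"
    proof
      fix w assume "w \<in> (\<lambda>i. W (take i f)) ` {..length f}"
      then obtain i where w: "w = W (take i f)" by auto
      \<comment> \<open>Hence the displacement at the end \<open>f\<close> has the length of
        \<open>V\<close>, and the bound involves only \<open>U\<close> and \<open>V\<close>.\<close>
      have "W f = inv\<^bsub>FF\<^esub> V" by (rule Wf)
      then have "length w \<le> M" using A[OF U f, of i] V by (simp add: w M_def W_def)
      moreover have "w \<in> carrier FF" using f U \<psi>c by (simp add: w W_def take_closed)
      ultimately show "w \<in> ?B" by (auto simp: carrier_F words_over_def)
    qed
    moreover have "finite ?B" by (rule finite_lists_length_le) simp
    ultimately have "card {..length f} \<le> card ?B" by (rule card_inj_on_le[OF inj])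
    also have "card ?B = (\<Sum>i\<le>M. (2 * n) ^ i)"
      by (subst card_lists_length_le) (simp_all add: card_cartesian_product mult.commute)
    also have "\<dots> \<le> Suc (2 * n) ^ M" by (rule sum_powers_le)
    finally have "length f \<le> Suc (2 * n) ^ M" by simp
    then show "\<exists>f\<in>carrier FF. U \<otimes>\<^bsub>FF\<^esub> f = \<psi> f \<otimes>\<^bsub>FF\<^esub> V
        \<and> length f \<le> Suc (2 * n) ^ (A * Suc (length U + length V))"
      using f fV by (auto simp: M_def)
  qed
qed

end

section \<open>The extension by a cyclic group\<close>

text \<open>A letter \<open>b\<close> is chosen that cancels neither after \<open>c\<close> nor
  before it. Commuting then becomes an equality of words, which makes \<open>b\<close> the first
  letter of \<open>c\<close>.\<close>

lemma free_group_centre_trivial: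
  assumes n: "n \<ge> 2" and c: "c \<in> carrier (free_group n)"
    and comm: "\<And>x. x \<in> carrier (free_group n) \<Longrightarrow> c \<otimes>\<^bsub>free_group n\<^esub> x = x \<otimes>\<^bsub>free_group n\<^esub> c"
  shows "c = []"
proof (rule ccontr)
  assume "c \<noteq> []"
  then obtain a w where aw: "c = a # w" by (cases c) auto
  obtain i where i: "i < n" "i \<noteq> fst a"
    using n by (metis One_nat_def Suc_1 less_2_cases_iff less_le_trans zero_neq_one)
  \<comment> \<open>The index differs from that of the first letter of \<open>c\<close>, and the
    sign agrees with that of the last letter if the indices agree.\<close>
  define b where "b = (i, if fst (last c) = i then snd (last c) else False)"
  have b: "[b] \<in> carrier (free_group n)" using i by (simp add: b_def carrier_F words_over_def reduced_def)
  have r: "reduced c" using c by (simp add: carrier_F)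
  have "b \<noteq> inv_letter (last c)" by (auto simp: b_def inv_letter_def prod_eq_iff)
  then have "reduced (c @ [b])" using r by (simp add: reduced_append reduced_Cons)
  moreover have "reduced (b # c)" using r i aw by (auto simp: b_def reduced_Cons inv_letter_def prod_eq_iff)
  ultimately have "c @ [b] = b # c"
    using comm[OF b] by (simp add: mult_F)
  then have "a = b" using aw by simp
  then have "fst a = i" by (simp add: b_def)
  then show False using i by simp
qed

lemma auto_free_reduce:
  assumes "\<psi> \<in> auto (free_group n)" "x \<in> carrier (free_group n)"
  shows "\<psi> x = free_reduce (concat (map (\<lambda>a. \<psi> [a]) x))"
  using assms(2)
proof (induction x)
  case Nil
  then show ?case using auto_F_one[OF assms(1)] by simp
next
  case (Cons a x)
  have a: "[a] \<in> carrier (free_group n)" and x: "x \<in> carrier (free_group n)"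
    using Cons.prems by (auto simp: carrier_F words_over_def reduced_Cons)
  have "a # x = [a] \<otimes>\<^bsub>free_group n\<^esub> x" using Cons.prems by (simp add: mult_F carrier_F)
  then have "\<psi> (a # x) = \<psi> [a] \<otimes>\<^bsub>free_group n\<^esub> \<psi> x" using auto_F_mult[OF assms(1) a x] by simp
  then show ?case using Cons.IH[OF x] by (simp add: mult_F free_reduce_append_right)
qed

lemma (in group) length_like_int_pow:
  fixes len :: "'a \<Rightarrow> nat"
  assumes "len \<one> = 0" "\<And>x y. x \<in> carrier G \<Longrightarrow> y \<in> carrier G \<Longrightarrow> len (x \<otimes> y) \<le> len x + len y"
    "\<And>x. x \<in> carrier G \<Longrightarrow> len (inv x) = len x" and g: "g \<in> carrier G"
  shows "len (g [^] (q::int)) \<le> nat \<bar>q\<bar> * len g"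
proof -
  have nat: "len (g [^] (k::nat)) \<le> k * len g" for k
  proof (induction k)
    case (Suc k)
    have "len (g [^] Suc k) \<le> len (g [^] k) + len g" using assms(2) g by simp
    with Suc show ?case by simp
  qed (simp add: assms(1))
  show ?thesis
  proof (cases "q \<ge> 0")
    case True
    then have "g [^] q = g [^] nat q" by (metis int_nat_eq int_pow_int)
    then show ?thesis using nat[of "nat q"] True by simp
  next
    case False
    then have "g [^] q = inv (g [^] nat (- q))"
      by (metis add.inverse_inverse g int_nat_eq int_pow_int int_pow_neg less_eq_int_code(1) linorder_not_le neg_0_le_iff_le nle_le)
    then show ?thesis using nat[of "nat (- q)"] False g assms(3) by simp
  qed
qed

section \<open>Multiplication, normal forms and the word problem in the extension\<close>

locale free_by_cyclic_extension =
  fixes n N :: nat and \<phi> :: "word \<Rightarrow> word"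
  assumes \<phi>: "\<phi> \<in> auto (free_group n)"
    and fin: "N > 0 \<Longrightarrow> \<phi> [^]\<^bsub>AutoGroup (free_group n)\<^esub> N = \<one>\<^bsub>AutoGroup (free_group n)\<^esub>"
begin

interpretation F: group "free_group n" by (rule group_free_group)
interpretation A: group "AutoGroup (free_group n)" by (rule F.AutoGroup)
interpretation G: group "free_by_cyclic n \<phi> N" by (rule group_free_by_cyclic[OF \<phi> fin])

abbreviation (input) FF where "FF \<equiv> free_group n"
abbreviation GG where "GG \<equiv> free_by_cyclic n \<phi> N"
abbreviation pw :: "int \<Rightarrow> word \<Rightarrow> word" where "pw l \<equiv> \<phi> [^]\<^bsub>AutoGroup FF\<^esub> l"
abbreviation val :: "word \<Rightarrow> int \<times> word" where "val \<equiv> word_value GG (free_by_cyclic_gens n N)"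

lemma phi_carrier: "\<phi> \<in> carrier (AutoGroup FF)"
  using \<phi> by (simp add: AutoGroup_simps)

lemma pw_auto: "pw l \<in> auto FF"
  using A.int_pow_closed[OF phi_carrier, of l] by (simp add: AutoGroup_simps)

lemma pw_add: "x \<in> carrier FF \<Longrightarrow> pw (k + l) x = pw k (pw l x)"
  using A.int_pow_mult[OF phi_carrier, of k l] pw_auto by (simp add: AutoGroup_simps compose_eq)

lemma one_apply: "x \<in> carrier FF \<Longrightarrow> \<one>\<^bsub>AutoGroup FF\<^esub> x = x"
  unfolding AutoGroup_simps(2) by simp

lemma pw_1: "pw 1 = \<phi>"
  using A.int_pow_1[OF phi_carrier] .

lemma pw_mod: "pw (l mod int N) = pw l"
  by (rule pow_mod_order[OF \<phi> fin])

lemmas pw_closed = auto_F_closed[OF pw_auto]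
lemmas pw_mult = auto_F_mult[OF pw_auto]
lemmas pw_inv = auto_F_inv[OF pw_auto]
lemmas pw_one = auto_F_one[OF pw_auto]

lemma pw_funpow: "x \<in> carrier FF \<Longrightarrow> (pw r ^^ k) x = pw (int k * r) x"
  by (induction k) (simp_all add: one_apply pw_add algebra_simps)

lemma mult_GG: "(h, x) \<otimes>\<^bsub>GG\<^esub> (k, y) = ((h + k) mod int N, pw k x \<otimes>\<^bsub>FF\<^esub> y)"
  by (simp add: free_by_cyclic_def semidirect_product_def)

text \<open>As \<open>l mod 0 = l\<close>, one condition describes the exponents both for finite and
  for infinite order of \<open>t\<close>.\<close>

lemma carrier_GG: "(l, U) \<in> carrier GG \<longleftrightarrow> l mod int N = l \<and> U \<in> carrier FF"
  by (auto simp: free_by_cyclic_def semidirect_product_def carrier_integer_mod_group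
      intro: mod_pos_pos_trivial) (metis pos_mod_bound pos_mod_sign of_nat_0_less_iff neq0_conv)+

lemma one_GG: "\<one>\<^bsub>GG\<^esub> = (0, [])"
  by (simp add: free_by_cyclic_def semidirect_product_def one_F)

lemma inv_letter_GG:
  assumes "i < n" shows "inv\<^bsub>GG\<^esub> (free_incl [(i, False)]) = free_incl [(i, True)]"
proof (rule G.inv_equality)
  have c: "[(i, b)] \<in> carrier FF" for b using assms by (simp add: carrier_F words_over_def reduced_def)
  show "free_incl [(i, True)] \<otimes>\<^bsub>GG\<^esub> free_incl [(i, False)] = \<one>\<^bsub>GG\<^esub>"
    using c by (simp add: free_incl_def mult_GG one_apply one_GG)
      (simp add: mult_F free_reduce_def inv_letter_def)
  show "free_incl [(i, False)] \<in> carrier GG" "free_incl [(i, True)] \<in> carrier GG"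
    using c by (simp_all add: free_incl_def carrier_GG)
qed

lemma Nil_FF: "[] \<in> carrier FF"
  using F.one_closed by (simp add: one_F)

lemma mult_Nil_FF: "x \<in> carrier FF \<Longrightarrow> x \<otimes>\<^bsub>FF\<^esub> [] = x" "x \<in> carrier FF \<Longrightarrow> [] \<otimes>\<^bsub>FF\<^esub> x = x"
  using F.r_one[of x] F.l_one[of x] by (simp_all add: one_F)

lemma inv_stable_GG: "inv\<^bsub>GG\<^esub> (stable_letter N) = ((- 1) mod int N, [])"
proof (rule G.inv_equality)
  show "((- 1) mod int N, []) \<otimes>\<^bsub>GG\<^esub> stable_letter N = \<one>\<^bsub>GG\<^esub>"
    by (simp add: stable_letter_def mult_GG one_GG pw_one mult_Nil_FF Nil_FF mod_add_eq)
  show "stable_letter N \<in> carrier GG" "((- 1) mod int N, []) \<in> carrier GG"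
    by (simp_all add: stable_letter_def carrier_GG Nil_FF)
qed

text \<open>The letters with index \<open>n\<close> stand for \<open>t\<close>, the last generator
  in the list, and its inverse.\<close>

definition letter_value :: "letter \<Rightarrow> int \<times> word" where
  "letter_value a = (if fst a = n then ((if snd a then - 1 else 1) mod int N, []) else (0, [a]))"

lemma letter_value_closed: "fst a \<le> n \<Longrightarrow> letter_value a \<in> carrier GG"
  by (cases a) (auto simp: letter_value_def carrier_GG Nil_FF carrier_F words_over_def reduced_def)

lemma gens_nth:
  "i < n \<Longrightarrow> free_by_cyclic_gens n N ! i = free_incl [(i, False)]"
  "free_by_cyclic_gens n N ! n = stable_letter N"
  by (simp_all add: free_by_cyclic_gens_def nth_append)

lemma val_Cons:
  assumes "fst a \<le> n" shows "val (a # w) = letter_value a \<otimes>\<^bsub>GG\<^esub> val w"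
proof -
  obtain i b where a: "a = (i, b)" by (cases a)
  show ?thesis
    using assms inv_letter_GG[of i]
    by (cases "i = n"; cases b)
      (auto simp: a word_value_def letter_value_def gens_nth inv_stable_GG stable_letter_def[symmetric] free_incl_def)
qed

lemma words_over_iff: "w \<in> words_over (Suc n) \<longleftrightarrow> (\<forall>a\<in>set w. fst a \<le> n)"
  by (auto simp: words_over_def less_Suc_eq_le)

lemma val_closed: "w \<in> words_over (Suc n) \<Longrightarrow> val w \<in> carrier GG"
proof (induction w)
  case Nil
  then show ?case by (simp add: word_value_def)
next
  case (Cons a w)
  then show ?case using letter_value_closed by (simp add: words_over_iff val_Cons)
qed

lemma val_append:
  "u \<in> words_over (Suc n) \<Longrightarrow> v \<in> words_over (Suc n) \<Longrightarrow> val (u @ v) = val u \<otimes>\<^bsub>GG\<^esub> val v"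
proof (induction u)
  case Nil
  then show ?case using val_closed[of v] by (simp add: word_value_def[of _ _ "[]"])
next
  case (Cons a u)
  then have "u \<in> words_over (Suc n)" "fst a \<le> n" by (auto simp: words_over_iff)
  then show ?case
    using Cons letter_value_closed[of a] val_closed[of u] val_closed[of v]
    by (simp add: val_Cons G.m_assoc)
qed

lemma val_single: "fst a \<le> n \<Longrightarrow> val [a] = letter_value a"
  using val_Cons[of a "[]"] letter_value_closed[of a] by (simp add: word_value_def[of _ _ "[]"])

text \<open>The exponent of \<open>t\<close> is kept as a pair \<open>(p, q)\<close> standing for \<open>p - q\<close>.\<close>

definition nf_step :: "(nat \<times> nat) \<times> word \<Rightarrow> letter \<Rightarrow> (nat \<times> nat) \<times> word" where
  "nf_step s a = (if fst a = n
     then if snd a then ((fst (fst s), Suc (snd (fst s))), pw (- 1) (snd s))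
          else ((Suc (fst (fst s)), snd (fst s)), \<phi> (snd s))
     else (fst s, free_reduce (snd s @ [a])))"

definition nf :: "word \<Rightarrow> (nat \<times> nat) \<times> word" where
  "nf w = foldl nf_step ((0, 0), []) w"

text \<open>Letters are appended on the right: by \<open>t^l U t = t^(l+1) \<phi>(U)\<close>, a
  stable letter acts on the free part collected so far. The last conjunct serves to bound the
  exponent of \<open>t\<close> in the search.\<close>

lemma val_nf:
  assumes "w \<in> words_over (Suc n)"
  shows "snd (nf w) \<in> carrier FF
    \<and> val w = ((int (fst (fst (nf w))) - int (snd (fst (nf w)))) mod int N, snd (nf w))
    \<and> fst (fst (nf w)) + snd (fst (nf w)) \<le> length w"
  using assms
proof (induction w rule: rev_induct)
  case Nil
  then show ?case by (simp add: nf_def word_value_def one_GG Nil_FF)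
next
  case (snoc a w)
  obtain p q U where w: "nf w = ((p, q), U)" by (metis surj_pair)
  have ww: "w \<in> words_over (Suc n)" and a: "fst a \<le> n" using snoc.prems by (auto simp: words_over_iff)
  have U: "U \<in> carrier FF" and v: "val w = ((int p - int q) mod int N, U)" and l: "p + q \<le> length w"
    using snoc.IH[OF ww] by (simp_all add: w)
  have val: "val (w @ [a]) = ((int p - int q) mod int N, U) \<otimes>\<^bsub>GG\<^esub> letter_value a"
    using a by (simp add: val_append[OF ww] words_over_iff val_single v)
  have nf: "nf (w @ [a]) = nf_step ((p, q), U) a" using w by (simp add: nf_def)
  have m1: "((int p - int q) mod int N + (- 1) mod int N) mod int N = (int p - int (Suc q)) mod int N"
    by (simp add: mod_add_eq algebra_simps)
  have m2: "((int p - int q) mod int N + 1 mod int N) mod int N = (int (Suc p) - int q) mod int N"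
    by (simp add: mod_add_eq algebra_simps)
  show ?case
  proof (cases "fst a = n")
    case True
    then show ?thesis
      using U l pw_closed[of U] auto_F_closed[OF \<phi> U]
      by (auto simp: nf nf_step_def val letter_value_def mult_GG pw_mod pw_1 mult_Nil_FF m1 m2)
  next
    case False
    then have "[a] \<in> carrier FF" using a by (auto simp: carrier_F words_over_def reduced_def mem_Times_iff)
    then show ?thesis
      using U l False F.m_closed[of U "[a]"]
      by (simp add: nf nf_step_def val letter_value_def mult_GG one_apply mult_F)
  qed
qed

text \<open>Solves the word problem. Comparing \<open>p + q'\<close> with \<open>p' + q\<close>
  stays within the natural numbers, and for \<open>N = 0\<close> the congruence is equality.\<close>

lemma val_eq_iff:
  assumes "u \<in> words_over (Suc n)" "v \<in> words_over (Suc n)"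
  shows "val u = val v \<longleftrightarrow>
    (fst (fst (nf u)) + snd (fst (nf v))) mod N = (fst (fst (nf v)) + snd (fst (nf u))) mod N
    \<and> snd (nf u) = snd (nf v)"
proof -
  have "(int p - int q) mod int N = (int p' - int q') mod int N \<longleftrightarrow> (p + q') mod N = (p' + q) mod N" for p q p' q'
  proof -
    have "(int p - int q) mod int N = (int p' - int q') mod int N
        \<longleftrightarrow> int N dvd (int p - int q) - (int p' - int q')" by (rule mod_eq_dvd_iff)
    also have "(int p - int q) - (int p' - int q') = int (p + q') - int (p' + q)" by simp
    also have "int N dvd int (p + q') - int (p' + q) \<longleftrightarrow> int (p + q') mod int N = int (p' + q) mod int N"
      by (rule mod_eq_dvd_iff[symmetric])
    also have "\<dots> \<longleftrightarrow> (p + q') mod N = (p' + q) mod N"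
      by (metis of_nat_mod of_nat_eq_iff)
    finally show ?thesis .
  qed
  then show ?thesis using val_nf[OF assms(1)] val_nf[OF assms(2)] by auto
qed

text \<open>Each stable letter may multiply the length of the free part by a Lipschitz constant, so
  growth is at most exponential. \<open>Suc\<close> absorbs the letters that are merely
  appended.\<close>

lemma nf_length:
  obtains c :: nat where "c \<ge> 2" "\<And>w. w \<in> words_over (Suc n) \<Longrightarrow> Suc (length (snd (nf w))) \<le> c ^ length w"
proof -
  obtain L1 where L1: "\<And>x. x \<in> carrier FF \<Longrightarrow> length (\<phi> x) \<le> L1 * length x"
    using auto_lipschitz[OF \<phi>] by blast
  obtain L2 where L2: "\<And>x. x \<in> carrier FF \<Longrightarrow> length (pw (- 1) x) \<le> L2 * length x"
    using auto_lipschitz[OF pw_auto] by blast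
  define c where "c = L1 + L2 + 2"
  have "Suc (length (snd (nf w))) \<le> c ^ length w" if "w \<in> words_over (Suc n)" for w
    using that
  proof (induction w rule: rev_induct)
    case Nil
    then show ?case by (simp add: nf_def)
  next
    case (snoc a w)
    have ww: "w \<in> words_over (Suc n)" using snoc.prems by (auto simp: words_over_iff)
    let ?U = "snd (nf w)"
    have U: "?U \<in> carrier FF" using val_nf[OF ww] by blast
    have nf: "nf (w @ [a]) = nf_step (nf w) a" by (simp add: nf_def)
    have 1: "length (\<phi> ?U) \<le> c * length ?U"
      using L1[OF U] by (rule le_trans) (intro mult_right_mono, simp_all add: c_def)
    have 2: "length (pw (- 1) ?U) \<le> c * length ?U"
      using L2[OF U] by (rule le_trans) (intro mult_right_mono, simp_all add: c_def)
    have 3: "length (free_reduce (?U @ [a])) \<le> Suc (length ?U)"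
      using length_free_reduce[of "?U @ [a]"] by simp
    have "Suc (length (snd (nf (w @ [a])))) \<le> c * Suc (length ?U)"
      using 1 2 3 by (auto simp: nf nf_step_def c_def)
    also have "\<dots> \<le> c * c ^ length w" using snoc.IH[OF ww] by (rule mult_left_mono) simp
    finally show ?case by simp
  qed
  then show thesis using that[of c] by (simp add: c_def)
qed

text \<open>Conjugacy is rewritten as \<open>a g = g b\<close> and read off componentwise.
  Conjugation preserves the exponent of \<open>t\<close>, and the other component is twisted
  conjugacy.\<close>

lemma conjugate_GG_iff:
  assumes "(l, U) \<in> carrier GG" "(k, V) \<in> carrier GG"
  shows "conjugate_in GG (l, U) (k, V) \<longleftrightarrow>
    l = k \<and> (\<exists>j f. (j, f) \<in> carrier GG \<and> pw j U \<otimes>\<^bsub>FF\<^esub> f = pw l f \<otimes>\<^bsub>FF\<^esub> V)"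
proof -
  have conj: "inv\<^bsub>GG\<^esub> g \<otimes>\<^bsub>GG\<^esub> (l, U) \<otimes>\<^bsub>GG\<^esub> g = (k, V) \<longleftrightarrow> (l, U) \<otimes>\<^bsub>GG\<^esub> g = g \<otimes>\<^bsub>GG\<^esub> (k, V)"
    if "g \<in> carrier GG" for g
    using that assms G.inv_solve_left[of "(k, V)" g "(l, U) \<otimes>\<^bsub>GG\<^esub> g"]
    by (simp add: G.m_assoc eq_commute[of _ "(k, V)"])
  have eq: "(l + j) mod int N = (j + k) mod int N \<longleftrightarrow> l = k" for j
  proof
    assume "(l + j) mod int N = (j + k) mod int N"
    then have "(l + j - j) mod int N = (j + k - j) mod int N" by (rule mod_diff_cong) simp
    then show "l = k" using assms by (simp add: carrier_GG)
  qed (simp add: add.commute)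
  have "conjugate_in GG (l, U) (k, V) \<longleftrightarrow>
    (\<exists>j f. (j, f) \<in> carrier GG \<and> (l, U) \<otimes>\<^bsub>GG\<^esub> (j, f) = (j, f) \<otimes>\<^bsub>GG\<^esub> (k, V))"
    unfolding conjugate_in_def using conj by (metis surj_pair)
  then show ?thesis by (auto simp: mult_GG eq)
qed

end

lemma abs_div_le_abs:
  fixes l k :: int
  assumes "0 < k" shows "\<bar>l div k\<bar> \<le> \<bar>l\<bar>"
proof -
  let ?q = "l div k"
  have l: "l = k * ?q + l mod k" and r: "0 \<le> l mod k" "l mod k < k" using assms by simp_all
  show ?thesis
  proof (cases "0 \<le> ?q")
    case True
    then have "1 * ?q \<le> k * ?q" using assms by (intro mult_right_mono) auto
    then show ?thesis using l r True by linarith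
  next
    case False
    then have "k * (?q + 1) \<le> 1 * (?q + 1)" using assms by (intro mult_right_mono_neg) auto
    then have "k * ?q + k \<le> ?q + 1" by (simp add: distrib_left)
    then have "l < ?q + 1" using l r by linarith
    then show ?thesis using False by linarith
  qed
qed

section \<open>Reduction of exponents modulo \<open>m\<close>\<close>

locale virtually_inner_extension = free_by_cyclic_extension n N \<phi>
  for n N :: nat and \<phi> :: "word \<Rightarrow> word" +
  fixes m :: nat and g :: word
  assumes n: "n \<ge> 2" and m: "m > 0" and g: "g \<in> carrier (free_group n)"
    and inner: "\<phi> [^]\<^bsub>AutoGroup (free_group n)\<^esub> m
      = (\<lambda>x\<in>carrier (free_group n). inv\<^bsub>free_group n\<^esub> g \<otimes>\<^bsub>free_group n\<^esub> x \<otimes>\<^bsub>free_group n\<^esub> g)"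
begin

interpretation F: group "free_group n" by (rule group_free_group)
interpretation A: group "AutoGroup (free_group n)" by (rule F.AutoGroup)
interpretation G: group "free_by_cyclic n \<phi> N" by (rule group_free_by_cyclic[OF \<phi> fin])

lemma pw_m: "x \<in> carrier FF \<Longrightarrow> pw (int m) x = inv\<^bsub>FF\<^esub> g \<otimes>\<^bsub>FF\<^esub> x \<otimes>\<^bsub>FF\<^esub> g"
  using inner by (simp add: int_pow_int)

text \<open>\<open>\<phi>^l\<close> commutes with \<open>\<phi>^m\<close>, so
  \<open>\<phi>^l(g)\<close> and \<open>g\<close> induce the same conjugation and differ by a
  central element, which is trivial.\<close>

lemma pw_fixes_g: "pw l g = g"
proof -
  let ?c = "pw l g \<otimes>\<^bsub>FF\<^esub> inv\<^bsub>FF\<^esub> g"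
  have c: "?c \<in> carrier FF" using pw_closed g by simp
  have "?c \<otimes>\<^bsub>FF\<^esub> y = y \<otimes>\<^bsub>FF\<^esub> ?c" if y: "y \<in> carrier FF" for y
  proof -
    define x where "x = pw (- l) y"
    have x: "x \<in> carrier FF" using y pw_closed by (simp add: x_def)
    have yx: "pw l x = y"
      using pw_add[OF y, of l "- l"] y by (simp add: x_def one_apply)
    have "pw l (pw (int m) x) = pw (int m) (pw l x)"
      using pw_add[OF x, of l "int m"] pw_add[OF x, of "int m" l] by (simp add: add.commute)
    then have eq: "inv\<^bsub>FF\<^esub> (pw l g) \<otimes>\<^bsub>FF\<^esub> y \<otimes>\<^bsub>FF\<^esub> pw l g = inv\<^bsub>FF\<^esub> g \<otimes>\<^bsub>FF\<^esub> y \<otimes>\<^bsub>FF\<^esub> g"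
      using x y g pw_closed by (simp add: pw_m pw_mult pw_inv yx)
    have "y \<otimes>\<^bsub>FF\<^esub> pw l g = pw l g \<otimes>\<^bsub>FF\<^esub> (inv\<^bsub>FF\<^esub> (pw l g) \<otimes>\<^bsub>FF\<^esub> y \<otimes>\<^bsub>FF\<^esub> pw l g)"
      using y g pw_closed[of g l] by (simp add: F.m_assoc F.inv_solve_left F.inv_solve_left')
        (simp add: F.m_assoc[symmetric])
    also have "\<dots> = ?c \<otimes>\<^bsub>FF\<^esub> y \<otimes>\<^bsub>FF\<^esub> g"
      unfolding eq using y g pw_closed[of g l] by (simp add: F.m_assoc)
    finally have "y \<otimes>\<^bsub>FF\<^esub> pw l g \<otimes>\<^bsub>FF\<^esub> inv\<^bsub>FF\<^esub> g = ?c \<otimes>\<^bsub>FF\<^esub> y \<otimes>\<^bsub>FF\<^esub> g \<otimes>\<^bsub>FF\<^esub> inv\<^bsub>FF\<^esub> g" by simp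
    then show ?thesis using y g c pw_closed[of g l] by (simp add: F.m_assoc)
  qed
  with n c have "?c = []" by (rule free_group_centre_trivial)
  then have "inv\<^bsub>FF\<^esub> g = inv\<^bsub>FF\<^esub> (pw l g)"
    using F.inv_equality[of "pw l g" "inv\<^bsub>FF\<^esub> g"] g pw_closed[of g l]
    by (metis F.inv_closed F.inv_equality F.inv_inv one_F)
  then show ?thesis using g pw_closed[of g l] by (metis F.inv_inv)
qed

lemma pw_fixes_g_pow: "pw l (g [^]\<^bsub>FF\<^esub> (q::int)) = g [^]\<^bsub>FF\<^esub> q"
proof -
  interpret group_hom FF FF "pw l"
    using pw_auto[of l] by (simp add: group_hom_def group_hom_axioms_def auto_def F.is_group)
  show ?thesis using hom_int_pow[OF g, of q] by (simp add: pw_fixes_g)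
qed

lemma pw_mult_m:
  assumes x: "x \<in> carrier FF"
  shows "pw (q * int m) x = inv\<^bsub>FF\<^esub> (g [^]\<^bsub>FF\<^esub> q) \<otimes>\<^bsub>FF\<^esub> x \<otimes>\<^bsub>FF\<^esub> g [^]\<^bsub>FF\<^esub> q"
proof (induction q rule: int_induct[where k = 0])
  case base
  then show ?case using x by (simp add: one_apply)
next
  case (step1 q)
  have gq: "g [^]\<^bsub>FF\<^esub> q \<in> carrier FF" using g by simp
  have "pw ((q + 1) * int m) x = pw (int m) (pw (q * int m) x)"
    using pw_add[OF x, of "int m" "q * int m"] by (simp add: algebra_simps)
  then show ?case
    using step1 x g gq by (simp add: pw_m F.int_pow_mult F.inv_mult_group F.m_assoc)
next
  case (step2 q)
  have gq: "g [^]\<^bsub>FF\<^esub> q \<in> carrier FF" using g by simp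
  let ?y = "pw ((q - 1) * int m) x"
  have y: "?y \<in> carrier FF" using x pw_closed by blast
  have "pw (q * int m) x = pw (int m) ?y"
    using pw_add[OF x, of "int m" "(q - 1) * int m"] by (simp add: algebra_simps)
  then have "inv\<^bsub>FF\<^esub> g \<otimes>\<^bsub>FF\<^esub> ?y \<otimes>\<^bsub>FF\<^esub> g = inv\<^bsub>FF\<^esub> (g [^]\<^bsub>FF\<^esub> q) \<otimes>\<^bsub>FF\<^esub> x \<otimes>\<^bsub>FF\<^esub> g [^]\<^bsub>FF\<^esub> q"
    using step2 y by (simp add: pw_m)
  then have "g \<otimes>\<^bsub>FF\<^esub> (inv\<^bsub>FF\<^esub> g \<otimes>\<^bsub>FF\<^esub> ?y \<otimes>\<^bsub>FF\<^esub> g) \<otimes>\<^bsub>FF\<^esub> inv\<^bsub>FF\<^esub> g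
      = g \<otimes>\<^bsub>FF\<^esub> (inv\<^bsub>FF\<^esub> (g [^]\<^bsub>FF\<^esub> q) \<otimes>\<^bsub>FF\<^esub> x \<otimes>\<^bsub>FF\<^esub> g [^]\<^bsub>FF\<^esub> q) \<otimes>\<^bsub>FF\<^esub> inv\<^bsub>FF\<^esub> g" by simp
  moreover have "g \<otimes>\<^bsub>FF\<^esub> (inv\<^bsub>FF\<^esub> g \<otimes>\<^bsub>FF\<^esub> ?y \<otimes>\<^bsub>FF\<^esub> g) \<otimes>\<^bsub>FF\<^esub> inv\<^bsub>FF\<^esub> g = ?y"
    using g y by (simp add: F.m_assoc) (simp add: F.m_assoc[symmetric])
  moreover have "g \<otimes>\<^bsub>FF\<^esub> (inv\<^bsub>FF\<^esub> (g [^]\<^bsub>FF\<^esub> q) \<otimes>\<^bsub>FF\<^esub> x \<otimes>\<^bsub>FF\<^esub> g [^]\<^bsub>FF\<^esub> q) \<otimes>\<^bsub>FF\<^esub> inv\<^bsub>FF\<^esub> g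
      = inv\<^bsub>FF\<^esub> (g [^]\<^bsub>FF\<^esub> (q - 1)) \<otimes>\<^bsub>FF\<^esub> x \<otimes>\<^bsub>FF\<^esub> g [^]\<^bsub>FF\<^esub> (q - 1)"
    using g x gq by (simp add: F.int_pow_diff F.inv_mult_group F.m_assoc)
  ultimately show ?case by simp
qed

text \<open>Replacing \<open>f\<close> by \<open>g\<^sup>p f\<close> reduces the exponent of \<open>t\<close> in the conjugator modulo \<open>m\<close>, and
  multiplying both sides by \<open>g\<^sup>q\<close> reduces the exponent of the automorphism modulo \<open>m\<close>.\<close>

lemma twisted_reduce_exponents:
  fixes l j :: int
  assumes U: "U \<in> carrier FF" and V: "V \<in> carrier FF" and f: "f \<in> carrier FF"
  defines "q \<equiv> l div int m" and "p \<equiv> j div int m"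
  shows "pw j U \<otimes>\<^bsub>FF\<^esub> f = pw l f \<otimes>\<^bsub>FF\<^esub> V \<longleftrightarrow>
    (g [^]\<^bsub>FF\<^esub> q \<otimes>\<^bsub>FF\<^esub> pw (j mod int m) U) \<otimes>\<^bsub>FF\<^esub> (g [^]\<^bsub>FF\<^esub> p \<otimes>\<^bsub>FF\<^esub> f)
      = pw (l mod int m) (g [^]\<^bsub>FF\<^esub> p \<otimes>\<^bsub>FF\<^esub> f) \<otimes>\<^bsub>FF\<^esub> (g [^]\<^bsub>FF\<^esub> q \<otimes>\<^bsub>FF\<^esub> V)"
proof -
  let ?gp = "g [^]\<^bsub>FF\<^esub> p" and ?gq = "g [^]\<^bsub>FF\<^esub> q"
  let ?U = "pw (j mod int m) U" and ?f = "pw (l mod int m) f"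
  have c: "?gp \<in> carrier FF" "?gq \<in> carrier FF" "?U \<in> carrier FF" "?f \<in> carrier FF"
    using g U f pw_closed by auto
  have j: "pw j U = inv\<^bsub>FF\<^esub> ?gp \<otimes>\<^bsub>FF\<^esub> ?U \<otimes>\<^bsub>FF\<^esub> ?gp"
    using pw_add[OF U, of "p * int m" "j mod int m"] pw_mult_m[OF c(3), of p] by (simp add: p_def)
  have l: "pw l f = inv\<^bsub>FF\<^esub> ?gq \<otimes>\<^bsub>FF\<^esub> ?f \<otimes>\<^bsub>FF\<^esub> ?gq"
    using pw_add[OF f, of "q * int m" "l mod int m"] pw_mult_m[OF c(4), of q] by (simp add: q_def)
  have comm: "?gp \<otimes>\<^bsub>FF\<^esub> ?gq = ?gq \<otimes>\<^bsub>FF\<^esub> ?gp"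
    using g by (simp add: add.commute flip: F.int_pow_mult)
  have comm': "?gp \<otimes>\<^bsub>FF\<^esub> (inv\<^bsub>FF\<^esub> ?gq \<otimes>\<^bsub>FF\<^esub> x) = inv\<^bsub>FF\<^esub> ?gq \<otimes>\<^bsub>FF\<^esub> (?gp \<otimes>\<^bsub>FF\<^esub> x)" if "x \<in> carrier FF" for x
  proof -
    have "?gp \<otimes>\<^bsub>FF\<^esub> inv\<^bsub>FF\<^esub> ?gq = inv\<^bsub>FF\<^esub> ?gq \<otimes>\<^bsub>FF\<^esub> ?gp"
      using g by (simp add: F.int_pow_neg[symmetric] add.commute flip: F.int_pow_mult)
    then show ?thesis using that c by (simp add: F.m_assoc[symmetric])
  qed
  let ?A = "pw j U \<otimes>\<^bsub>FF\<^esub> f" and ?B = "pw l f \<otimes>\<^bsub>FF\<^esub> V"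
  have AB: "?A \<in> carrier FF" "?B \<in> carrier FF" using U V f pw_closed by auto
  \<comment> \<open>Both sides are multiplied from the left by \<open>?gq \<otimes> ?gp\<close>,
    which can be cancelled again. On the side of \<open>?B\<close>, \<open>?gp\<close> passes
    through the automorphism, which fixes powers of \<open>g\<close>.\<close>
  have "?gq \<otimes>\<^bsub>FF\<^esub> (?gp \<otimes>\<^bsub>FF\<^esub> ?A) = (?gq \<otimes>\<^bsub>FF\<^esub> ?U) \<otimes>\<^bsub>FF\<^esub> (?gp \<otimes>\<^bsub>FF\<^esub> f)"
    unfolding j using c f by (simp add: F.m_assoc) (simp add: F.m_assoc[symmetric])
  moreover have "?gq \<otimes>\<^bsub>FF\<^esub> (?gp \<otimes>\<^bsub>FF\<^esub> ?B) = pw (l mod int m) (?gp \<otimes>\<^bsub>FF\<^esub> f) \<otimes>\<^bsub>FF\<^esub> (?gq \<otimes>\<^bsub>FF\<^esub> V)"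
    unfolding l pw_mult[OF c(1) f] pw_fixes_g_pow using c V
    by (simp add: F.m_assoc comm') (simp add: F.m_assoc[symmetric])
  ultimately show ?thesis using AB c by (metis F.l_cancel F.m_closed)
qed

text \<open>Reducing \<open>l\<close> and \<open>j\<close> modulo \<open>m\<close> leaves finitely
  many automorphisms, so the constants can be chosen uniformly. The exponent \<open>l\<close> stays
  in the bound through the length of \<open>g^q\<close>, where \<open>q = l div m\<close>.\<close>

lemma short_conjugator:
  "\<exists>A::nat. \<forall>l::int. \<forall>U\<in>carrier FF. \<forall>V\<in>carrier FF.
    (\<exists>j::int. \<exists>f\<in>carrier FF. pw j U \<otimes>\<^bsub>FF\<^esub> f = pw l f \<otimes>\<^bsub>FF\<^esub> V) \<longrightarrow>
    (\<exists>j<m. \<exists>f\<in>carrier FF. pw (int j) U \<otimes>\<^bsub>FF\<^esub> f = pw l f \<otimes>\<^bsub>FF\<^esub> V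
      \<and> length f \<le> Suc (2 * n) ^ (A * Suc (nat \<bar>l\<bar> + length U + length V)))"
proof -
  let ?bound = "\<lambda>r A. \<forall>U\<in>carrier FF. \<forall>V\<in>carrier FF.
     (\<exists>f\<in>carrier FF. U \<otimes>\<^bsub>FF\<^esub> f = pw (int r) f \<otimes>\<^bsub>FF\<^esub> V) \<longrightarrow>
     (\<exists>f\<in>carrier FF. U \<otimes>\<^bsub>FF\<^esub> f = pw (int r) f \<otimes>\<^bsub>FF\<^esub> V
        \<and> length f \<le> Suc (2 * n) ^ (A * Suc (length U + length V)))"
  have "\<exists>A. ?bound r A" for r
  proof (rule short_twisted_conjugator[OF pw_auto m])
    show "g [^]\<^bsub>FF\<^esub> int r \<in> carrier FF" using g by simp
    show "(pw (int r) ^^ m) x = inv\<^bsub>FF\<^esub> (g [^]\<^bsub>FF\<^esub> int r) \<otimes>\<^bsub>FF\<^esub> x \<otimes>\<^bsub>FF\<^esub> g [^]\<^bsub>FF\<^esub> int r"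
      if "x \<in> carrier FF" for x
      using pw_funpow[OF that, where r = "int r" and k = m] pw_mult_m[OF that, of "int r"] by (simp add: mult.commute)
  qed
  then obtain A where A: "\<And>r. ?bound r (A r)" by metis
  have "\<exists>L::nat. \<forall>w\<in>carrier FF. length (pw (int j) w) \<le> L * length w" for j
    by (rule auto_lipschitz[OF pw_auto])
  then obtain L :: "nat \<Rightarrow> nat" where L: "\<And>j w. w \<in> carrier FF \<Longrightarrow> length (pw (int j) w) \<le> L j * length w"
    by metis
  \<comment> \<open>Sums over the residues dominate each of the finitely many constants.\<close>
  define A' where "A' = (\<Sum>r<m. A r)"
  define L' where "L' = (\<Sum>j<m. L j)"
  define C where "C = 2 * length g + L' + 1"
  show ?thesis
  proof (rule exI[of _ "A' * C"], intro allI ballI impI)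
    fix l :: int and U V assume U: "U \<in> carrier FF" and V: "V \<in> carrier FF"
      and ex: "\<exists>j::int. \<exists>f\<in>carrier FF. pw j U \<otimes>\<^bsub>FF\<^esub> f = pw l f \<otimes>\<^bsub>FF\<^esub> V"
    then obtain j0 :: int and f0 where f0: "f0 \<in> carrier FF" "pw j0 U \<otimes>\<^bsub>FF\<^esub> f0 = pw l f0 \<otimes>\<^bsub>FF\<^esub> V" by blast
    define j r where "j = nat (j0 mod int m)" and "r = nat (l mod int m)"
    have jr: "int j = j0 mod int m" "int r = l mod int m" "j < m" "r < m"
      using m by (simp_all add: j_def r_def nat_less_iff)
    define q where "q = l div int m"
    let ?gq = "g [^]\<^bsub>FF\<^esub> q"
    let ?X = "?gq \<otimes>\<^bsub>FF\<^esub> pw (int j) U" and ?Y = "?gq \<otimes>\<^bsub>FF\<^esub> V"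
    have gq: "?gq \<in> carrier FF" using g by simp
    have XY: "?X \<in> carrier FF" "?Y \<in> carrier FF" using gq U V pw_closed by auto
    have "?X \<otimes>\<^bsub>FF\<^esub> (g [^]\<^bsub>FF\<^esub> (j0 div int m) \<otimes>\<^bsub>FF\<^esub> f0)
        = pw (int r) (g [^]\<^bsub>FF\<^esub> (j0 div int m) \<otimes>\<^bsub>FF\<^esub> f0) \<otimes>\<^bsub>FF\<^esub> ?Y"
      using f0 twisted_reduce_exponents[OF U V f0(1), of j0 l] by (simp add: jr q_def)
    then have "\<exists>f\<in>carrier FF. ?X \<otimes>\<^bsub>FF\<^esub> f = pw (int r) f \<otimes>\<^bsub>FF\<^esub> ?Y"
      by (rule bexI) (use g f0 in simp)
    then obtain f where f: "f \<in> carrier FF" "?X \<otimes>\<^bsub>FF\<^esub> f = pw (int r) f \<otimes>\<^bsub>FF\<^esub> ?Y"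
      and len: "length f \<le> Suc (2 * n) ^ (A r * Suc (length ?X + length ?Y))"
      using A XY by meson
    \<comment> \<open>The reduction is now read backwards with exponent \<open>int j\<close>: as
      \<open>j < m\<close>, its quotient by \<open>m\<close> is 0, and no power of \<open>g\<close>
      is put before \<open>f\<close>.\<close>
    have "pw (int j) U \<otimes>\<^bsub>FF\<^esub> f = pw l f \<otimes>\<^bsub>FF\<^esub> V"
      using f jr(3) twisted_reduce_exponents[OF U V f(1), of "int j" l] by (simp add: jr(2) q_def)
    moreover have "length f \<le> Suc (2 * n) ^ ((A' * C) * Suc (nat \<bar>l\<bar> + length U + length V))"
    proof -
      have "\<bar>q\<bar> \<le> \<bar>l\<bar>" unfolding q_def by (rule abs_div_le_abs) (use m in simp)
      then have q: "nat \<bar>q\<bar> \<le> nat \<bar>l\<bar>" by simp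
      have "length ?gq \<le> nat \<bar>q\<bar> * length g"
        using g length_mult_F by (intro F.length_like_int_pow) (auto simp: one_F)
      also have "\<dots> \<le> nat \<bar>l\<bar> * length g" using q by (rule mult_right_mono) simp
      finally have gql: "length ?gq \<le> nat \<bar>l\<bar> * length g" .
      have "L j \<le> L'" unfolding L'_def using jr(3) by (intro member_le_sum) auto
      then have "length (pw (int j) U) \<le> L' * length U"
        using L[OF U, of j] by (meson le_trans mult_right_mono zero_le)
      then have "length ?X + length ?Y \<le> 2 * (nat \<bar>l\<bar> * length g) + L' * length U + length V"
        using length_mult_F[of n ?gq "pw (int j) U"] length_mult_F[of n ?gq V] gql by linarith
      also have "Suc \<dots> \<le> C * Suc (nat \<bar>l\<bar> + length U + length V)"
        by (simp add: C_def algebra_simps)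
      finally have "Suc (length ?X + length ?Y) \<le> C * Suc (nat \<bar>l\<bar> + length U + length V)" by simp
      moreover have "A r \<le> A'" unfolding A'_def using jr(4) by (intro member_le_sum) auto
      ultimately have "A r * Suc (length ?X + length ?Y) \<le> A' * (C * Suc (nat \<bar>l\<bar> + length U + length V))"
        by (intro mult_mono) auto
      then have "Suc (2 * n) ^ (A r * Suc (length ?X + length ?Y))
          \<le> Suc (2 * n) ^ ((A' * C) * Suc (nat \<bar>l\<bar> + length U + length V))"
        unfolding mult.assoc by (rule power_increasing) simp
      with len show ?thesis by (rule le_trans)
    qed
    ultimately show "\<exists>j<m. \<exists>f\<in>carrier FF. pw (int j) U \<otimes>\<^bsub>FF\<^esub> f = pw l f \<otimes>\<^bsub>FF\<^esub> V
      \<and> length f \<le> Suc (2 * n) ^ ((A' * C) * Suc (nat \<bar>l\<bar> + length U + length V))"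
      using f(1) jr(3) by blast
  qed
qed

end

section \<open>Conjugators written as words\<close>

context free_by_cyclic_extension
begin

interpretation F: group "free_group n" by (rule group_free_group)
interpretation A: group "AutoGroup (free_group n)" by (rule F.AutoGroup)
interpretation G: group "free_by_cyclic n \<phi> N" by (rule group_free_by_cyclic[OF \<phi> fin])

lemma val_Nil: "val [] = (0, [])"
  by (simp add: word_value_def one_GG)

lemma val_replicate: "val (replicate j (n, False)) = (int j mod int N, [])"
proof (induction j)
  case (Suc j)
  then show ?case
    by (simp add: val_Cons letter_value_def mult_GG pw_one mult_Nil_FF Nil_FF mod_add_eq)
qed (simp add: val_Nil)

lemma val_free: "f \<in> carrier FF \<Longrightarrow> val f = (0, f)"
proof (induction f)
  case (Cons a f)
  then have "f \<in> carrier FF" "fst a < n" by (auto simp: carrier_F words_over_def reduced_Cons)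
  moreover have "[a] \<in> carrier FF" using Cons.prems by (auto simp: carrier_F words_over_def reduced_Cons)
  moreover have "free_reduce (a # f) = a # f" using Cons.prems by (simp add: carrier_F)
  ultimately show ?case
    using Cons.IH by (simp add: val_Cons letter_value_def mult_GG one_apply) (simp add: mult_F)
qed (simp add: val_Nil)

lemma words_over_Suc: "w \<in> words_over n \<Longrightarrow> w \<in> words_over (Suc n)"
  by (auto simp: words_over_def)

end

context virtually_inner_extension
begin

interpretation F: group "free_group n" by (rule group_free_group)
interpretation A: group "AutoGroup (free_group n)" by (rule F.AutoGroup)
interpretation G: group "free_by_cyclic n \<phi> N" by (rule group_free_by_cyclic[OF \<phi> fin])

text \<open>The conjugator \<open>t^j f\<close> is itself a word \<open>w\<close>, and comparing
  \<open>u @ w\<close> with \<open>w @ v\<close> makes the test an instance of the word problem. The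
  bound is doubly exponential since normal forms grow exponentially and \<open>f\<close> is
  exponential in them.\<close>

lemma conjugate_iff_bounded:
  "\<exists>M c. \<forall>u\<in>words_over (Suc n). \<forall>v\<in>words_over (Suc n).
     conjugate_in GG (val u) (val v) \<longleftrightarrow>
     (\<exists>w\<in>words_over (Suc n). length w \<le> m + Suc (2 * n) ^ (M * c ^ (length u + length v))
        \<and> val (u @ w) = val (w @ v))"
proof -
  obtain A :: nat where A: "\<And>l U V j f. U \<in> carrier FF \<Longrightarrow> V \<in> carrier FF \<Longrightarrow> f \<in> carrier FF \<Longrightarrow>
      pw j U \<otimes>\<^bsub>FF\<^esub> f = pw l f \<otimes>\<^bsub>FF\<^esub> V \<Longrightarrow>
      \<exists>j<m. \<exists>f\<in>carrier FF. pw (int j) U \<otimes>\<^bsub>FF\<^esub> f = pw l f \<otimes>\<^bsub>FF\<^esub> V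
      \<and> length f \<le> Suc (2 * n) ^ (A * Suc (nat \<bar>l\<bar> + length U + length V))"
    using short_conjugator by blast
  obtain c :: nat where c: "c \<ge> 2"
    "\<And>w. w \<in> words_over (Suc n) \<Longrightarrow> Suc (length (snd (nf w))) \<le> c ^ length w"
    using nf_length by blast
  show ?thesis
  proof (intro exI ballI iffI)
    fix u v assume u: "u \<in> words_over (Suc n)" and v: "v \<in> words_over (Suc n)"
      and conj: "conjugate_in GG (val u) (val v)"
    define l where "l = int (fst (fst (nf u))) - int (snd (fst (nf u)))"
    let ?U = "snd (nf u)" and ?V = "snd (nf v)"
    have U: "?U \<in> carrier FF" and V: "?V \<in> carrier FF" and valu: "val u = (l mod int N, ?U)"
      and l: "nat \<bar>l\<bar> \<le> length u"
      using val_nf[OF u] val_nf[OF v] by (auto simp: l_def)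
    obtain k where valv: "val v = (k, ?V)" using val_nf[OF v] by auto
    have c': "(l mod int N, ?U) \<in> carrier GG" "(k, ?V) \<in> carrier GG"
      using val_closed[OF u] val_closed[OF v] valu valv by auto
    obtain j0 f0 where k: "k = l mod int N" and "(j0, f0) \<in> carrier GG"
      and "pw j0 ?U \<otimes>\<^bsub>FF\<^esub> f0 = pw l f0 \<otimes>\<^bsub>FF\<^esub> ?V"
      using conj conjugate_GG_iff[OF c'] unfolding valu valv pw_mod by auto
    then obtain j f where j: "j < m" and f: "f \<in> carrier FF"
      and eq: "pw (int j) ?U \<otimes>\<^bsub>FF\<^esub> f = pw l f \<otimes>\<^bsub>FF\<^esub> ?V"
      and len: "length f \<le> Suc (2 * n) ^ (A * Suc (nat \<bar>l\<bar> + length ?U + length ?V))"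
      using A[OF U V, of f0 j0 l] by (auto simp: carrier_GG)
    let ?w = "replicate j (n, False) @ f"
    have rw: "replicate j (n, False) \<in> words_over (Suc n)" by (auto simp: words_over_def)
    have fw: "f \<in> words_over (Suc n)" using f words_over_Suc by (simp add: carrier_F)
    have w: "?w \<in> words_over (Suc n)" using rw fw by (auto simp: words_over_def)
    have valw: "val ?w = (int j mod int N, f)"
      unfolding val_append[OF rw fw] val_replicate val_free[OF f]
      using f by (simp add: mult_GG one_apply Nil_FF mult_Nil_FF)
    have "val (u @ ?w) = val (?w @ v)"
      unfolding val_append[OF u w] val_append[OF w v] valw valu valv mult_GG k pw_mod eq
      by (simp add: add.commute)
    moreover have "length ?w \<le> m + Suc (2 * n) ^ (3 * A * c ^ (length u + length v))"
    proof -
      let ?s = "length u + length v"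
      have "c ^ length u \<le> c ^ ?s" "c ^ length v \<le> c ^ ?s"
        using c(1) by (auto intro: power_increasing)
      moreover have "?s < c ^ ?s"
        using c(1) less_exp[of ?s] power_mono[of 2 c ?s] by linarith
      \<comment> \<open>Each of the three summands is strictly below \<open>c ^ ?s\<close>.\<close>
      ultimately have "Suc (nat \<bar>l\<bar> + length ?U + length ?V) \<le> 3 * c ^ ?s"
        using c(2)[OF u] c(2)[OF v] l by linarith
      then have "A * Suc (nat \<bar>l\<bar> + length ?U + length ?V) \<le> A * (3 * c ^ ?s)"
        by (rule mult_left_mono) simp
      then have "Suc (2 * n) ^ (A * Suc (nat \<bar>l\<bar> + length ?U + length ?V)) \<le> Suc (2 * n) ^ (3 * A * c ^ ?s)"
        by (intro power_increasing) auto
      then show ?thesis using j len by simp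
    qed
    ultimately show "\<exists>w\<in>words_over (Suc n). length w \<le> m + Suc (2 * n) ^ (3 * A * c ^ (length u + length v))
        \<and> val (u @ w) = val (w @ v)"
      using w by blast
  next
    fix u v assume u: "u \<in> words_over (Suc n)" and v: "v \<in> words_over (Suc n)"
      and "\<exists>w\<in>words_over (Suc n). length w \<le> m + Suc (2 * n) ^ (3 * A * c ^ (length u + length v))
        \<and> val (u @ w) = val (w @ v)"
    then obtain w where w: "w \<in> words_over (Suc n)" and eq: "val (u @ w) = val (w @ v)" by blast
    note cl = val_closed[OF u] val_closed[OF v] val_closed[OF w]
    have "inv\<^bsub>GG\<^esub> val w \<otimes>\<^bsub>GG\<^esub> val u \<otimes>\<^bsub>GG\<^esub> val w = inv\<^bsub>GG\<^esub> val w \<otimes>\<^bsub>GG\<^esub> (val w \<otimes>\<^bsub>GG\<^esub> val v)"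
      using cl eq by (simp add: val_append u v w G.m_assoc)
    also have "\<dots> = val v" using cl by (simp add: G.m_assoc[symmetric])
    finally show "conjugate_in GG (val u) (val v)"
      unfolding conjugate_in_def using cl by blast
  qed
qed

end

section \<open>The decision procedure\<close>

definition letter_code :: "letter \<Rightarrow> nat" where
  "letter_code = (\<lambda>(i, b). 2 * i + of_bool b)"

lemma word_code_eq: "word_code = enc_list letter_code"
  by (simp add: fun_eq_iff word_code_def enc_list_def letter_code_def)

lemma letter_code_div: "letter_code a div 2 = fst a" and letter_code_odd: "odd (letter_code a) = snd a"
  by (cases a; simp add: letter_code_def)+

lemma inj_letter_code: "inj letter_code"
proof (rule injI)
  fix a b assume "letter_code a = letter_code b"
  then show "a = b"
    using letter_code_div[of a] letter_code_div[of b] letter_code_odd[of a] letter_code_odd[of b]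
    by (simp add: prod_eq_iff)
qed

lemma inj_word_code: "inj word_code"
  unfolding word_code_eq by (intro inj_enc_list inj_letter_code)

text \<open>Inversion flips the lowest bit of the code.\<close>

lemma computes_inv_letter: "computes letter_code letter_code inv_letter"
proof -
  have "computes letter_code id (\<lambda>a. if letter_code a mod 2 = 0 then Suc (letter_code a) else letter_code a - 1)"
    by (rule computes_If computes_eq_0 computes_mod computes_Suc computes_diff computes_code computes_const)+
  moreover have "(if letter_code a mod 2 = 0 then Suc (letter_code a) else letter_code a - 1)
      = letter_code (inv_letter a)" for a
    by (cases a) (simp add: letter_code_def inv_letter_def)
  ultimately show ?thesis by (simp add: computes_def)
qed

lemma computes_letter_table:
  "computes letter_code e (\<lambda>a. if fst a < k then f a else d)"
proof -
  have "computes letter_code e (\<lambda>a. if letter_code a < 2 * k then f (letter_code a div 2, odd (letter_code a)) else d)"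
    using computes_comp[OF computes_table[of e "2 * k" "\<lambda>c. f (c div 2, odd c)" d] computes_code] .
  moreover have "letter_code a < 2 * k \<longleftrightarrow> fst a < k" for a
    by (cases a) (auto simp: letter_code_def)
  ultimately show ?thesis by (simp only: letter_code_div letter_code_odd prod.collapse)
qed

lemma computes_cons_reduce:
  assumes "computes e letter_code f" "computes e word_code g"
  shows "computes e word_code (\<lambda>x. cons_reduce (f x) (g x))"
proof -
  have "computes (enc_prod letter_code word_code) word_code
     (\<lambda>p. case snd p of [] \<Rightarrow> [fst p] | b # w \<Rightarrow> if b = inv_letter (fst p) then w else fst p # b # w)"
    unfolding word_code_eq
    by (rule computes_case_list computes_If computes_eq[OF _ _ inj_letter_code]
        computes_comp[OF computes_inv_letter] computes_intros computes_const)+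
  moreover have "cons_reduce a w = (case w of [] \<Rightarrow> [a] | b # w \<Rightarrow> if b = inv_letter a then w else a # b # w)" for a w
    by (cases w) auto
  ultimately have "computes (enc_prod letter_code word_code) word_code (\<lambda>p. cons_reduce (fst p) (snd p))"
    by simp
  from computes_comp2[OF this assms] show ?thesis .
qed

lemma computes_free_reduce:
  assumes "computes e word_code f" shows "computes e word_code (\<lambda>x. free_reduce (f x))"
proof -
  have "computes e word_code (\<lambda>x. foldr (\<lambda>a w. cons_reduce a w) (f x) [])"
    by (rule computes_foldr[OF computes_const _ assms[unfolded word_code_eq]]
        computes_cons_reduce computes_intros)+
  then show ?thesis by (simp add: free_reduce_def)
qed

text \<open>The homomorphism given by the finite table of images of letters. The default
  \<open>[]\<close> makes it computable on all words.\<close>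

definition table_apply :: "nat \<Rightarrow> (word \<Rightarrow> word) \<Rightarrow> word \<Rightarrow> word" where
  "table_apply k \<psi> w = free_reduce (concat (map (\<lambda>a. if fst a < k then \<psi> [a] else []) w))"

lemma table_apply_auto:
  assumes "\<psi> \<in> auto (free_group n)" "w \<in> carrier (free_group n)"
  shows "table_apply n \<psi> w = \<psi> w"
proof -
  have map: "map (\<lambda>a. if fst a < n then \<psi> [a] else []) w = map (\<lambda>a. \<psi> [a]) w"
    using assms(2) by (auto simp: carrier_F words_over_def)
  show ?thesis unfolding table_apply_def map by (rule auto_free_reduce[OF assms, symmetric])
qed

lemma computes_table_apply:
  assumes "computes e word_code f" shows "computes e word_code (\<lambda>x. table_apply k \<psi> (f x))"
proof -
  have "computes e word_code (\<lambda>x. concat (map (\<lambda>a. if fst a < k then \<psi> [a] else []) (f x)))"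
    unfolding word_code_eq
    by (rule computes_bind[OF _ assms[unfolded word_code_eq]] computes_comp[OF computes_letter_table] computes_intros)+
  then show ?thesis unfolding table_apply_def by (rule computes_free_reduce)
qed

text \<open>Written with \<open>rec_nat\<close> so that \<open>computes_rec_nat\<close> applies.
  Adding \<open>[]\<close> in each round keeps the shorter words.\<close>

definition words_upto :: "'a list \<Rightarrow> nat \<Rightarrow> 'a list list" where
  "words_upto as L = rec_nat [[]] (\<lambda>_ ws. [] # concat (map (\<lambda>w. map (\<lambda>a. a # w) as) ws)) L"

lemma set_words_upto: "set (words_upto as L) = {w. set w \<subseteq> set as \<and> length w \<le> L}"
proof (induction L)
  case 0
  then show ?case by (auto simp: words_upto_def)
next
  case (Suc L)
  have "set (words_upto as (Suc L)) = insert [] (\<Union>w\<in>set (words_upto as L). (\<lambda>a. a # w) ` set as)"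
    by (simp add: words_upto_def)
  also have "\<dots> = {w. set w \<subseteq> set as \<and> length w \<le> Suc L}" (is "?A = ?B")
  proof
    show "?A \<subseteq> ?B" using Suc by auto
    show "?B \<subseteq> ?A"
    proof
      fix w assume "w \<in> ?B"
      then show "w \<in> ?A" using Suc by (cases w) auto
    qed
  qed
  finally show ?case .
qed

lemma computes_words_upto:
  assumes "computes e id f" shows "computes e (enc_list (enc_list e1)) (\<lambda>x. words_upto as (f x))"
  unfolding words_upto_def
  by (rule computes_rec_nat[OF computes_const _ assms] computes_Cons computes_bind
      computes_map computes_intros computes_const)+

context free_by_cyclic_extension
begin

text \<open>\<open>\<phi>\<close> is arbitrary outside the free group, so the automorphisms have to be replaced by their
  finite tables of values at the letters.\<close>

definition nf_table_step :: "(nat \<times> nat) \<times> word \<Rightarrow> letter \<Rightarrow> (nat \<times> nat) \<times> word" where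
  "nf_table_step s a =
     (if a = (n, True) then ((fst (fst s), Suc (snd (fst s))), table_apply n (pw (- 1)) (snd s))
      else if a = (n, False) then ((Suc (fst (fst s)), snd (fst s)), table_apply n \<phi> (snd s))
      else (fst s, free_reduce (snd s @ [a])))"

lemma nf_table:
  assumes "w \<in> words_over (Suc n)" shows "foldl nf_table_step ((0, 0), []) w = nf w"
  using assms
proof (induction w rule: rev_induct)
  case Nil
  then show ?case by (simp add: nf_def)
next
  case (snoc a w)
  have w: "w \<in> words_over (Suc n)" using snoc.prems by (auto simp: words_over_iff)
  have "snd (nf w) \<in> carrier FF" using val_nf[OF w] by blast
  then have "nf_table_step (nf w) a = nf_step (nf w) a"
    by (cases a) (auto simp: nf_table_step_def nf_step_def table_apply_auto[OF pw_auto] table_apply_auto[OF \<phi>])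
  then show ?case using snoc.IH[OF w] by (simp add: nf_def)
qed

abbreviation enc_nf :: "(nat \<times> nat) \<times> word \<Rightarrow> nat" where
  "enc_nf \<equiv> enc_prod (enc_prod id id) word_code"

lemma computes_nf_table:
  assumes "computes e word_code f"
  shows "computes e enc_nf (\<lambda>x. foldl nf_table_step ((0, 0), []) (f x))"
proof -
  have snoc: "computes e word_code (\<lambda>x. g x @ [h x])"
    if "computes e word_code g" "computes e letter_code h" for e :: "'c \<Rightarrow> nat" and g h
    using that unfolding word_code_eq by (intro computes_append computes_Cons computes_const)
  have "computes (enc_prod enc_nf letter_code) enc_nf (\<lambda>p. nf_table_step (fst p) (snd p))"
    unfolding nf_table_step_def
    by (rule computes_If computes_eq[OF _ _ inj_letter_code] computes_table_apply
        computes_free_reduce snoc computes_Pair computes_Suc computes_intros computes_const)+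
  note step = computes_comp2[OF this]
  show ?thesis
    by (rule computes_foldl[OF computes_const _ assms[unfolded word_code_eq]] step computes_intros)+
qed

text \<open>The constants of the bound are fixed, so the length limit is computable from
  \<open>u\<close> and \<open>v\<close>; the candidates can be listed, and each is tested by normal
  forms.\<close>

lemma conjugacy_decidable:
  assumes bound: "\<And>u v. u \<in> words_over (Suc n) \<Longrightarrow> v \<in> words_over (Suc n) \<Longrightarrow>
     conjugate_in GG (val u) (val v) \<longleftrightarrow>
     (\<exists>w\<in>words_over (Suc n). length w \<le> m + b ^ (M * c ^ (length u + length v))
        \<and> val (u @ w) = val (w @ v))"
  shows "conjugacy_problem_solvable GG (free_by_cyclic_gens n N)"
proof -
  define letters where "letters = List.product [0..<Suc n] [False, True]"
  \<comment> \<open>Normal form by way of the tables: computable on all words, and equal to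
    \<open>nf\<close> on words over the generators.\<close>
  define nt where "nt w = foldl nf_table_step ((0, 0), []) w" for w
  define test where "test x y \<longleftrightarrow>
    (fst (fst (nt x)) + snd (fst (nt y))) mod N = (fst (fst (nt y)) + snd (fst (nt x))) mod N
    \<and> snd (nt x) = snd (nt y)" for x y
  define P where "P p \<longleftrightarrow> (\<exists>w\<in>set (words_upto letters (m + b ^ (M * c ^ (length (fst p) + length (snd p))))).
     test (fst p @ w) (w @ snd p))" for p
  note nt = computes_nf_table[folded nt_def]
  have test: "computes e of_bool (\<lambda>x. test (f x) (h x))"
    if fh: "computes e word_code f" "computes e word_code h" for e :: "'c \<Rightarrow> nat" and f h
    unfolding test_def
    by (rule computes_conj computes_eq[OF _ _ inj_word_code] computes_eq[OF _ _ inj_on_id] computes_mod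
        nt[OF fh(1)] nt[OF fh(2)] computes_intros)+
  have len: "computes e id (\<lambda>x. length (f x))" if "computes e word_code f" for e :: "'c \<Rightarrow> nat" and f
    using that unfolding word_code_eq by (rule computes_length)
  have app: "computes e word_code (\<lambda>x. f x @ h x)"
    if "computes e word_code f" "computes e word_code h" for e :: "'c \<Rightarrow> nat" and f h
    using that unfolding word_code_eq by (rule computes_append)
  have upto: "computes e (enc_list word_code) (\<lambda>x. words_upto letters (f x))"
    if "computes e id f" for e :: "'c \<Rightarrow> nat" and f
    using that unfolding word_code_eq by (rule computes_words_upto)
  have "computes (enc_prod word_code word_code) of_bool P"
    unfolding P_def
    by (rule computes_Bex_set test app upto computes_power len computes_intros computes_const)+
  then obtain r where r: "recursive 1 r" "\<And>p. r [enc_prod word_code word_code p] = of_bool (P p)"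
    by (metis computesE)
  have len_gens: "length (free_by_cyclic_gens n N) = Suc n" by (simp add: free_by_cyclic_gens_def)
  have letters: "set letters = {..<Suc n} \<times> UNIV"
    by (auto simp: letters_def)
  show ?thesis
    unfolding conjugacy_problem_solvable_def decidable_word_relation_def len_gens
  proof (intro exI conjI ballI)
    \<comment> \<open>The decision function takes two arguments; pairing them reduces it to the
      unary \<open>r\<close>.\<close>
    show "recursive 2 (\<lambda>xs. r [prod_encode (xs ! 0, xs ! 1)])"
      by (intro recursive_comp1[OF r(1)] recursive_prod_encode recursive.proj) auto
    fix u v assume u: "u \<in> words_over (Suc n)" and v: "v \<in> words_over (Suc n)"
    have test_iff: "test (u @ w) (w @ v) \<longleftrightarrow> val (u @ w) = val (w @ v)" if "w \<in> words_over (Suc n)" for w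
    proof -
      have "u @ w \<in> words_over (Suc n)" "w @ v \<in> words_over (Suc n)"
        using u v that by (auto simp: words_over_def)
      then show ?thesis unfolding test_def nt_def by (simp only: nf_table val_eq_iff)
    qed
    \<comment> \<open>The listed candidates are words over the generators, where the test by tables
      is correct.\<close>
    have "P (u, v) \<longleftrightarrow> conjugate_in GG (val u) (val v)"
      unfolding P_def bound[OF u v] set_words_upto letters
      using test_iff by (auto simp: words_over_def)
    then show "r [prod_encode ([word_code u, word_code v] ! 0, [word_code u, word_code v] ! 1)]
        = (if conjugate_in GG (val u) (val v) then 1 else 0)"
      using r(2)[of "(u, v)"] by (simp add: enc_prod_def)
  qed
qed

end

theorem theorem3p1:
  fixes n N :: nat and \<phi> :: "word \<Rightarrow> word"
  assumes "n \<ge> 2"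
    and "\<phi> \<in> auto (free_group n)"
    and "virtually_inner (free_group n) \<phi>"
    and "N > 0 \<Longrightarrow> \<phi> [^]\<^bsub>AutoGroup (free_group n)\<^esub> N = \<one>\<^bsub>AutoGroup (free_group n)\<^esub>"
  shows "conjugacy_problem_solvable (free_by_cyclic n \<phi> N) (free_by_cyclic_gens n N)"
proof -
  obtain m :: nat and g where mg: "m > 0" "g \<in> carrier (free_group n)"
    "\<phi> [^]\<^bsub>AutoGroup (free_group n)\<^esub> m
      = (\<lambda>x\<in>carrier (free_group n). inv\<^bsub>free_group n\<^esub> g \<otimes>\<^bsub>free_group n\<^esub> x \<otimes>\<^bsub>free_group n\<^esub> g)"
    using assms(3) by (auto simp: virtually_inner_def Inn_def)
  interpret virtually_inner_extension n N \<phi> m g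
    using assms mg by unfold_locales auto
  obtain M c where "\<And>u v. u \<in> words_over (Suc n) \<Longrightarrow> v \<in> words_over (Suc n) \<Longrightarrow>
     conjugate_in GG (val u) (val v) \<longleftrightarrow>
     (\<exists>w\<in>words_over (Suc n). length w \<le> m + Suc (2 * n) ^ (M * c ^ (length u + length v))
        \<and> val (u @ w) = val (w @ v))"
    using conjugate_iff_bounded by blast
  then show ?thesis by (rule conjugacy_decidable)
qed

end
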